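(* Let $\psi\colon\Gamma\to G$ be a surjective homomorphism of groups, let $P_1,P_2\le G$ be $\mathbf{Z}$-equivalent subgroups, and let $\Gamma_i=\psi^{-1}(P_i)$ for $i=1,2$. Then for any $\mathbf{Z}[\Gamma]$-module $A$ and any nonnegative integer $k$, there is a compatible isomorphism $H^k(\Gamma_1,\mathrm{Res}^{\Gamma}_{\Gamma_1}(A))\to H^k(\Gamma_2,\mathrm{Res}^{\Gamma}_{\Gamma_2}(A))$.
   Context: Subgroups $P_1,P_2$ of a group $G$ are $\mathbf{Z}$-equivalent if $\mathbf{Z}[G/P_1]$ and $\mathbf{Z}[G/P_2]$ are isomorphic as left $\mathbf{Z}[G]$-modules. $H^k$ is group cohomology and $\mathrm{Res}^{\Gamma}_{\Gamma_i}(A)$ is $A$ regarded as a $\mathbf{Z}[\Gamma_i]$-module. Write $\mathrm{Res}\colon H^k(\Gamma,A)\to H^k(\Gamma_i,\mathrm{Res}^\Gamma_{\Gamma_i}(A))$ for the restriction map and $\mathrm{Cor}\colon H^k(\Gamma_i,\mathrm{Res}^\Gamma_{\Gamma_i}(A))\to H^k(\Gamma,A)$ for the co-restriction (transfer) map. A homomorphism $\psi_k\colon H^k(\Gamma_1,\mathrm{Res}^\Gamma_{\Gamma_1}(A))\to H^k(\Gamma_2,\mathrm{Res}^\Gamma_{\Gamma_2}(A))$ is compatible if it commutes with these maps: $\psi_k\circ\mathrm{Res}=\mathrm{Res}$ on $H^k(\Gamma,A)$ and $\mathrm{Cor}\circ\psi_k=\mathrm{Cor}$ on $H^k(\Gamma_1,\mathrm{Res}^\Gamma_{\Gamma_1}(A))$.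 *)

theory Defs
  imports "HOL-Algebra.Algebra"
begin

section \<open>Integral group rings and left modules\<close>

text \<open>The biadditive extension of a map \<open>b\<close> on basis elements to formal integer combinations:
  \<open>(\<Sum>\<^sub>g m\<^sub>g g, \<Sum>\<^sub>h n\<^sub>h h) \<mapsto> \<Sum>\<^sub>g\<^sub>,\<^sub>h m\<^sub>g n\<^sub>h b(g,h)\<close>.\<close>

definition frag_extend2 ::
  "('b \<Rightarrow> 'c \<Rightarrow> 'd) \<Rightarrow> ('b \<Rightarrow>\<^sub>0 int) \<Rightarrow> ('c \<Rightarrow>\<^sub>0 int) \<Rightarrow> ('d \<Rightarrow>\<^sub>0 int)"
  where "frag_extend2 b x y = frag_extend (\<lambda>g. frag_extend (\<lambda>h. frag_of (b g h)) y) x"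

definition group_ring :: "('g, 'm) monoid_scheme \<Rightarrow> ('g \<Rightarrow>\<^sub>0 int) ring"
  where "group_ring G =
    \<lparr>carrier = {x. Poly_Mapping.keys x \<subseteq> carrier G},
     monoid.mult = frag_extend2 (monoid.mult G), one = frag_of \<one>\<^bsub>G\<^esub>,
     ring.zero = 0, ring.add = (+)\<rparr>"

text \<open>The library locale \<^locale>\<open>module\<close> requires a commutative ring of scalars, so it does not
  cover modules over group rings. The fields \<^const>\<open>mult\<close> and \<^const>\<open>one\<close>, which every module
  record inherits from rings, are irrelevant here as they are in the library.\<close>

locale left_module = R?: ring R + M?: abelian_group M
  for R :: "('r, 'p) ring_scheme" (structure) and M :: "('r, 'a, 'm) module_scheme" (structure) +
  assumes smult_closed:
      "\<lbrakk>a \<in> carrier R; x \<in> carrier M\<rbrakk> \<Longrightarrow> a \<odot>\<^bsub>M\<^esub> x \<in> carrier M"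
    and smult_l_distr:
      "\<lbrakk>a \<in> carrier R; b \<in> carrier R; x \<in> carrier M\<rbrakk> \<Longrightarrow>
        (a \<oplus>\<^bsub>R\<^esub> b) \<odot>\<^bsub>M\<^esub> x = a \<odot>\<^bsub>M\<^esub> x \<oplus>\<^bsub>M\<^esub> b \<odot>\<^bsub>M\<^esub> x"
    and smult_r_distr:
      "\<lbrakk>a \<in> carrier R; x \<in> carrier M; y \<in> carrier M\<rbrakk> \<Longrightarrow>
        a \<odot>\<^bsub>M\<^esub> (x \<oplus>\<^bsub>M\<^esub> y) = a \<odot>\<^bsub>M\<^esub> x \<oplus>\<^bsub>M\<^esub> a \<odot>\<^bsub>M\<^esub> y"
    and smult_assoc:
      "\<lbrakk>a \<in> carrier R; b \<in> carrier R; x \<in> carrier M\<rbrakk> \<Longrightarrow>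
        (a \<otimes>\<^bsub>R\<^esub> b) \<odot>\<^bsub>M\<^esub> x = a \<odot>\<^bsub>M\<^esub> (b \<odot>\<^bsub>M\<^esub> x)"
    and smult_one: "x \<in> carrier M \<Longrightarrow> \<one>\<^bsub>R\<^esub> \<odot>\<^bsub>M\<^esub> x = x"

definition left_module_iso ::
  "('r, 'p) ring_scheme \<Rightarrow> ('r, 'a, 'm) module_scheme \<Rightarrow> ('r, 'b, 'n) module_scheme \<Rightarrow> ('a \<Rightarrow> 'b) set"
  where "left_module_iso R M N = {f. bij_betw f (carrier M) (carrier N) \<and>
    (\<forall>x\<in>carrier M. \<forall>y\<in>carrier M. f (x \<oplus>\<^bsub>M\<^esub> y) = f x \<oplus>\<^bsub>N\<^esub> f y) \<and>
    (\<forall>r\<in>carrier R. \<forall>x\<in>carrier M. f (r \<odot>\<^bsub>M\<^esub> x) = r \<odot>\<^bsub>N\<^esub> f x)}"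

text \<open>The permutation module \<open>\<int>[G/P]\<close> on the left cosets of \<open>P\<close>, with \<open>g \<cdot> cP = gcP\<close>.\<close>

definition coset_module ::
  "('g, 'm) monoid_scheme \<Rightarrow> 'g set \<Rightarrow> ('g \<Rightarrow>\<^sub>0 int, 'g set \<Rightarrow>\<^sub>0 int) module"
  where "coset_module G P =
    \<lparr>carrier = {x. Poly_Mapping.keys x \<subseteq> lcosets\<^bsub>G\<^esub> P},
     monoid.mult = undefined, one = undefined,
     ring.zero = 0, ring.add = (+),
     smult = frag_extend2 (\<lambda>g c. g <#\<^bsub>G\<^esub> c)\<rparr>"

definition Z_equivalent :: "('g, 'm) monoid_scheme \<Rightarrow> 'g set \<Rightarrow> 'g set \<Rightarrow> bool"
  where "Z_equivalent G P\<^sub>1 P\<^sub>2 \<longleftrightarrow>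
    (\<exists>f. f \<in> left_module_iso (group_ring G) (coset_module G P\<^sub>1) (coset_module G P\<^sub>2))"

lemma frag_extend2_add_left: "frag_extend2 b (x + x') y = frag_extend2 b x y + frag_extend2 b x' y"
  by (simp add: frag_extend2_def frag_extend_add)

lemma frag_extend2_add_right: "frag_extend2 b x (y + y') = frag_extend2 b x y + frag_extend2 b x y'"
  by (simp add: frag_extend2_def frag_extend_def [of _ x] frag_extend_add frag_cmul_distrib2 sum.distrib)

lemma frag_extend2_0 [simp]: "frag_extend2 b 0 y = 0" "frag_extend2 b x 0 = 0"
  using frag_extend2_add_left [of b 0 0 y] frag_extend2_add_right [of b x 0 0] by auto

lemma frag_extend2_diff_left: "frag_extend2 b (x - x') y = frag_extend2 b x y - frag_extend2 b x' y"
  using frag_extend2_add_left [of b "x - x'" x' y] by (simp add: algebra_simps)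

lemma frag_extend2_diff_right: "frag_extend2 b x (y - y') = frag_extend2 b x y - frag_extend2 b x y'"
  using frag_extend2_add_right [of b x "y - y'" y'] by (simp add: algebra_simps)

lemma frag_extend2_of [simp]: "frag_extend2 b (frag_of g) (frag_of h) = frag_of (b g h)"
  by (simp add: frag_extend2_def)

lemma keys_frag_extend2:
  assumes "Poly_Mapping.keys x \<subseteq> S" "Poly_Mapping.keys y \<subseteq> T" "\<And>g h. g \<in> S \<Longrightarrow> h \<in> T \<Longrightarrow> b g h \<in> U"
  shows "Poly_Mapping.keys (frag_extend2 b x y) \<subseteq> U"
proof -
  have "Poly_Mapping.keys (frag_extend (\<lambda>h. frag_of (b g h)) y) \<subseteq> U" if "g \<in> S" for g
    using keys_frag_extend [of "\<lambda>h. frag_of (b g h)" y] assms that by fastforce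
  then show ?thesis
    using keys_frag_extend [of "\<lambda>g. frag_extend (\<lambda>h. frag_of (b g h)) y" x] assms(1)
    unfolding frag_extend2_def by blast
qed

lemma frag_extend2_assoc:
  assumes "Poly_Mapping.keys x \<subseteq> S" "Poly_Mapping.keys y \<subseteq> T" "Poly_Mapping.keys z \<subseteq> U"
    and "\<And>g h c. g \<in> S \<Longrightarrow> h \<in> T \<Longrightarrow> c \<in> U \<Longrightarrow> b (b' g h) c = d g (d' h c)"
  shows "frag_extend2 b (frag_extend2 b' x y) z = frag_extend2 d x (frag_extend2 d' y z)"
  using assms(1)
proof (induction rule: frag_induction)
  case (one g)
  show ?case using assms(2)
  proof (induction rule: frag_induction)
    case (one h)
    show ?case using assms(3)
      by (induction rule: frag_induction)
        (use one \<open>g \<in> S\<close> assms(4) in \<open>simp_all add: frag_extend2_diff_right\<close>)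
  qed (simp_all add: frag_extend2_diff_left frag_extend2_diff_right)
qed (simp_all add: frag_extend2_diff_left)

lemma frag_extend2_unit:
  assumes "Poly_Mapping.keys x \<subseteq> S" "\<And>g. g \<in> S \<Longrightarrow> b e g = g"
  shows "frag_extend2 b (frag_of e) x = x"
  using assms(1) by (induction rule: frag_induction) (use assms(2) in \<open>simp_all add: frag_extend2_diff_right\<close>)

lemma abelian_group_frag:
  assumes "carrier M = {x :: 'c \<Rightarrow>\<^sub>0 int. Poly_Mapping.keys x \<subseteq> S}" "ring.zero M = 0" "ring.add M = (+)"
  shows "abelian_group M"
proof (rule abelian_groupI)
  show "x \<oplus>\<^bsub>M\<^esub> y \<in> carrier M" if "x \<in> carrier M" "y \<in> carrier M" for x y
    using that keys_add [of x y] assms by auto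
  show "\<exists>y\<in>carrier M. y \<oplus>\<^bsub>M\<^esub> x = \<zero>\<^bsub>M\<^esub>" if "x \<in> carrier M" for x
    using that assms by (intro bexI [of _ "- x"]) auto
qed (use assms in \<open>auto simp: algebra_simps\<close>)

lemma ring_group_ring:
  fixes G (structure)
  assumes "group G"
  shows "ring (group_ring G)"
proof -
  interpret group G by fact
  show ?thesis
  proof (rule ringI)
    show "abelian_group (group_ring G)"
      by (rule abelian_group_frag [of _ "carrier G"]) (simp_all add: group_ring_def)
    show "Group.monoid (group_ring G)"
    proof
      fix x y z
      assume x: "x \<in> carrier (group_ring G)"
      show "\<one>\<^bsub>group_ring G\<^esub> \<otimes>\<^bsub>group_ring G\<^esub> x = x"
        using x frag_extend2_unit [of x "carrier G" "monoid.mult G" \<one>] by (simp add: group_ring_def)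
      show "x \<otimes>\<^bsub>group_ring G\<^esub> \<one>\<^bsub>group_ring G\<^esub> = x"
      proof -
        have "Poly_Mapping.keys x \<subseteq> carrier G" using x by (simp add: group_ring_def)
        then have "frag_extend2 (monoid.mult G) x (frag_of \<one>) = x"
          by (induction rule: frag_induction) (simp_all add: frag_extend2_diff_left)
        then show ?thesis by (simp add: group_ring_def)
      qed
      assume y: "y \<in> carrier (group_ring G)"
      show "x \<otimes>\<^bsub>group_ring G\<^esub> y \<in> carrier (group_ring G)"
        using x y keys_frag_extend2 [of x "carrier G" y "carrier G" _ "carrier G"]
        by (simp add: group_ring_def)
      assume z: "z \<in> carrier (group_ring G)"
      show "x \<otimes>\<^bsub>group_ring G\<^esub> y \<otimes>\<^bsub>group_ring G\<^esub> z = x \<otimes>\<^bsub>group_ring G\<^esub> (y \<otimes>\<^bsub>group_ring G\<^esub> z)"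
        using x y z frag_extend2_assoc [of x "carrier G" y "carrier G" z "carrier G"
              "monoid.mult G" "monoid.mult G" "monoid.mult G" "monoid.mult G"]
        by (simp add: group_ring_def m_assoc)
    qed (simp add: group_ring_def keys_frag_of)
  qed (simp_all add: group_ring_def frag_extend2_add_left frag_extend2_add_right)
qed

lemma left_module_coset_module:
  fixes G (structure)
  assumes "group G" "subgroup P G"
  shows "left_module (group_ring G) (coset_module G P)"
proof -
  interpret group G by fact
  have P: "P \<subseteq> carrier G" using assms(2) by (rule subgroup.subset)
  have sub: "c \<subseteq> carrier G" if "c \<in> lcosets P" for c
    using that lcosets_subset_PowG [OF assms(2)] by blast
  have act: "g <# c \<in> lcosets P" if "g \<in> carrier G" "c \<in> lcosets P" for g c
    using that P by (auto simp: LCOSETS_def lcos_m_assoc)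
  show ?thesis
  proof (intro left_module.intro left_module_axioms.intro)
    show "ring (group_ring G)" by (rule ring_group_ring) fact
    show "abelian_group (coset_module G P)"
      by (rule abelian_group_frag [of _ "lcosets P"]) (simp_all add: coset_module_def)
  next
    fix a x assume "a \<in> carrier (group_ring G)" "x \<in> carrier (coset_module G P)"
    then show "a \<odot>\<^bsub>coset_module G P\<^esub> x \<in> carrier (coset_module G P)"
      using keys_frag_extend2 [of a "carrier G" x "lcosets P" "l_coset G" "lcosets P"] act
      by (simp add: group_ring_def coset_module_def)
  next
    fix a b x
    assume "a \<in> carrier (group_ring G)" "b \<in> carrier (group_ring G)" "x \<in> carrier (coset_module G P)"
    then show "(a \<otimes>\<^bsub>group_ring G\<^esub> b) \<odot>\<^bsub>coset_module G P\<^esub> x =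
        a \<odot>\<^bsub>coset_module G P\<^esub> (b \<odot>\<^bsub>coset_module G P\<^esub> x)"
      using frag_extend2_assoc [of a "carrier G" b "carrier G" x "lcosets P"
          "l_coset G" "monoid.mult G" "l_coset G" "l_coset G"] sub
      by (simp add: group_ring_def coset_module_def lcos_m_assoc)
  next
    fix x assume "x \<in> carrier (coset_module G P)"
    then show "\<one>\<^bsub>group_ring G\<^esub> \<odot>\<^bsub>coset_module G P\<^esub> x = x"
      using frag_extend2_unit [of x "lcosets P" "l_coset G" \<one>] sub
      by (simp add: group_ring_def coset_module_def lcos_mult_one)
  qed (simp_all add: group_ring_def coset_module_def frag_extend2_add_left frag_extend2_add_right)
qed

section \<open>Group cohomology\<close>

text \<open>\<open>H\<^sup>k(G,A)\<close> is the cohomology of the complex of homogeneous cochains, that is, of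
  \<open>Hom\<^sub>\<int>\<^sub>[\<^sub>G\<^sub>](F\<^sub>\<bullet>,A)\<close> for the standard free resolution \<open>F\<^sub>k = \<int>[G\<^sup>k\<^sup>+\<^sup>1]\<close> of the trivial module \<open>\<int>\<close>.
  A group element \<open>g\<close> acts on \<open>A\<close> as the scalar \<^term>\<open>frag_of g\<close> of \<open>\<int>[G]\<close>.

  For a subgroup \<open>H\<close> of \<open>G\<close>, the ring \<open>\<int>[H]\<close> is a subring of \<open>\<int>[G]\<close> with the same operations
  (the representation of its elements does not change), so the record of a \<open>\<int>[G]\<close>-module \<open>A\<close>
  is, unchanged, also the record of the restricted module \<open>Res A\<close>; see
  \<open>left_module_restrict\<close> below.\<close>

lemma left_module_restrict:
  assumes "group G" "subgroup H G" "left_module (group_ring G) A"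
  shows "left_module (group_ring (G\<lparr>carrier := H\<rparr>)) A"
proof -
  interpret left_module "group_ring G" A by fact
  have sub: "x \<in> carrier (group_ring G)" if "x \<in> carrier (group_ring (G\<lparr>carrier := H\<rparr>))" for x
    using that subgroup.subset [OF assms(2)] by (auto simp: group_ring_def)
  have ops: "monoid.mult (group_ring (G\<lparr>carrier := H\<rparr>)) = monoid.mult (group_ring G)"
    "ring.add (group_ring (G\<lparr>carrier := H\<rparr>)) = ring.add (group_ring G)"
    "one (group_ring (G\<lparr>carrier := H\<rparr>)) = one (group_ring G)"
    by (simp_all add: group_ring_def)
  show ?thesis
    by (intro left_module.intro left_module_axioms.intro ring_group_ring
        subgroup.subgroup_is_group [OF assms(2,1)] M.abelian_group_axioms)
      (simp_all add: sub ops smult_closed smult_l_distr smult_r_distr smult_assoc smult_one)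
qed

definition tuples :: "('g, 'm) monoid_scheme \<Rightarrow> nat \<Rightarrow> 'g list set"
  where "tuples G k = {xs. length xs = Suc k \<and> set xs \<subseteq> carrier G}"

definition cochain_group ::
  "('g, 'm) monoid_scheme \<Rightarrow> ('g \<Rightarrow>\<^sub>0 int, 'a, 'n) module_scheme \<Rightarrow> nat \<Rightarrow> ('g list \<Rightarrow> 'a) monoid"
  where "cochain_group G A k =
    \<lparr>carrier = {f \<in> tuples G k \<rightarrow>\<^sub>E carrier A.
       \<forall>g\<in>carrier G. \<forall>xs\<in>tuples G k. f (map (\<lambda>x. g \<otimes>\<^bsub>G\<^esub> x) xs) = frag_of g \<odot>\<^bsub>A\<^esub> f xs},
     monoid.mult = (\<lambda>f f'. \<lambda>xs\<in>tuples G k. f xs \<oplus>\<^bsub>A\<^esub> f' xs),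
     one = (\<lambda>xs\<in>tuples G k. \<zero>\<^bsub>A\<^esub>)\<rparr>"

text \<open>\<open>(df)(x\<^sub>0,\<dots>,x\<^sub>k\<^sub>+\<^sub>1) = \<Sum>\<^sub>i (-1)\<^sup>i f(x\<^sub>0,\<dots>,x\<^sub>i\<^sub>-\<^sub>1,x\<^sub>i\<^sub>+\<^sub>1,\<dots>,x\<^sub>k\<^sub>+\<^sub>1)\<close>\<close>

definition cochain_diff ::
  "('g, 'm) monoid_scheme \<Rightarrow> ('g \<Rightarrow>\<^sub>0 int, 'a, 'n) module_scheme \<Rightarrow> nat \<Rightarrow>
    ('g list \<Rightarrow> 'a) \<Rightarrow> ('g list \<Rightarrow> 'a)"
  where "cochain_diff G A k f = (\<lambda>xs\<in>tuples G (Suc k).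
    finsum A (\<lambda>i. let y = f (take i xs @ drop (Suc i) xs) in if even i then y else \<ominus>\<^bsub>A\<^esub> y) {..Suc k})"

definition cocycle_group ::
  "('g, 'm) monoid_scheme \<Rightarrow> ('g \<Rightarrow>\<^sub>0 int, 'a, 'n) module_scheme \<Rightarrow> nat \<Rightarrow> ('g list \<Rightarrow> 'a) monoid"
  where "cocycle_group G A k = (cochain_group G A k)
    \<lparr>carrier := kernel (cochain_group G A k) (cochain_group G A (Suc k)) (cochain_diff G A k)\<rparr>"

definition coboundaries ::
  "('g, 'm) monoid_scheme \<Rightarrow> ('g \<Rightarrow>\<^sub>0 int, 'a, 'n) module_scheme \<Rightarrow> nat \<Rightarrow> ('g list \<Rightarrow> 'a) set"
  where "coboundaries G A k = (case k of
      0 \<Rightarrow> {\<one>\<^bsub>cochain_group G A 0\<^esub>}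
    | Suc j \<Rightarrow> cochain_diff G A j ` carrier (cochain_group G A j))"

definition cohomology ::
  "('g, 'm) monoid_scheme \<Rightarrow> ('g \<Rightarrow>\<^sub>0 int, 'a, 'n) module_scheme \<Rightarrow> nat \<Rightarrow> ('g list \<Rightarrow> 'a) set monoid"
  where "cohomology G A k = cocycle_group G A k Mod coboundaries G A k"

text \<open>The map to \<open>H\<^sup>k(G,A)\<close> induced by a map \<open>\<theta>\<close> of cocycles: the class \<open>[f]\<close>, which is itself a
  set of cocycles, goes to \<open>[\<theta> f]\<close>. The union is over equal cosets when \<open>\<theta>\<close> comes from a cochain map.\<close>

definition induced_map ::
  "('g, 'm) monoid_scheme \<Rightarrow> ('g \<Rightarrow>\<^sub>0 int, 'a, 'n) module_scheme \<Rightarrow> nat \<Rightarrow>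
    (('h list \<Rightarrow> 'a) \<Rightarrow> ('g list \<Rightarrow> 'a)) \<Rightarrow> ('h list \<Rightarrow> 'a) set \<Rightarrow> ('g list \<Rightarrow> 'a) set"
  where "induced_map G A k \<theta> C = (\<Union>f\<in>C. coboundaries G A k #>\<^bsub>cocycle_group G A k\<^esub> \<theta> f)"

definition cohomology_res ::
  "('g, 'm) monoid_scheme \<Rightarrow> 'g set \<Rightarrow> ('g \<Rightarrow>\<^sub>0 int, 'a, 'n) module_scheme \<Rightarrow> nat \<Rightarrow>
    ('g list \<Rightarrow> 'a) set \<Rightarrow> ('g list \<Rightarrow> 'a) set"
  where "cohomology_res G H A k =
    induced_map (G\<lparr>carrier := H\<rparr>) A k (\<lambda>f. restrict f (tuples (G\<lparr>carrier := H\<rparr>) k))"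

text \<open>Co-restriction from a subgroup \<open>H\<close> of finite index. For each right coset \<open>c\<close> of \<open>H\<close> in \<open>G\<close> fix a
  representative \<open>r\<^sub>c\<close>. The map \<open>p(x) = x r\<^sub>H\<^sub>x\<^sup>-\<^sup>1\<close> from \<open>G\<close> to \<open>H\<close> is \<open>H\<close>-equivariant, so it induces a
  comparison of resolutions \<open>\<int>[G\<^sup>k\<^sup>+\<^sup>1] \<rightarrow> \<int>[H\<^sup>k\<^sup>+\<^sup>1]\<close> over \<open>\<int>[H]\<close>. Applying the transfer
  \<open>\<phi> \<mapsto> \<Sum>\<^sub>c r\<^sub>c\<^sup>-\<^sup>1 \<phi>(r\<^sub>c \<cdot>)\<close> to \<open>\<phi> = f \<circ> p\<close> gives the classical formula
  \<open>(Cor f)(x\<^sub>0,\<dots>,x\<^sub>k) = \<Sum>\<^sub>c r\<^sub>c\<^sup>-\<^sup>1 f(p(r\<^sub>c x\<^sub>0),\<dots>,p(r\<^sub>c x\<^sub>k))\<close>.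
  On cohomology it does not depend on the representatives. If the index is infinite, the
  sum over the cosets is not meaningful.\<close>

definition coset_rep :: "'g set \<Rightarrow> 'g"
  where "coset_rep c = (SOME x. x \<in> c)"

definition cochain_cor ::
  "('g, 'm) monoid_scheme \<Rightarrow> 'g set \<Rightarrow> ('g \<Rightarrow>\<^sub>0 int, 'a, 'n) module_scheme \<Rightarrow> nat \<Rightarrow>
    ('g list \<Rightarrow> 'a) \<Rightarrow> ('g list \<Rightarrow> 'a)"
  where "cochain_cor G H A k f =
    (let p = (\<lambda>x. x \<otimes>\<^bsub>G\<^esub> inv\<^bsub>G\<^esub> (coset_rep (H #>\<^bsub>G\<^esub> x))) in
     (\<lambda>xs\<in>tuples G k. finsum A
       (\<lambda>c. frag_of (inv\<^bsub>G\<^esub> (coset_rep c)) \<odot>\<^bsub>A\<^esub> f (map (\<lambda>x. p (coset_rep c \<otimes>\<^bsub>G\<^esub> x)) xs))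
       (rcosets\<^bsub>G\<^esub> H)))"

definition cohomology_cor ::
  "('g, 'm) monoid_scheme \<Rightarrow> 'g set \<Rightarrow> ('g \<Rightarrow>\<^sub>0 int, 'a, 'n) module_scheme \<Rightarrow> nat \<Rightarrow>
    ('g list \<Rightarrow> 'a) set \<Rightarrow> ('g list \<Rightarrow> 'a) set"
  where "cohomology_cor G H A k = induced_map G A k (cochain_cor G H A k)"

text \<open>Co-restriction exists only for subgroups of finite index, so the second square is required to
  commute exactly when both indices are finite. For finite \<open>G\<close>, or preimages of subgroups of a
  finite group, this is always the case.\<close>

definition compatible ::
  "('g, 'm) monoid_scheme \<Rightarrow> 'g set \<Rightarrow> 'g set \<Rightarrow> ('g \<Rightarrow>\<^sub>0 int, 'a, 'n) module_scheme \<Rightarrow> nat \<Rightarrow>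
    (('g list \<Rightarrow> 'a) set \<Rightarrow> ('g list \<Rightarrow> 'a) set) \<Rightarrow> bool"
  where "compatible G H\<^sub>1 H\<^sub>2 A k \<Psi> \<longleftrightarrow>
    \<Psi> \<in> hom (cohomology (G\<lparr>carrier := H\<^sub>1\<rparr>) A k) (cohomology (G\<lparr>carrier := H\<^sub>2\<rparr>) A k) \<and>
    (\<forall>C\<in>carrier (cohomology G A k).
       \<Psi> (cohomology_res G H\<^sub>1 A k C) = cohomology_res G H\<^sub>2 A k C) \<and>
    (finite (rcosets\<^bsub>G\<^esub> H\<^sub>1) \<and> finite (rcosets\<^bsub>G\<^esub> H\<^sub>2) \<longrightarrow>
       (\<forall>D\<in>carrier (cohomology (G\<lparr>carrier := H\<^sub>1\<rparr>) A k).
          cohomology_cor G H\<^sub>2 A k (\<Psi> D) = cohomology_cor G H\<^sub>1 A k D))"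

end

theory Submission
  imports Defs
begin

text \<open>
  The group \<open>H\<^sup>k(\<Gamma>\<^sub>i, A)\<close> is \<open>Ext\<close> over \<open>\<int>[\<Gamma>]\<close> of \<open>\<int>[\<Gamma>/\<Gamma>\<^sub>i]\<close> with values in \<open>A\<close> (Shapiro's lemma), and
  \<open>\<Gamma>/\<Gamma>\<^sub>i = G/P\<^sub>i\<close> as \<open>\<Gamma>\<close>-sets, because \<open>\<psi>\<close> is surjective. An isomorphism of the permutation modules
  therefore induces an isomorphism of the cohomology groups. Under this identification restriction is
  induced by the augmentation \<open>\<int>[\<Gamma>/\<Gamma>\<^sub>i] \<rightarrow> \<int>\<close>, and co-restriction by the norm map \<open>\<int> \<rightarrow> \<int>[\<Gamma>/\<Gamma>\<^sub>i]\<close> that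
  sends \<open>1\<close> to the sum \<open>N\<^sub>i\<close> of all cosets. It is thus enough that the module isomorphism respects
  augmentations and, if the indices are finite, takes \<open>N\<^sub>1\<close> to \<open>N\<^sub>2\<close>.

  An equivariant map multiplies the augmentation by a constant, which for an isomorphism is a unit
  of \<open>\<int>\<close>; changing the sign of the isomorphism makes it \<open>1\<close> (\<open>coset_iso_normalized\<close>). For
  finite indices the invariants of \<open>\<int>[\<Gamma>/\<Gamma>\<^sub>i]\<close> are \<open>\<int>N\<^sub>i\<close>, so \<open>N\<^sub>1\<close> goes to \<open>\<plusminus>N\<^sub>2\<close>, and comparing augmentations, which are the
  positive indices, excludes the minus sign (\<open>coset_iso_norm_element\<close>).

  The \<open>Ext\<close> groups are avoided by working with cochains. Let \<open>C(H, U)\<close> be the complex of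
  \<open>H\<close>-equivariant cochains on tuples from a left \<open>H\<close>-stable set \<open>U\<close>; the definition of \<open>H\<^sup>k(H, A)\<close> uses
  \<open>C(H, H)\<close>. Any two \<open>H\<close>-maps between such sets induce the same map on cohomology, by the prism
  operator (\<open>coclass_pullback_eq\<close>). So the inclusion of \<open>H\<close> and an \<open>H\<close>-map \<open>\<Gamma> \<rightarrow> H\<close> give mutually inverse
  maps between the cohomology of \<open>C(H, H)\<close> and of \<open>C(H, \<Gamma>)\<close>. The cochain form of the identification with
  \<open>Hom\<close> from \<open>\<int>[\<Gamma>/H]\<close> is this: a cochain \<open>f\<close> in \<open>C(H, \<Gamma>)\<close> and an element \<open>z = \<Sum>\<^sub>c z\<^sub>c c\<close> of \<open>\<int>[\<Gamma>/H]\<close> give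
  the function \<open>x \<mapsto> \<Sum>\<^sub>c z\<^sub>c g\<^sub>c f(g\<^sub>c\<^sup>-\<^sup>1 x)\<close>, where \<open>c = g\<^sub>c H\<close>, and if \<open>z\<close> is \<open>K\<close>-invariant, it lies in \<open>C(K, \<Gamma>)\<close>
  (\<open>cochain_map_transfer\<close>). An equivariant map \<open>e : \<int>[\<Gamma>/K] \<rightarrow> \<int>[\<Gamma>/H]\<close> is determined by the \<open>K\<close>-invariant
  element \<open>e(K)\<close>, and composition of such maps corresponds to composition of transfers
  (\<open>transfer_transfer\<close>). Inverse module maps thus give inverse isomorphisms, and co-restriction itself is
  the transfer along the norm element (\<open>cochain_cor_eq\<close>).
\<close>

section \<open>Cochain complexes of abelian groups\<close>

locale cochain_complex =
  fixes C :: "nat \<Rightarrow> 'c monoid" and d :: "nat \<Rightarrow> 'c \<Rightarrow> 'c"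
  assumes comm_group_C: "comm_group (C k)"
    and d_hom: "d k \<in> hom (C k) (C (Suc k))"
    and d_d: "x \<in> carrier (C k) \<Longrightarrow> d (Suc k) (d k x) = \<one>\<^bsub>C (Suc (Suc k))\<^esub>"

text \<open>These are the constructions of \<^const>\<open>cocycle_group\<close>, \<^const>\<open>coboundaries\<close> and \<^const>\<open>induced_map\<close>
for an arbitrary complex: the comparison of two cohomology groups passes through complexes that do
not come from a single group.\<close>

definition cocycles :: "(nat \<Rightarrow> 'c monoid) \<Rightarrow> (nat \<Rightarrow> 'c \<Rightarrow> 'c) \<Rightarrow> nat \<Rightarrow> 'c monoid"
  where "cocycles C d k = (C k)\<lparr>carrier := kernel (C k) (C (Suc k)) (d k)\<rparr>"

definition cobounds :: "(nat \<Rightarrow> 'c monoid) \<Rightarrow> (nat \<Rightarrow> 'c \<Rightarrow> 'c) \<Rightarrow> nat \<Rightarrow> 'c set"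
  where "cobounds C d k = (case k of 0 \<Rightarrow> {\<one>\<^bsub>C 0\<^esub>} | Suc j \<Rightarrow> d j ` carrier (C j))"

definition coclass :: "(nat \<Rightarrow> 'c monoid) \<Rightarrow> (nat \<Rightarrow> 'c \<Rightarrow> 'c) \<Rightarrow> nat \<Rightarrow> 'c \<Rightarrow> 'c set"
  where "coclass C d k z = cobounds C d k #>\<^bsub>cocycles C d k\<^esub> z"

definition class_map ::
  "(nat \<Rightarrow> 'c monoid) \<Rightarrow> (nat \<Rightarrow> 'c \<Rightarrow> 'c) \<Rightarrow> nat \<Rightarrow> ('b \<Rightarrow> 'c) \<Rightarrow> 'b set \<Rightarrow> 'c set"
  where "class_map C d k \<theta> Z = (\<Union>z\<in>Z. coclass C d k (\<theta> z))"

definition cochain_map ::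
  "(nat \<Rightarrow> 'b monoid) \<Rightarrow> (nat \<Rightarrow> 'b \<Rightarrow> 'b) \<Rightarrow> (nat \<Rightarrow> 'c monoid) \<Rightarrow> (nat \<Rightarrow> 'c \<Rightarrow> 'c) \<Rightarrow>
    (nat \<Rightarrow> 'b \<Rightarrow> 'c) \<Rightarrow> bool"
  where "cochain_map C d C' d' \<theta> \<longleftrightarrow>
    (\<forall>k. \<theta> k \<in> hom (C k) (C' k) \<and> (\<forall>x\<in>carrier (C k). d' k (\<theta> k x) = \<theta> (Suc k) (d k x)))"

lemma cochain_map_comp:
  assumes "cochain_map C d C' d' \<theta>" "cochain_map C' d' C'' d'' \<theta>'"
  shows "cochain_map C d C'' d'' (\<lambda>k x. \<theta>' k (\<theta> k x))"
  using assms unfolding cochain_map_def hom_def Pi_iff by simp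

lemma cocycles_simps [simp]:
  "carrier (cocycles C d k) = {z \<in> carrier (C k). d k z = \<one>\<^bsub>C (Suc k)\<^esub>}"
  "monoid.mult (cocycles C d k) = monoid.mult (C k)"
  "one (cocycles C d k) = one (C k)"
  by (auto simp: cocycles_def kernel_def)

context cochain_complex
begin

lemma d_group_hom: "group_hom (C k) (C (Suc k)) (d k)"
  using comm_group_C d_hom by (intro group_hom.intro group_hom_axioms.intro) (auto simp: comm_group_def)

lemma subgroup_cocycles: "subgroup (kernel (C k) (C (Suc k)) (d k)) (C k)"
  by (rule group_hom.subgroup_kernel [OF d_group_hom])

lemma comm_group_cocycles: "comm_group (cocycles C d k)"
proof -
  interpret comm_group "C k" by (rule comm_group_C)
  show ?thesis
    unfolding cocycles_def
    by (intro group.group_comm_groupI subgroup.subgroup_is_group[OF subgroup_cocycles] is_group)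
      (use subgroup.subset[OF subgroup_cocycles] in \<open>auto intro!: m_comm\<close>)
qed

lemma normal_cobounds: "cobounds C d k \<lhd> cocycles C d k"
proof -
  interpret comm_group "cocycles C d k" by (rule comm_group_cocycles)
  have "subgroup (cobounds C d k) (C k)"
  proof (cases k)
    case 0
    then show ?thesis
      using group.triv_subgroup comm_group_C[of 0] by (auto simp: cobounds_def comm_group_def)
  next
    case (Suc j)
    then show ?thesis
      using group_hom.img_is_subgroup [OF d_group_hom, of j] by (simp add: cobounds_def)
  qed
  moreover have "cobounds C d k \<subseteq> kernel (C k) (C (Suc k)) (d k)"
  proof (cases k)
    case 0
    then show ?thesis using subgroup.one_closed[OF subgroup_cocycles[of 0]]
      by (auto simp: cobounds_def)
  next
    case (Suc j)
    then show ?thesis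
      using d_d d_hom[of j] by (auto simp: cobounds_def kernel_def hom_def)
  qed
  ultimately have "subgroup (cobounds C d k) (cocycles C d k)"
    unfolding cocycles_def
    using comm_group_C[of k] subgroup_cocycles[of k]
    by (intro group.subgroup_incl) (auto simp: comm_group_def)
  then show ?thesis by (rule subgroup_imp_normal)
qed

lemma coclass_eqI:
  assumes "z \<in> carrier (cocycles C d k)" "b \<in> cobounds C d k" "z' = b \<otimes>\<^bsub>C k\<^esub> z"
  shows "coclass C d k z' = coclass C d k z"
proof -
  interpret N: normal "cobounds C d k" "cocycles C d k" by (rule normal_cobounds)
  have "z' \<in> cobounds C d k #>\<^bsub>cocycles C d k\<^esub> z"
    using assms by (auto simp: r_coset_def)
  then show ?thesis
    unfolding coclass_def using N.repr_independence[of z' _ z] assms(1) N.subgroup_axioms by blast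
qed

lemma coclass_eqD:
  assumes "z \<in> carrier (cocycles C d k)" "z' \<in> coclass C d k z"
  shows "z' \<in> carrier (cocycles C d k)" "\<exists>b\<in>cobounds C d k. z' = b \<otimes>\<^bsub>C k\<^esub> z"
proof -
  interpret N: normal "cobounds C d k" "cocycles C d k" by (rule normal_cobounds)
  show "z' \<in> carrier (cocycles C d k)"
    using assms N.r_coset_subset_G[OF N.subset] unfolding coclass_def by blast
  show "\<exists>b\<in>cobounds C d k. z' = b \<otimes>\<^bsub>C k\<^esub> z"
    using assms(2) by (auto simp: coclass_def r_coset_def)
qed

lemma self_in_coclass:
  assumes "z \<in> carrier (cocycles C d k)" shows "z \<in> coclass C d k z"
proof -
  interpret N: normal "cobounds C d k" "cocycles C d k" by (rule normal_cobounds)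
  show ?thesis unfolding coclass_def using N.rcos_self[OF assms N.subgroup_axioms] .
qed

lemma carrier_cohomology:
  "carrier (cocycles C d k Mod cobounds C d k) = coclass C d k ` carrier (cocycles C d k)"
  by (auto simp: FactGroup_def RCOSETS_def coclass_def)

lemma coclass_mult:
  assumes "z \<in> carrier (cocycles C d k)" "w \<in> carrier (cocycles C d k)"
  shows "coclass C d k z \<otimes>\<^bsub>cocycles C d k Mod cobounds C d k\<^esub> coclass C d k w =
    coclass C d k (z \<otimes>\<^bsub>C k\<^esub> w)"
  unfolding coclass_def
  using normal.rcos_sum[OF normal_cobounds assms] by (simp add: FactGroup_def)

end

lemma cochain_map_group_hom:
  assumes "cochain_complex C d" "cochain_complex C' d'" "cochain_map C d C' d' \<theta>"
  shows "group_hom (C k) (C' k) (\<theta> k)"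
  using assms(3) cochain_complex.comm_group_C[OF assms(1), of k]
    cochain_complex.comm_group_C[OF assms(2), of k]
  by (intro group_hom.intro group_hom_axioms.intro) (auto simp: comm_group_def cochain_map_def)

lemma cochain_map_cocycle:
  assumes "cochain_complex C d" "cochain_complex C' d'" "cochain_map C d C' d' \<theta>"
    and z: "z \<in> carrier (cocycles C d k)"
  shows "\<theta> k z \<in> carrier (cocycles C' d' k)"
proof -
  have "group_hom (C (Suc k)) (C' (Suc k)) (\<theta> (Suc k))"
    by (rule cochain_map_group_hom[OF assms(1-3)])
  then have "\<theta> (Suc k) \<one>\<^bsub>C (Suc k)\<^esub> = \<one>\<^bsub>C' (Suc k)\<^esub>" by (rule group_hom.hom_one)
  then show ?thesis using assms(3) z by (auto simp: cochain_map_def hom_def)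
qed

lemma cochain_map_cobound:
  assumes "cochain_complex C d" "cochain_complex C' d'" "cochain_map C d C' d' \<theta>"
    and b: "b \<in> cobounds C d k"
  shows "\<theta> k b \<in> cobounds C' d' k"
proof (cases k)
  case 0
  have "group_hom (C 0) (C' 0) (\<theta> 0)"
    by (rule cochain_map_group_hom[OF assms(1-3)])
  then show ?thesis using 0 b group_hom.hom_one by (force simp: cobounds_def)
next
  case (Suc j)
  then show ?thesis using b assms(3) by (force simp: cobounds_def cochain_map_def hom_def)
qed

lemma cobounds_subset:
  assumes "cochain_complex C d" shows "cobounds C d k \<subseteq> carrier (C k)"
  using normal_imp_subgroup[OF cochain_complex.normal_cobounds[OF assms, of k], THEN subgroup.subset]
  by auto

text \<open>The form in which cohomologous cocycles are used below: replacing one cocycle by another of the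
same class is allowed under every cochain map.\<close>

lemma cochain_map_coclass_cong:
  assumes C: "cochain_complex C d" "cochain_complex C' d'" "cochain_map C d C' d' \<theta>"
    and z: "z \<in> carrier (cocycles C d k)" and "w \<in> carrier (cocycles C d k)" 
    and eq: "coclass C d k w = coclass C d k z"
  shows "coclass C' d' k (\<theta> k w) = coclass C' d' k (\<theta> k z)"
proof -
  obtain b where b: "b \<in> cobounds C d k" "w = b \<otimes>\<^bsub>C k\<^esub> z"
    using cochain_complex.coclass_eqD(2)[OF C(1) z] cochain_complex.self_in_coclass[OF C(1) assms(5)] eq
    by blast
  have "b \<in> carrier (C k)" using b(1) cobounds_subset[OF C(1)] by blast
  then have "\<theta> k w = \<theta> k b \<otimes>\<^bsub>C' k\<^esub> \<theta> k z"
    using b z C(3) by (auto simp: cochain_map_def hom_def)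
  then show ?thesis
    using cochain_complex.coclass_eqI[OF C(2) cochain_map_cocycle[OF C z] cochain_map_cobound[OF C b(1)]]
    by blast
qed

text \<open>All members of a class have cohomologous images, so the union that defines \<^const>\<open>class_map\<close> is over
equal cosets.\<close>

lemma class_map_coclass:
  assumes C: "cochain_complex C d" "cochain_complex C' d'" "cochain_map C d C' d' \<theta>"
    and z: "z \<in> carrier (cocycles C d k)"
  shows "class_map C' d' k (\<theta> k) (coclass C d k z) = coclass C' d' k (\<theta> k z)"
proof -
  have "coclass C' d' k (\<theta> k w) = coclass C' d' k (\<theta> k z)" if "w \<in> coclass C d k z" for w
  proof -
    note w = cochain_complex.coclass_eqD[OF C(1) z that]
    show ?thesis
      using w cochain_map_coclass_cong[OF C z w(1)] cochain_complex.coclass_eqI[OF C(1) z] by blast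
  qed
  then show ?thesis
    unfolding class_map_def using cochain_complex.self_in_coclass[OF C(1) z] by blast
qed

text \<open>The two cochain maps need to be inverse to each other only on classes of cocycles of one degree,
and only up to coboundaries.\<close>

lemma class_map_iso:
  assumes C: "cochain_complex C d" "cochain_complex C' d'"
    and \<theta>: "cochain_map C d C' d' \<theta>" and \<theta>': "cochain_map C' d' C d \<theta>'"
    and 1: "\<And>z. z \<in> carrier (cocycles C d k) \<Longrightarrow> coclass C d k (\<theta>' k (\<theta> k z)) = coclass C d k z"
    and 2: "\<And>z. z \<in> carrier (cocycles C' d' k) \<Longrightarrow> coclass C' d' k (\<theta> k (\<theta>' k z)) = coclass C' d' k z"
  shows "class_map C' d' k (\<theta> k) \<in>
    iso (cocycles C d k Mod cobounds C d k) (cocycles C' d' k Mod cobounds C' d' k)"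
proof -
  let ?f = "class_map C' d' k (\<theta> k)" and ?g = "class_map C d k (\<theta>' k)"
  note f = class_map_coclass[OF C \<theta>] and g = class_map_coclass[OF C(2,1) \<theta>']
  note \<theta>c = cochain_map_cocycle[OF C \<theta>] and \<theta>c' = cochain_map_cocycle[OF C(2,1) \<theta>']
  note car = cochain_complex.carrier_cohomology[OF C(1)] cochain_complex.carrier_cohomology[OF C(2)]
  have "bij_betw ?f (carrier (cocycles C d k Mod cobounds C d k)) (carrier (cocycles C' d' k Mod cobounds C' d' k))"
    by (rule bij_betw_byWitness[where f' = ?g])
      (auto simp: car f g \<theta>c \<theta>c' 1 2 simp del: cocycles_simps)
  moreover have "?f \<in> hom (cocycles C d k Mod cobounds C d k) (cocycles C' d' k Mod cobounds C' d' k)"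
  proof (rule homI)
    fix Z assume "Z \<in> carrier (cocycles C d k Mod cobounds C d k)"
    then show "?f Z \<in> carrier (cocycles C' d' k Mod cobounds C' d' k)"
      by (auto simp: car f \<theta>c simp del: cocycles_simps)
    fix Y assume "Y \<in> carrier (cocycles C d k Mod cobounds C d k)"
    with \<open>Z \<in> _\<close> obtain z w where zw: "z \<in> carrier (cocycles C d k)" "w \<in> carrier (cocycles C d k)"
      "Z = coclass C d k z" "Y = coclass C d k w" unfolding car by blast
    interpret Zk: comm_group "cocycles C d k" by (rule cochain_complex.comm_group_cocycles[OF C(1)])
    have m: "z \<otimes>\<^bsub>C k\<^esub> w \<in> carrier (cocycles C d k)"
      using Zk.m_closed[OF zw(1,2)] by (simp only: cocycles_simps)
    have "\<theta> k (z \<otimes>\<^bsub>C k\<^esub> w) = \<theta> k z \<otimes>\<^bsub>C' k\<^esub> \<theta> k w"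
      using zw \<theta> by (auto simp: cochain_map_def hom_def)
    then show "?f (Z \<otimes>\<^bsub>cocycles C d k Mod cobounds C d k\<^esub> Y) =
        ?f Z \<otimes>\<^bsub>cocycles C' d' k Mod cobounds C' d' k\<^esub> ?f Y"
      unfolding zw(3,4) cochain_complex.coclass_mult[OF C(1) zw(1,2)] f[OF m] f[OF zw(1)] f[OF zw(2)]
        cochain_complex.coclass_mult[OF C(2) \<theta>c[OF zw(1)] \<theta>c[OF zw(2)]]
      by simp
  qed
  ultimately show ?thesis by (simp add: iso_def)
qed

section \<open>Evaluating formal integer combinations in an abelian group\<close>

text \<open>The \<open>\<int>\<close>-linear extension of \<open>\<phi>\<close> to formal combinations. Chain-level identities can then be proved
in the type of formal combinations, where the group operations are those of a type class, and
transported to the carrier of \<open>A\<close> afterwards.\<close>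

definition frag_pair :: "('a, 'p) ring_scheme \<Rightarrow> ('x \<Rightarrow> 'a) \<Rightarrow> ('x \<Rightarrow>\<^sub>0 int) \<Rightarrow> 'a"
  where "frag_pair A \<phi> z =
    finsum A (\<lambda>x. [Poly_Mapping.lookup z x] \<cdot>\<^bsub>A\<^esub> \<phi> x) (Poly_Mapping.keys z)"

context abelian_group
begin

lemma frag_pair_superset:
  assumes "finite S" "Poly_Mapping.keys z \<subseteq> S" "\<phi> \<in> S \<rightarrow> carrier G"
  shows "frag_pair G \<phi> z = finsum G (\<lambda>x. [Poly_Mapping.lookup z x] \<cdot> \<phi> x) S"
proof -
  have 0: "add_pow G (0::int) a = \<zero>" for a by (simp add: add_pow_def)
  show ?thesis
    unfolding frag_pair_def
    by (rule add.finprod_mono_neutral_cong_left)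
      (use assms in \<open>auto simp: Pi_iff in_keys_iff 0 intro!: add.int_pow_closed\<close>)
qed

lemma frag_pair_closed [simp, intro]:
  assumes "\<phi> \<in> Poly_Mapping.keys z \<rightarrow> carrier G" shows "frag_pair G \<phi> z \<in> carrier G"
  unfolding frag_pair_def using assms by (intro finsum_closed) auto

lemma frag_pair_0 [simp]: "frag_pair G \<phi> 0 = \<zero>"
  by (simp add: frag_pair_def)

lemma frag_pair_of [simp]: "\<phi> x \<in> carrier G \<Longrightarrow> frag_pair G \<phi> (frag_of x) = \<phi> x"
  by (simp add: frag_pair_def keys_frag_of)

lemma frag_pair_add:
  assumes "Poly_Mapping.keys z \<subseteq> S" "Poly_Mapping.keys w \<subseteq> S" "\<phi> \<in> S \<rightarrow> carrier G"
  shows "frag_pair G \<phi> (z + w) = frag_pair G \<phi> z \<oplus> frag_pair G \<phi> w"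
proof -
  let ?T = "Poly_Mapping.keys z \<union> Poly_Mapping.keys w"
  have \<phi>: "\<phi> \<in> ?T \<rightarrow> carrier G" using assms by auto
  have "Poly_Mapping.keys (z + w) \<subseteq> ?T" by (rule keys_add)
  then have "frag_pair G \<phi> (z + w) = finsum G (\<lambda>x. [Poly_Mapping.lookup (z + w) x] \<cdot> \<phi> x) ?T"
    using \<phi> by (intro frag_pair_superset) auto
  also have "\<dots> = finsum G (\<lambda>x. [Poly_Mapping.lookup z x] \<cdot> \<phi> x \<oplus> [Poly_Mapping.lookup w x] \<cdot> \<phi> x) ?T"
    by (rule finsum_cong') (use \<phi> in \<open>auto simp: lookup_add Pi_iff intro: add.int_pow_mult\<close>)
  also have "\<dots> = frag_pair G \<phi> z \<oplus> frag_pair G \<phi> w"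
    using \<phi> by (simp add: frag_pair_superset[of ?T] Pi_iff)
  finally show ?thesis .
qed

lemma frag_pair_diff:
  assumes "Poly_Mapping.keys z \<subseteq> S" "Poly_Mapping.keys w \<subseteq> S" "\<phi> \<in> S \<rightarrow> carrier G"
  shows "frag_pair G \<phi> (z - w) = frag_pair G \<phi> z \<ominus> frag_pair G \<phi> w"
proof -
  have k: "Poly_Mapping.keys (z - w) \<subseteq> S" using keys_diff[of z w] assms by blast
  have c: "frag_pair G \<phi> z \<in> carrier G" "frag_pair G \<phi> w \<in> carrier G" "frag_pair G \<phi> (z - w) \<in> carrier G"
    using assms k by (auto intro!: frag_pair_closed)
  have "frag_pair G \<phi> z = frag_pair G \<phi> (z - w) \<oplus> frag_pair G \<phi> w"
    using frag_pair_add[OF k assms(2,3)] by simp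
  then show ?thesis using c by (simp add: minus_eq a_assoc r_neg)
qed

end

text \<open>The bound on the support is kept in the induction step, where the additivity of \<^const>\<open>frag_pair\<close>
needs it.\<close>

lemma frag_induction_support [consumes 1, case_names zero one diff]:
  assumes "Poly_Mapping.keys c \<subseteq> S" "P 0" "\<And>x. x \<in> S \<Longrightarrow> P (frag_of x)"
    and "\<And>a b. Poly_Mapping.keys a \<subseteq> S \<Longrightarrow> Poly_Mapping.keys b \<subseteq> S \<Longrightarrow> P a \<Longrightarrow> P b \<Longrightarrow> P (a - b)"
  shows "P c"
proof -
  have "Poly_Mapping.keys c \<subseteq> S \<and> P c"
    using assms(1)
  proof (induction rule: frag_induction)
    case (diff a b) then show ?case using assms(4) keys_diff[of a b] by blast
  qed (use assms in \<open>auto simp: keys_frag_of\<close>)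
  then show ?thesis ..
qed

context abelian_group
begin

lemma frag_pair_extend:
  assumes "Poly_Mapping.keys z \<subseteq> S" "\<And>x. x \<in> S \<Longrightarrow> Poly_Mapping.keys (b x) \<subseteq> T" "\<phi> \<in> T \<rightarrow> carrier G"
  shows "frag_pair G \<phi> (frag_extend b z) = frag_pair G (\<lambda>x. frag_pair G \<phi> (b x)) z"
  using assms(1)
proof (induction rule: frag_induction_support)
  case (one x)
  have "frag_pair G \<phi> (b x) \<in> carrier G" using assms(2)[OF one] assms(3) by (intro frag_pair_closed) auto
  then show ?case by simp
next
  case (diff a c)
  have k: "Poly_Mapping.keys (frag_extend b y) \<subseteq> T" if "Poly_Mapping.keys y \<subseteq> S" for y
    using keys_frag_extend[of b y] that assms(2) by blast
  have "(\<lambda>x. frag_pair G \<phi> (b x)) \<in> S \<rightarrow> carrier G"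
    using assms(2,3) by (auto intro!: frag_pair_closed)
  then show ?case
    using diff k by (simp add: frag_extend_diff frag_pair_diff[OF _ _ assms(3)] frag_pair_diff[of _ S])
qed simp

lemma frag_pair_cong:
  assumes "\<And>x. x \<in> Poly_Mapping.keys z \<Longrightarrow> \<phi> x = \<phi>' x" "\<phi>' \<in> Poly_Mapping.keys z \<rightarrow> carrier G"
  shows "frag_pair G \<phi> z = frag_pair G \<phi>' z"
  unfolding frag_pair_def by (rule finsum_cong') (use assms in \<open>auto simp: Pi_iff intro!: add.int_pow_closed\<close>)

lemma frag_pair_hom:
  assumes "\<phi> \<in> Poly_Mapping.keys z \<rightarrow> carrier G" "\<alpha> \<in> carrier G \<rightarrow> carrier G"
    and "\<And>a b. a \<in> carrier G \<Longrightarrow> b \<in> carrier G \<Longrightarrow> \<alpha> (a \<oplus> b) = \<alpha> a \<oplus> \<alpha> b"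
  shows "\<alpha> (frag_pair G \<phi> z) = frag_pair G (\<lambda>x. \<alpha> (\<phi> x)) z"
proof -
  have h: "\<alpha> \<in> hom (add_monoid G) (add_monoid G)" using assms by (auto simp: hom_def)
  interpret h: group_hom "add_monoid G" "add_monoid G" \<alpha>
    using h by (intro group_hom.intro group_hom_axioms.intro add.is_group)
  have z: "\<alpha> \<zero> = \<zero>" using h.hom_one by simp
  have m: "\<alpha> (a \<ominus> b) = \<alpha> a \<ominus> \<alpha> b" if "a \<in> carrier G" "b \<in> carrier G" for a b
    using h.hom_inv[of b] that assms(2,3) by (auto simp: minus_eq a_inv_def)
  define S where "S = Poly_Mapping.keys z"
  have "Poly_Mapping.keys z \<subseteq> S" "\<phi> \<in> S \<rightarrow> carrier G" using assms(1) by (auto simp: S_def)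
  then show ?thesis
  proof (induction rule: frag_induction_support)
    case (one x) then show ?case using assms(2) by (auto simp: Pi_iff)
  next
    case (diff a c)
    have "(\<lambda>x. \<alpha> (\<phi> x)) \<in> S \<rightarrow> carrier G" using diff.prems assms(2) by auto
    moreover have "frag_pair G \<phi> a \<in> carrier G" "frag_pair G \<phi> c \<in> carrier G"
      using diff.hyps diff.prems by (auto intro!: frag_pair_closed)
    ultimately show ?case
      using diff by (simp add: frag_pair_diff[of _ S] m)
  qed (simp add: z)
qed

lemma frag_pair_add_fun:
  assumes "\<phi> \<in> Poly_Mapping.keys z \<rightarrow> carrier G" "\<phi>' \<in> Poly_Mapping.keys z \<rightarrow> carrier G"
  shows "frag_pair G (\<lambda>x. \<phi> x \<oplus> \<phi>' x) z = frag_pair G \<phi> z \<oplus> frag_pair G \<phi>' z"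
proof -
  have "finsum G (\<lambda>x. [Poly_Mapping.lookup z x] \<cdot> (\<phi> x \<oplus> \<phi>' x)) (Poly_Mapping.keys z) =
    finsum G (\<lambda>x. [Poly_Mapping.lookup z x] \<cdot> \<phi> x \<oplus> [Poly_Mapping.lookup z x] \<cdot> \<phi>' x) (Poly_Mapping.keys z)"
    by (rule finsum_cong') (use assms in \<open>auto simp: Pi_iff add.int_pow_distrib\<close>)
  then show ?thesis
    using assms by (simp add: frag_pair_def finsum_addf Pi_iff)
qed

lemma frag_pair_diff_fun:
  assumes "\<phi> \<in> Poly_Mapping.keys z \<rightarrow> carrier G" "\<phi>' \<in> Poly_Mapping.keys z \<rightarrow> carrier G"
  shows "frag_pair G (\<lambda>x. \<phi> x \<ominus> \<phi>' x) z = frag_pair G \<phi> z \<ominus> frag_pair G \<phi>' z"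
proof -
  have "frag_pair G (\<lambda>x. \<ominus> \<phi>' x) z = \<ominus> frag_pair G \<phi>' z"
    using assms(2) by (subst frag_pair_hom[where \<alpha> = "\<lambda>a. \<ominus> a"]) (auto simp: minus_add)
  then show ?thesis
    using frag_pair_add_fun[OF assms(1), of "\<lambda>x. \<ominus> \<phi>' x"] assms(2) by (simp add: minus_eq Pi_iff)
qed

text \<open>Interchange of two finite sums. It makes the differential, a sum over faces, commute with the
transfer, a sum over cosets.\<close>

lemma frag_pair_swap:
  assumes "\<And>x y. x \<in> Poly_Mapping.keys z \<Longrightarrow> y \<in> Poly_Mapping.keys w \<Longrightarrow> F x y \<in> carrier G"
  shows "frag_pair G (\<lambda>x. frag_pair G (F x) w) z = frag_pair G (\<lambda>y. frag_pair G (\<lambda>x. F x y) z) w"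
proof -
  define S where "S = Poly_Mapping.keys z"
  have "Poly_Mapping.keys z \<subseteq> S" "\<And>x y. x \<in> S \<Longrightarrow> y \<in> Poly_Mapping.keys w \<Longrightarrow> F x y \<in> carrier G"
    using assms by (auto simp: S_def)
  then show ?thesis
  proof (induction rule: frag_induction_support)
    case zero
    then show ?case by (simp add: frag_pair_def add.int_pow_one)
  next
    case (one x)
    have "frag_pair G (F x) w \<in> carrier G" using one by (intro frag_pair_closed) auto
    moreover have "frag_pair G (\<lambda>y. frag_pair G (\<lambda>x. F x y) (frag_of x)) w = frag_pair G (F x) w"
      using one by (intro frag_pair_cong) auto
    ultimately show ?case by simp
  next
    case (diff a b)
    have l: "(\<lambda>x. frag_pair G (F x) w) \<in> S \<rightarrow> carrier G"
      using diff.prems by (auto intro!: frag_pair_closed)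
    have r: "(\<lambda>y. frag_pair G (\<lambda>x. F x y) v) \<in> Poly_Mapping.keys w \<rightarrow> carrier G"
      if "Poly_Mapping.keys v \<subseteq> S" for v
      using diff.prems that by (auto intro!: frag_pair_closed)
    have "frag_pair G (\<lambda>y. frag_pair G (\<lambda>x. F x y) (a - b)) w =
        frag_pair G (\<lambda>y. frag_pair G (\<lambda>x. F x y) a \<ominus> frag_pair G (\<lambda>x. F x y) b) w"
    proof (rule frag_pair_cong)
      fix y assume y: "y \<in> Poly_Mapping.keys w"
      show "frag_pair G (\<lambda>x. F x y) (a - b) = frag_pair G (\<lambda>x. F x y) a \<ominus> frag_pair G (\<lambda>x. F x y) b"
        using diff y by (intro frag_pair_diff[of _ S]) auto
    qed (use r diff.hyps in \<open>auto simp: Pi_iff\<close>)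
    also have "\<dots> = frag_pair G (\<lambda>y. frag_pair G (\<lambda>x. F x y) a) w \<ominus> frag_pair G (\<lambda>y. frag_pair G (\<lambda>x. F x y) b) w"
      using r diff.hyps by (intro frag_pair_diff_fun) auto
    finally show ?case
      using diff l by (simp add: frag_pair_diff[of _ S])
  qed
qed

end

section \<open>The simplicial boundary and the prism operator on lists\<close>

text \<open>The alternating sum of the faces of a simplex. Deleting the head gives the first face, and the faces
that keep the head are those of the tail, with the opposite sign. The recursion turns the usual
computations with double sums over faces into structural inductions; \<open>bd_eq_sum\<close> gives the closed
form.\<close>

fun bd :: "'x list \<Rightarrow> ('x list \<Rightarrow>\<^sub>0 int)" where
  "bd [] = 0"
| "bd (x # xs) = frag_of xs - frag_extend (\<lambda>ys. frag_of (x # ys)) (bd xs)"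

text \<open>The alternating sum of the simplices \<open>(u x\<^sub>0, \<dots>, u x\<^sub>i, v x\<^sub>i, \<dots>, v x\<^sub>n)\<close>, which triangulate the prism between the
images of \<open>(x\<^sub>0, \<dots>, x\<^sub>n)\<close> under \<open>u\<close> and \<open>v\<close>.\<close>

fun prism :: "('x \<Rightarrow> 'y) \<Rightarrow> ('x \<Rightarrow> 'y) \<Rightarrow> 'x list \<Rightarrow> ('y list \<Rightarrow>\<^sub>0 int)" where
  "prism u v [] = 0"
| "prism u v (x # xs) = frag_of (u x # v x # map v xs) - frag_extend (\<lambda>ys. frag_of (u x # ys)) (prism u v xs)"

lemma bd_extend_Cons:
  "frag_extend bd (frag_extend (\<lambda>ys. frag_of (x # ys)) z) =
    z - frag_extend (\<lambda>ys. frag_of (x # ys)) (frag_extend bd z)"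
  using subset_UNIV[of "Poly_Mapping.keys z"]
  by (induction z rule: frag_induction) (simp_all add: frag_extend_diff)

lemma prism_extend_Cons:
  "frag_extend (prism u v) (frag_extend (\<lambda>ys. frag_of (x # ys)) z) =
    frag_extend (\<lambda>ys. frag_of (u x # v x # map v ys)) z
    - frag_extend (\<lambda>ys. frag_of (u x # ys)) (frag_extend (prism u v) z)"
  using subset_UNIV[of "Poly_Mapping.keys z"]
  by (induction z rule: frag_induction) (simp_all add: frag_extend_diff)

lemma frag_extend_of_of: 
  "frag_extend (\<lambda>y. frag_of (f y)) (frag_extend (\<lambda>x. frag_of (g x)) z) = frag_extend (\<lambda>x. frag_of (f (g x))) z"
  using subset_UNIV[of "Poly_Mapping.keys z"]
  by (induction z rule: frag_induction) (simp_all add: frag_extend_diff)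

lemma bd_map: "bd (map u xs) = frag_extend (\<lambda>ys. frag_of (map u ys)) (bd xs)"
  by (induction xs) (simp_all add: frag_extend_diff frag_extend_of_of)

lemma bd_bd: "frag_extend bd (bd xs) = 0"
  by (induction xs) (simp_all add: frag_extend_diff bd_extend_Cons)

text \<open>The boundary of a prism consists of the top, the bottom, and the prism over the boundary. For a
list with head \<open>x\<close>, the faces of \<open>(u x, v x, v x\<^sub>1, \<dots>)\<close> that keep \<open>u x\<close> and \<open>v x\<close> cancel against the first
terms of the prisms over those faces of the list that keep \<open>x\<close>.\<close>

lemma prism_homotopy:
  "frag_extend bd (prism u v xs) + frag_extend (prism u v) (bd xs) = frag_of (map v xs) - frag_of (map u xs)"
proof (induction xs)
  case (Cons x xs)
  let ?P = "frag_extend (\<lambda>ys. frag_of (u x # ys))" 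
  have "frag_extend bd (prism u v xs) = frag_of (map v xs) - frag_of (map u xs) - frag_extend (prism u v) (bd xs)"
    using Cons.IH by (simp add: algebra_simps)
  then show ?case
    by (simp add: frag_extend_diff bd_extend_Cons prism_extend_Cons bd_map frag_extend_of_of)
qed simp

lemma prism_map:
  assumes "\<And>x. x \<in> set xs \<Longrightarrow> u (a x) = b (u x)" "\<And>x. x \<in> set xs \<Longrightarrow> v (a x) = b (v x)"
  shows "prism u v (map a xs) = frag_extend (\<lambda>ys. frag_of (map b ys)) (prism u v xs)"
  using assms by (induction xs) (simp_all add: frag_extend_diff frag_extend_of_of comp_def cong: map_cong)

definition lists_of :: "'x set \<Rightarrow> nat \<Rightarrow> 'x list set"
  where "lists_of U n = {xs. length xs = n \<and> set xs \<subseteq> U}"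

lemma keys_frag_extend_subset:
  assumes "Poly_Mapping.keys z \<subseteq> S" "\<And>x. x \<in> S \<Longrightarrow> Poly_Mapping.keys (b x) \<subseteq> T"
  shows "Poly_Mapping.keys (frag_extend b z) \<subseteq> T"
  using assms keys_frag_extend[of b z] by blast

lemma keys_bd: "xs \<in> lists_of U (Suc n) \<Longrightarrow> Poly_Mapping.keys (bd xs) \<subseteq> lists_of U n"
proof (induction n arbitrary: xs)
  case 0
  then obtain x where "xs = [x]" by (auto simp: lists_of_def length_Suc_conv)
  then show ?case by (simp add: keys_frag_of lists_of_def)
next
  case (Suc n)
  then obtain x ys where xs: "xs = x # ys" "x \<in> U" "ys \<in> lists_of U (Suc n)"
    by (auto simp: lists_of_def length_Suc_conv)
  have "Poly_Mapping.keys (frag_extend (\<lambda>ys. frag_of (x # ys)) (bd ys)) \<subseteq> lists_of U (Suc n)"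
    by (rule keys_frag_extend_subset[OF Suc.IH[OF xs(3)]])
      (use xs(2) in \<open>auto simp: keys_frag_of lists_of_def\<close>)
  then show ?case
    unfolding xs(1) bd.simps using xs(3) keys_diff by (fastforce simp: keys_frag_of)
qed

lemma keys_prism:
  assumes "xs \<in> lists_of U n" "u \<in> U \<rightarrow> V" "v \<in> U \<rightarrow> V"
  shows "Poly_Mapping.keys (prism u v xs) \<subseteq> lists_of V (Suc n)"
  using assms(1)
proof (induction n arbitrary: xs)
  case 0
  then show ?case by (simp add: lists_of_def)
next
  case (Suc n)
  then obtain x ys where xs: "xs = x # ys" "x \<in> U" "ys \<in> lists_of U n"
    by (auto simp: lists_of_def length_Suc_conv)
  have "Poly_Mapping.keys (frag_extend (\<lambda>ys. frag_of (u x # ys)) (prism u v ys)) \<subseteq> lists_of V (Suc (Suc n))"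
    by (rule keys_frag_extend_subset[OF Suc.IH[OF xs(3)]])
      (use xs(2) assms in \<open>auto simp: keys_frag_of lists_of_def\<close>)
  moreover have "u x # v x # map v ys \<in> lists_of V (Suc (Suc n))"
    using xs assms by (auto simp: lists_of_def)
  ultimately show ?case
    unfolding xs(1) prism.simps using keys_diff by (fastforce simp: keys_frag_of)
qed

lemma bd_eq_sum:
  "bd xs = (\<Sum>i<length xs. frag_cmul ((-1) ^ i) (frag_of (take i xs @ drop (Suc i) xs)))"
proof (induction xs)
  case (Cons x xs)
  show ?case
    by (simp add: Cons.IH sum.lessThan_Suc_shift frag_extend_sum frag_extend_cmul sum_negf[symmetric] 
       del: sum.lessThan_Suc)
qed simp

section \<open>Equivariant cochains of a group module\<close>

lemma (in abelian_group) frag_pair_sum: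
  assumes "finite I" "\<And>i. i \<in> I \<Longrightarrow> Poly_Mapping.keys (c i) \<subseteq> S" "\<phi> \<in> S \<rightarrow> carrier G"
  shows "frag_pair G \<phi> (sum c I) = finsum G (\<lambda>i. frag_pair G \<phi> (c i)) I"
  using assms(1,2)
proof (induction I rule: finite_induct)
  case (insert i I)
  have "Poly_Mapping.keys (sum c I) \<subseteq> S" using insert.prems Poly_Mapping.keys_sum[of c I] by fastforce
  moreover have "frag_pair G \<phi> (c j) \<in> carrier G" if "j \<in> insert i I" for j
    using insert.prems[OF that] assms(3) by (intro frag_pair_closed) auto
  ultimately show ?case
    using insert assms(3) by (simp add: frag_pair_add[of _ S] Pi_iff)
qed simp

locale group_module = G: group G + A: abelian_group A
  for G :: "('g, 'm) monoid_scheme" (structure) and A :: "('g \<Rightarrow>\<^sub>0 int, 'a, 'n) module_scheme" +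
  assumes act_closed: "\<lbrakk>g \<in> carrier G; a \<in> carrier A\<rbrakk> \<Longrightarrow> frag_of g \<odot>\<^bsub>A\<^esub> a \<in> carrier A"
    and act_add: "\<lbrakk>g \<in> carrier G; a \<in> carrier A; b \<in> carrier A\<rbrakk> \<Longrightarrow>
      frag_of g \<odot>\<^bsub>A\<^esub> (a \<oplus>\<^bsub>A\<^esub> b) = frag_of g \<odot>\<^bsub>A\<^esub> a \<oplus>\<^bsub>A\<^esub> frag_of g \<odot>\<^bsub>A\<^esub> b"
    and act_mult: "\<lbrakk>g \<in> carrier G; h \<in> carrier G; a \<in> carrier A\<rbrakk> \<Longrightarrow>
      frag_of (g \<otimes> h) \<odot>\<^bsub>A\<^esub> a = frag_of g \<odot>\<^bsub>A\<^esub> (frag_of h \<odot>\<^bsub>A\<^esub> a)"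
    and act_one: "a \<in> carrier A \<Longrightarrow> frag_of \<one> \<odot>\<^bsub>A\<^esub> a = a"

text \<open>The cochain complex is built from the addition of \<open>A\<close> and the action of group elements by additive
maps, which is the form in which a \<open>\<int>[G]\<close>-module is used from here on.\<close>

lemma group_module_left_module:
  assumes "group G" "left_module (group_ring G) A"
  shows "group_module G A"
proof -
  interpret group G by fact
  interpret left_module "group_ring G" A by fact
  have of: "frag_of g \<in> carrier (group_ring G)" if "g \<in> carrier G" for g
    using that by (simp add: group_ring_def keys_frag_of)
  show ?thesis
  proof
    show "frag_of (g \<otimes>\<^bsub>G\<^esub> h) \<odot>\<^bsub>A\<^esub> a = frag_of g \<odot>\<^bsub>A\<^esub> (frag_of h \<odot>\<^bsub>A\<^esub> a)"
      if "g \<in> carrier G" "h \<in> carrier G" "a \<in> carrier A" for g h a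
      using smult_assoc[OF of of] that by (simp add: group_ring_def)
    show "frag_of \<one>\<^bsub>G\<^esub> \<odot>\<^bsub>A\<^esub> a = a" if "a \<in> carrier A" for a
      using smult_one[OF that] by (simp add: group_ring_def)
  qed (simp_all add: of smult_closed smult_r_distr)
qed

text \<open>The complex \<open>C(H, U)\<close>. Two cases matter: \<open>U = H\<close>, where it is the complex that defines \<open>H\<^sup>k(H, A)\<close>, and
\<open>U\<close> the whole group, where cochains for different subgroups \<open>H\<close> live on the same tuples and can be
compared. The cohomology of both is \<open>H\<^sup>k(H, A)\<close>, since the tuples from the whole group also give a free
resolution of \<open>\<int>\<close> over \<open>\<int>[H]\<close>.\<close>

definition equivariant_cochains ::
  "('g, 'm) monoid_scheme \<Rightarrow> ('g \<Rightarrow>\<^sub>0 int, 'a, 'n) module_scheme \<Rightarrow> 'g set \<Rightarrow> 'g set \<Rightarrow> nat \<Rightarrow>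
    ('g list \<Rightarrow> 'a) monoid"
  where "equivariant_cochains G A H U k =
    \<lparr>carrier = {f \<in> lists_of U (Suc k) \<rightarrow>\<^sub>E carrier A.
       \<forall>g\<in>H. \<forall>xs\<in>lists_of U (Suc k). f (map (\<lambda>x. g \<otimes>\<^bsub>G\<^esub> x) xs) = frag_of g \<odot>\<^bsub>A\<^esub> f xs},
     monoid.mult = (\<lambda>f f'. \<lambda>xs\<in>lists_of U (Suc k). f xs \<oplus>\<^bsub>A\<^esub> f' xs),
     one = (\<lambda>xs\<in>lists_of U (Suc k). \<zero>\<^bsub>A\<^esub>)\<rparr>"

definition list_diff :: "('a, 'p) ring_scheme \<Rightarrow> 'x set \<Rightarrow> nat \<Rightarrow> ('x list \<Rightarrow> 'a) \<Rightarrow> ('x list \<Rightarrow> 'a)"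
  where "list_diff A U k f = (\<lambda>xs\<in>lists_of U (Suc (Suc k)). frag_pair A f (bd xs))"

definition pullback :: "'y set \<Rightarrow> ('y \<Rightarrow> 'x) \<Rightarrow> nat \<Rightarrow> ('x list \<Rightarrow> 'a) \<Rightarrow> ('y list \<Rightarrow> 'a)"
  where "pullback V u k f = (\<lambda>xs\<in>lists_of V (Suc k). f (map u xs))"

definition stable_under :: "('g, 'm) monoid_scheme \<Rightarrow> 'g set \<Rightarrow> 'g set \<Rightarrow> bool"
  where "stable_under G H U \<longleftrightarrow> H \<subseteq> carrier G \<and> U \<subseteq> carrier G \<and> (\<forall>h\<in>H. \<forall>x\<in>U. h \<otimes>\<^bsub>G\<^esub> x \<in> U)"

lemma tuples_eq: "tuples (G\<lparr>carrier := U\<rparr>) k = lists_of U (Suc k)" "tuples G k = lists_of (carrier G) (Suc k)"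
  by (simp_all add: tuples_def lists_of_def)

lemma cochain_group_eq:
  "cochain_group (G\<lparr>carrier := H\<rparr>) A = equivariant_cochains G A H H"
  "cochain_group G A = equivariant_cochains G A (carrier G) (carrier G)"
  by (simp_all add: fun_eq_iff cochain_group_def equivariant_cochains_def tuples_eq)

lemma map_lists_of: "xs \<in> lists_of V n \<Longrightarrow> u \<in> V \<rightarrow> U \<Longrightarrow> map u xs \<in> lists_of U n"
  by (auto simp: lists_of_def)

lemma face_lists_of:
  assumes "xs \<in> lists_of U (Suc n)" "i \<le> n" 
  shows "take i xs @ drop (Suc i) xs \<in> lists_of U n"
  using assms set_take_subset[of i xs] set_drop_subset[of "Suc i" xs] by (auto simp: lists_of_def)


context group_module
begin

abbreviation EC where "EC \<equiv> equivariant_cochains G A"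

lemma cochain_diff_eq:
  assumes "f \<in> lists_of (carrier L) (Suc k) \<rightarrow> carrier A"
  shows "cochain_diff L A k f = list_diff A (carrier L) k f"
proof -
  have "finsum A (\<lambda>i. let y = f (take i xs @ drop (Suc i) xs) in if even i then y else \<ominus>\<^bsub>A\<^esub> y) {..Suc k} =
      frag_pair A f (bd xs)" if xs: "xs \<in> lists_of (carrier L) (Suc (Suc k))" for xs
  proof -
    let ?S = "lists_of (carrier L) (Suc k)"
    let ?y = "\<lambda>i. take i xs @ drop (Suc i) xs"
    let ?c = "\<lambda>i. frag_cmul ((-1) ^ i) (frag_of (?y i))"
    have y: "?y i \<in> ?S" if "i \<in> {..Suc k}" for i
      using face_lists_of[OF xs] that by simp
    then have c: "Poly_Mapping.keys (?c i) \<subseteq> ?S" if "i \<in> {..Suc k}" for i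
      using that by (auto simp: keys_frag_of)
    have "{..<length xs} = {..Suc k}" using xs by (auto simp: lists_of_def)
    then have "frag_pair A f (bd xs) = finsum A (\<lambda>i. frag_pair A f (?c i)) {..Suc k}"
      unfolding bd_eq_sum using A.frag_pair_sum[OF _ c assms, of "{..Suc k}" "\<lambda>i. i"] by simp
    also have "\<dots> = finsum A (\<lambda>i. let y = f (?y i) in if even i then y else \<ominus>\<^bsub>A\<^esub> y) {..Suc k}"
    proof (rule A.finsum_cong')
      fix i assume i: "i \<in> {..Suc k}"
      have fy: "f (?y i) \<in> carrier A" using y[OF i] assms by blast
      have "frag_pair A f (0 - frag_of (?y i)) = \<ominus>\<^bsub>A\<^esub> f (?y i)"
        using y[OF i] fy assms by (subst A.frag_pair_diff[of _ ?S]) (auto simp: keys_frag_of A.minus_eq)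
      then show "frag_pair A f (?c i) = (let y = f (?y i) in if even i then y else \<ominus>\<^bsub>A\<^esub> y)"
        using fy by (auto simp: Let_def)
    qed (use y funcset_mem[OF assms] in \<open>auto simp: Let_def\<close>)
    finally show ?thesis by simp
  qed
  then show ?thesis
    unfolding cochain_diff_def list_diff_def tuples_eq by (intro restrict_ext) auto
qed

lemma EC_simps:
  "f \<in> carrier (EC H U k) \<longleftrightarrow> f \<in> lists_of U (Suc k) \<rightarrow>\<^sub>E carrier A \<and>
     (\<forall>g\<in>H. \<forall>xs\<in>lists_of U (Suc k). f (map (\<lambda>x. g \<otimes> x) xs) = frag_of g \<odot>\<^bsub>A\<^esub> f xs)"
  "monoid.mult (EC H U k) = (\<lambda>f f'. \<lambda>xs\<in>lists_of U (Suc k). f xs \<oplus>\<^bsub>A\<^esub> f' xs)"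
  "one (EC H U k) = (\<lambda>xs\<in>lists_of U (Suc k). \<zero>\<^bsub>A\<^esub>)"
  by (auto simp: equivariant_cochains_def)

lemma EC_closed: "f \<in> carrier (EC H U k) \<Longrightarrow> xs \<in> lists_of U (Suc k) \<Longrightarrow> f xs \<in> carrier A"
  by (auto simp: EC_simps)

lemma EC_eq:
  "f \<in> carrier (EC H U k) \<Longrightarrow> g \<in> H \<Longrightarrow> xs \<in> lists_of U (Suc k) \<Longrightarrow>
    f (map (\<lambda>x. g \<otimes> x) xs) = frag_of g \<odot>\<^bsub>A\<^esub> f xs"
  by (auto simp: EC_simps)

lemma EC_ext:
  "f \<in> carrier (EC H U k) \<Longrightarrow> f' \<in> carrier (EC H' U k) \<Longrightarrow> (\<And>xs. xs \<in> lists_of U (Suc k) \<Longrightarrow> f xs = f' xs) \<Longrightarrow> f = f'"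
  unfolding EC_simps by (elim conjE PiE_ext) auto

lemma ECI:
  assumes "\<And>xs. xs \<in> lists_of U (Suc k) \<Longrightarrow> f xs \<in> carrier A" "stable_under G H U"
    and "\<And>g xs. g \<in> H \<Longrightarrow> xs \<in> lists_of U (Suc k) \<Longrightarrow> f (map (\<lambda>x. g \<otimes> x) xs) = frag_of g \<odot>\<^bsub>A\<^esub> f xs"
  shows "restrict f (lists_of U (Suc k)) \<in> carrier (EC H U k)"
proof -
  have "map (\<lambda>x. g \<otimes> x) xs \<in> lists_of U (Suc k)" if "g \<in> H" "xs \<in> lists_of U (Suc k)" for g xs
    using that assms(2) by (intro map_lists_of[of _ U]) (auto simp: stable_under_def)
  then show ?thesis using assms by (auto simp: EC_simps)
qed

lemma act_group_hom: "g \<in> carrier G \<Longrightarrow> group_hom (add_monoid A) (add_monoid A) (\<lambda>a. frag_of g \<odot>\<^bsub>A\<^esub> a)"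
  using act_closed act_add
  by (intro group_hom.intro group_hom_axioms.intro A.add.is_group) (auto simp: hom_def)

lemma act_zero: "g \<in> carrier G \<Longrightarrow> frag_of g \<odot>\<^bsub>A\<^esub> \<zero>\<^bsub>A\<^esub> = \<zero>\<^bsub>A\<^esub>"
  using group_hom.hom_one[OF act_group_hom] by simp

lemma act_minus: "g \<in> carrier G \<Longrightarrow> a \<in> carrier A \<Longrightarrow> frag_of g \<odot>\<^bsub>A\<^esub> (\<ominus>\<^bsub>A\<^esub> a) = \<ominus>\<^bsub>A\<^esub> (frag_of g \<odot>\<^bsub>A\<^esub> a)"
  using group_hom.hom_inv[OF act_group_hom] by (simp add: a_inv_def)

lemma act_frag_pair:
  assumes "g \<in> carrier G" "\<phi> \<in> Poly_Mapping.keys z \<rightarrow> carrier A"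
  shows "frag_of g \<odot>\<^bsub>A\<^esub> frag_pair A \<phi> z = frag_pair A (\<lambda>x. frag_of g \<odot>\<^bsub>A\<^esub> \<phi> x) z"
  using assms by (intro A.frag_pair_hom) (auto intro: act_closed act_add)

lemma frag_pair_map:
  assumes "Poly_Mapping.keys z \<subseteq> S" "\<And>x. x \<in> S \<Longrightarrow> f (u x) \<in> carrier A"
  shows "frag_pair A f (frag_extend (\<lambda>x. frag_of (u x)) z) = frag_pair A (\<lambda>x. f (u x)) z"
proof -
  have "frag_pair A f (frag_extend (\<lambda>x. frag_of (u x)) z) = frag_pair A (\<lambda>x. frag_pair A f (frag_of (u x))) z"
    by (rule A.frag_pair_extend[OF assms(1), of _ "u ` S"]) (use assms(2) in \<open>auto simp: keys_frag_of\<close>)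
  also have "\<dots> = frag_pair A (\<lambda>x. f (u x)) z"
    by (rule A.frag_pair_cong) (use assms in auto)
  finally show ?thesis .
qed

lemma comm_group_EC:
  assumes "stable_under G H U" shows "comm_group (EC H U k)"
proof (rule group.group_comm_groupI)
  let ?L = "lists_of U (Suc k)"
  have H: "H \<subseteq> carrier G" using assms by (simp add: stable_under_def)
  note c = EC_closed[of _ H U k] 
  have one: "one (EC H U k) \<in> carrier (EC H U k)"
    unfolding EC_simps(3) by (rule ECI) (use assms H in \<open>auto simp: act_zero subset_iff\<close>)
  have mult: "monoid.mult (EC H U k) f f' \<in> carrier (EC H U k)"
    if "f \<in> carrier (EC H U k)" "f' \<in> carrier (EC H U k)" for f f'
    unfolding EC_simps(2) by (rule ECI) (use assms that H in \<open>auto simp: c EC_eq act_add subset_iff\<close>)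
  show "group (EC H U k)"
  proof (rule groupI)
    fix f assume f: "f \<in> carrier (EC H U k)"
    have inv: "(\<lambda>xs\<in>?L. \<ominus>\<^bsub>A\<^esub> f xs) \<in> carrier (EC H U k)"
      by (rule ECI) (use assms f H in \<open>auto simp: c EC_eq act_minus subset_iff\<close>)
    show "\<exists>f'\<in>carrier (EC H U k). monoid.mult (EC H U k) f' f = one (EC H U k)"
      by (rule bexI[OF _ inv]) (auto simp: EC_simps(2,3) A.l_neg c[OF f] intro: restrict_ext)
    show "monoid.mult (EC H U k) (one (EC H U k)) f = f"
      by (rule EC_ext[OF mult[OF one f] f]) (simp add: EC_simps(2,3) c[OF f])
    fix f' f'' assume f': "f' \<in> carrier (EC H U k)" "f'' \<in> carrier (EC H U k)"
    show "monoid.mult (EC H U k) (monoid.mult (EC H U k) f f') f'' =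
      monoid.mult (EC H U k) f (monoid.mult (EC H U k) f' f'')"
      using f f' by (auto simp: EC_simps(2) c A.a_assoc intro: restrict_ext)
  qed (auto intro: one mult)
  show "monoid.mult (EC H U k) f f' = monoid.mult (EC H U k) f' f"
    if "f \<in> carrier (EC H U k)" "f' \<in> carrier (EC H U k)" for f f'
    using that by (auto simp: EC_simps(2) c A.a_comm intro: restrict_ext)
qed

lemma list_diff_apply: "xs \<in> lists_of U (Suc (Suc k)) \<Longrightarrow> list_diff A U k f xs = frag_pair A f (bd xs)"
  by (simp add: list_diff_def)

lemma list_diff_closed:
  assumes "stable_under G H U" "f \<in> carrier (EC H U k)"
  shows "list_diff A U k f \<in> carrier (EC H U (Suc k))"
  unfolding list_diff_def
proof (rule ECI)
  fix xs assume xs: "xs \<in> lists_of U (Suc (Suc k))"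
  note k = keys_bd[OF xs]
  show "frag_pair A f (bd xs) \<in> carrier A"
    using k assms EC_closed by (intro A.frag_pair_closed) blast
  fix g assume g: "g \<in> H"
  have gc: "g \<in> carrier G" using g assms by (auto simp: stable_under_def)
  have "frag_pair A f (bd (map (\<lambda>x. g \<otimes> x) xs)) = frag_pair A (\<lambda>ys. f (map (\<lambda>x. g \<otimes> x) ys)) (bd xs)"
    unfolding bd_map
    by (rule frag_pair_map[OF k]) (use g gc assms in \<open>auto simp: EC_eq EC_closed act_closed\<close>)
  also have "\<dots> = frag_pair A (\<lambda>ys. frag_of g \<odot>\<^bsub>A\<^esub> f ys) (bd xs)"
    by (rule A.frag_pair_cong) (use k g gc assms in \<open>auto simp: EC_eq EC_closed act_closed subset_iff\<close>)
  also have "\<dots> = frag_of g \<odot>\<^bsub>A\<^esub> frag_pair A f (bd xs)"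
    by (rule act_frag_pair[symmetric]) (use k gc assms EC_closed in blast)+
  finally show "frag_pair A f (bd (map (\<lambda>x. g \<otimes> x) xs)) = frag_of g \<odot>\<^bsub>A\<^esub> frag_pair A f (bd xs)" .
qed fact

lemma frag_pair_EC_mult:
  assumes "f \<in> carrier (EC H U k)" "f' \<in> carrier (EC H U k)" "Poly_Mapping.keys z \<subseteq> lists_of U (Suc k)"
  shows "frag_pair A (monoid.mult (EC H U k) f f') z = frag_pair A f z \<oplus>\<^bsub>A\<^esub> frag_pair A f' z"
proof -
  have c: "f \<in> Poly_Mapping.keys z \<rightarrow> carrier A" "f' \<in> Poly_Mapping.keys z \<rightarrow> carrier A"
    using assms EC_closed by blast+
  have "frag_pair A (monoid.mult (EC H U k) f f') z = frag_pair A (\<lambda>x. f x \<oplus>\<^bsub>A\<^esub> f' x) z"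
    by (rule A.frag_pair_cong) (use c assms(3) in \<open>auto simp: EC_simps(2) subset_iff\<close>)
  then show ?thesis using A.frag_pair_add_fun[OF c] by simp
qed

lemma cochain_complex_EC:
  assumes "stable_under G H U" shows "cochain_complex (EC H U) (list_diff A U)"
proof (rule cochain_complex.intro)
  fix k
  show "comm_group (EC H U k)" by (rule comm_group_EC) fact
  show "list_diff A U k \<in> hom (EC H U k) (EC H U (Suc k))"
  proof (rule homI)
    fix f f' assume f: "f \<in> carrier (EC H U k)" "f' \<in> carrier (EC H U k)"
    show "list_diff A U k (f \<otimes>\<^bsub>EC H U k\<^esub> f') = list_diff A U k f \<otimes>\<^bsub>EC H U (Suc k)\<^esub> list_diff A U k f'"
      by (auto simp: list_diff_def EC_simps(2)[of H U "Suc k"] frag_pair_EC_mult[OF f keys_bd] intro!: restrict_ext)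
  qed (rule list_diff_closed[OF assms])
  fix f assume f: "f \<in> carrier (EC H U k)"
  have "frag_pair A (list_diff A U k f) (bd xs) = \<zero>\<^bsub>A\<^esub>" if xs: "xs \<in> lists_of U (Suc (Suc (Suc k)))" for xs
  proof -
    have "frag_pair A (list_diff A U k f) (bd xs) = frag_pair A (\<lambda>ys. frag_pair A f (bd ys)) (bd xs)"
      using keys_bd[OF xs] keys_bd[of _ U "Suc k"] EC_closed[OF f]
      by (intro A.frag_pair_cong) (auto simp: list_diff_apply subset_iff intro!: A.frag_pair_closed)
    also have "\<dots> = frag_pair A f (frag_extend bd (bd xs))"
      by (rule A.frag_pair_extend[symmetric, OF keys_bd[OF xs] keys_bd]) (use EC_closed[OF f] in auto)
    finally show ?thesis by (simp add: bd_bd)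
  qed
  then show "list_diff A U (Suc k) (list_diff A U k f) = \<one>\<^bsub>EC H U (Suc (Suc k))\<^esub>"
    unfolding EC_simps(3) list_diff_def[of A U "Suc k"] by (intro restrict_ext) simp
qed

lemma cochain_map_pullback:
  assumes "stable_under G H U" "stable_under G H V" "u \<in> V \<rightarrow> U"
    and u: "\<And>h x. h \<in> H \<Longrightarrow> x \<in> V \<Longrightarrow> u (h \<otimes> x) = h \<otimes> u x"
  shows "cochain_map (EC H U) (list_diff A U) (EC H V) (list_diff A V) (pullback V u)"
  unfolding cochain_map_def
proof (intro allI conjI ballI)
  fix k
  show "pullback V u k \<in> hom (EC H U k) (EC H V k)"
  proof (rule homI)
    fix f assume f: "f \<in> carrier (EC H U k)"
    show "pullback V u k f \<in> carrier (EC H V k)"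
      unfolding pullback_def
    proof (rule ECI)
      fix xs assume xs: "xs \<in> lists_of V (Suc k)"
      note uxs = map_lists_of[OF xs assms(3)]
      show "f (map u xs) \<in> carrier A" by (rule EC_closed[OF f uxs])
      fix g assume g: "g \<in> H"
      have eq: "map u (map (\<lambda>x. g \<otimes> x) xs) = map (\<lambda>x. g \<otimes> x) (map u xs)"
        using xs g u by (auto simp: lists_of_def)
      show "f (map u (map (\<lambda>x. g \<otimes> x) xs)) = frag_of g \<odot>\<^bsub>A\<^esub> f (map u xs)"
        unfolding eq by (rule EC_eq[OF f g uxs])
    qed fact
  next
    fix f f'
    show "pullback V u k (f \<otimes>\<^bsub>EC H U k\<^esub> f') = pullback V u k f \<otimes>\<^bsub>EC H V k\<^esub> pullback V u k f'"
      using map_lists_of[OF _ assms(3)] by (auto simp: pullback_def EC_simps(2) intro!: restrict_ext)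
  qed
  fix f assume f: "f \<in> carrier (EC H U k)"
  show "list_diff A V k (pullback V u k f) = pullback V u (Suc k) (list_diff A U k f)"
    unfolding list_diff_def[of A V] pullback_def[of V u "Suc k"]
  proof (rule restrict_ext)
    fix xs assume xs: "xs \<in> lists_of V (Suc (Suc k))"
    note c = EC_closed[OF f map_lists_of[OF _ assms(3)]]
    have "frag_pair A (pullback V u k f) (bd xs) = frag_pair A (\<lambda>ys. f (map u ys)) (bd xs)"
      using keys_bd[OF xs] c by (intro A.frag_pair_cong) (auto simp: pullback_def)
    also have "\<dots> = frag_pair A f (bd (map u xs))"
      unfolding bd_map using frag_pair_map[OF keys_bd[OF xs], of f "map u"] c by simp
    also have "\<dots> = list_diff A U k f (map u xs)"
      using map_lists_of[OF xs assms(3)] by (simp add: list_diff_apply)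
    finally show "frag_pair A (pullback V u k f) (bd xs) = list_diff A U k f (map u xs)" .
  qed
qed

text \<open>Composing a cocycle with the prism operator gives a cochain of degree one less, whose coboundary is
the difference of the two pullbacks. It is equivariant because \<open>u\<close> and \<open>v\<close> are. In degree \<open>0\<close> there
is no such cochain, but there the homotopy formula already says that the pullbacks are equal: the
prism over the empty list is \<open>0\<close>.\<close>

lemma coclass_pullback_eq:
  assumes "stable_under G H U" "stable_under G H V" "u \<in> V \<rightarrow> U" "v \<in> V \<rightarrow> U"
    and u: "\<And>h x. h \<in> H \<Longrightarrow> x \<in> V \<Longrightarrow> u (h \<otimes> x) = h \<otimes> u x"
    and v: "\<And>h x. h \<in> H \<Longrightarrow> x \<in> V \<Longrightarrow> v (h \<otimes> x) = h \<otimes> v x"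
    and f: "f \<in> carrier (cocycles (EC H U) (list_diff A U) k)"
  shows "coclass (EC H V) (list_diff A V) k (pullback V v k f) =
    coclass (EC H V) (list_diff A V) k (pullback V u k f)"
proof -
  let ?P = "prism u v"
  have fC: "f \<in> carrier (EC H U k)" and fd: "list_diff A U k f = \<one>\<^bsub>EC H U (Suc k)\<^esub>"
    using f by simp_all
  note fc = EC_closed[OF fC]
  have f0: "frag_pair A f (bd ys) = \<zero>\<^bsub>A\<^esub>" if "ys \<in> lists_of U (Suc (Suc k))" for ys
    using fun_cong[OF fd, of ys] that by (simp add: list_diff_apply EC_simps(3))
  note kP = keys_prism[OF _ assms(3,4)]
  have Pc: "frag_pair A f (?P ys) \<in> carrier A" if "ys \<in> lists_of V k" for ys
    using kP[OF that] fc by (intro A.frag_pair_closed) auto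
  have homotopy: "f (map v xs) = frag_pair A (\<lambda>ys. frag_pair A f (?P ys)) (bd xs) \<oplus>\<^bsub>A\<^esub> f (map u xs)"
    if xs: "xs \<in> lists_of V (Suc k)" for xs
  proof -
    let ?S = "lists_of U (Suc k)" 
    have fS: "f \<in> ?S \<rightarrow> carrier A" using fc by auto
    note us = map_lists_of[OF xs assms(3)] and vs = map_lists_of[OF xs assms(4)]
    have k1: "Poly_Mapping.keys (frag_extend bd (?P xs)) \<subseteq> ?S"
      by (rule keys_frag_extend_subset[OF kP[OF xs] keys_bd])
    have k2: "Poly_Mapping.keys (frag_extend ?P (bd xs)) \<subseteq> ?S"
      by (rule keys_frag_extend_subset[OF keys_bd[OF xs] kP])
    \<comment> \<open>This term is the prism operator applied to the coboundary of \<open>f\<close>, and \<open>f\<close> is a cocycle.\<close>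
    have "frag_pair A f (frag_extend bd (?P xs)) = frag_pair A (\<lambda>ys. frag_pair A f (bd ys)) (?P xs)"
      by (rule A.frag_pair_extend[OF kP[OF xs] keys_bd fS])
    also have "\<dots> = frag_pair A (\<lambda>ys. \<zero>\<^bsub>A\<^esub>) (?P xs)"
      using kP[OF xs] f0 by (intro A.frag_pair_cong) auto
    also have "\<dots> = \<zero>\<^bsub>A\<^esub>" by (simp add: frag_pair_def A.add.int_pow_one)
    finally have 1: "frag_pair A f (frag_extend bd (?P xs)) = \<zero>\<^bsub>A\<^esub>" .
    have 2: "frag_pair A f (frag_extend ?P (bd xs)) = frag_pair A (\<lambda>ys. frag_pair A f (?P ys)) (bd xs)"
      by (rule A.frag_pair_extend[OF keys_bd[OF xs] kP fS])
    have c2: "frag_pair A f (frag_extend ?P (bd xs)) \<in> carrier A"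
      using k2 fS by (intro A.frag_pair_closed) auto
    have "frag_of (map v xs) = frag_extend bd (?P xs) + frag_extend ?P (bd xs) + frag_of (map u xs)"
      unfolding prism_homotopy by simp
    then have "f (map v xs) = frag_pair A f (frag_extend bd (?P xs) + frag_extend ?P (bd xs) + frag_of (map u xs))"
      using fc[OF vs] by (metis A.frag_pair_of)
    also have "\<dots> = frag_pair A f (frag_extend bd (?P xs)) \<oplus>\<^bsub>A\<^esub> frag_pair A f (frag_extend ?P (bd xs)) \<oplus>\<^bsub>A\<^esub> f (map u xs)"
      using k1 k2 us fc[OF us] keys_add[of "frag_extend bd (?P xs)" "frag_extend ?P (bd xs)"]
      by (subst A.frag_pair_add[OF _ _ fS] A.frag_pair_add[OF k1 k2 fS]; auto simp: keys_frag_of)+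
    finally show ?thesis using 1 2 c2 fc[OF us] by simp
  qed
  note pc = cochain_map_cocycle[OF cochain_complex_EC[OF assms(1)] cochain_complex_EC[OF assms(2)]
      cochain_map_pullback[OF assms(1-3) u] f]
  show ?thesis
  proof (cases k)
    case 0
    have "pullback V v k f = pullback V u k f"
      unfolding pullback_def
    proof (rule restrict_ext)
      fix xs assume xs: "xs \<in> lists_of V (Suc k)"
      then obtain x where "xs = [x]" using 0 by (auto simp: lists_of_def length_Suc_conv)
      then show "f (map v xs) = f (map u xs)"
        using homotopy[OF xs] fc[OF map_lists_of[OF xs assms(3)]] Pc[of "[]"] 0
        by (simp add: lists_of_def)
    qed
    then show ?thesis by simp
  next
    case (Suc j)
    define b where "b = (\<lambda>ys\<in>lists_of V k. frag_pair A f (?P ys))"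
    have "b \<in> carrier (EC H V j)"
      unfolding b_def Suc
    proof (rule ECI)
      fix ys assume ys: "ys \<in> lists_of V (Suc j)"
      then show "frag_pair A f (?P ys) \<in> carrier A" using Pc Suc by simp
      fix g assume g: "g \<in> H"
      have gc: "g \<in> carrier G" using g assms by (auto simp: stable_under_def)
      note k = kP[OF ys, folded Suc]
      have eq: "?P (map (\<lambda>x. g \<otimes> x) ys) = frag_extend (\<lambda>ys. frag_of (map (\<lambda>x. g \<otimes> x) ys)) (?P ys)"
        by (rule prism_map) (use ys g u v in \<open>auto simp: lists_of_def\<close>)
      have "frag_pair A f (?P (map (\<lambda>x. g \<otimes> x) ys)) = frag_pair A (\<lambda>ys. f (map (\<lambda>x. g \<otimes> x) ys)) (?P ys)"
        unfolding eq by (rule frag_pair_map[OF k]) (use g gc fC in \<open>auto simp: EC_eq EC_closed act_closed\<close>)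
      also have "\<dots> = frag_pair A (\<lambda>ys. frag_of g \<odot>\<^bsub>A\<^esub> f ys) (?P ys)"
        by (rule A.frag_pair_cong) (use k g gc fC in \<open>auto simp: EC_eq EC_closed act_closed subset_iff\<close>)
      also have "\<dots> = frag_of g \<odot>\<^bsub>A\<^esub> frag_pair A f (?P ys)"
        by (rule act_frag_pair[symmetric]) (use k gc fc in blast)+
      finally show "frag_pair A f (?P (map (\<lambda>x. g \<otimes> x) ys)) = frag_of g \<odot>\<^bsub>A\<^esub> frag_pair A f (?P ys)" .
    qed fact
    then have "list_diff A V j b \<in> cobounds (EC H V) (list_diff A V) k"
      by (simp add: Suc cobounds_def)
    moreover have "pullback V v k f = list_diff A V j b \<otimes>\<^bsub>EC H V k\<^esub> pullback V u k f"
      unfolding EC_simps(2) pullback_def[of V v]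
    proof (rule restrict_ext)
      fix xs assume xs: "xs \<in> lists_of V (Suc k)"
      have "list_diff A V j b xs = frag_pair A (\<lambda>ys. frag_pair A f (?P ys)) (bd xs)"
        unfolding list_diff_def
        using xs Suc keys_bd[OF xs] Pc by (auto simp: b_def intro!: A.frag_pair_cong)
      then show "f (map v xs) = list_diff A V j b xs \<oplus>\<^bsub>A\<^esub> pullback V u k f xs"
        using homotopy[OF xs] xs by (simp add: pullback_def)
    qed
    ultimately show ?thesis
      using cochain_complex.coclass_eqI[OF cochain_complex_EC[OF assms(2)] pc] by blast
  qed
qed

lemma cochain_map_subgroup:
  assumes "K \<subseteq> H"
  shows "cochain_map (EC H U) (list_diff A U) (EC K U) (list_diff A U) (\<lambda>k f. f)"
  using assms by (auto simp: cochain_map_def hom_def EC_simps subset_iff)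

end

section \<open>Permutation modules on cosets\<close>

definition frag_act :: "('g, 'm) monoid_scheme \<Rightarrow> 'g \<Rightarrow> ('g set \<Rightarrow>\<^sub>0 int) \<Rightarrow> ('g set \<Rightarrow>\<^sub>0 int)"
  where "frag_act G g = frag_extend (\<lambda>c. frag_of (g <#\<^bsub>G\<^esub> c))"

text \<open>The \<open>\<int>[G]\<close>-linear maps \<open>\<int>[G/P] \<rightarrow> \<int>[G/Q]\<close>. Additivity and equivariance under group elements together
amount to linearity over the group ring.\<close>

definition coset_hom :: "('g, 'm) monoid_scheme \<Rightarrow> 'g set \<Rightarrow> 'g set \<Rightarrow>
    (('g set \<Rightarrow>\<^sub>0 int) \<Rightarrow> ('g set \<Rightarrow>\<^sub>0 int)) \<Rightarrow> bool"
  where "coset_hom G P Q f \<longleftrightarrow>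
    (\<forall>z. Poly_Mapping.keys z \<subseteq> lcosets\<^bsub>G\<^esub> P \<longrightarrow> Poly_Mapping.keys (f z) \<subseteq> lcosets\<^bsub>G\<^esub> Q \<and>
      (\<forall>g\<in>carrier G. f (frag_act G g z) = frag_act G g (f z)) \<and>
      (\<forall>w. Poly_Mapping.keys w \<subseteq> lcosets\<^bsub>G\<^esub> P \<longrightarrow> f (z + w) = f z + f w))"

text \<open>The augmentation. The integers are represented as the free abelian group on one generator, so that
the augmentation inherits its additivity from \<^const>\<open>frag_extend\<close>, and \<^term>\<open>frag_of ()\<close> plays the
role of the integer \<open>1\<close>.\<close>

definition augment :: "('x \<Rightarrow>\<^sub>0 int) \<Rightarrow> (unit \<Rightarrow>\<^sub>0 int)"
  where "augment = frag_extend (\<lambda>_. frag_of ())"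

definition norm_element :: "('g, 'm) monoid_scheme \<Rightarrow> 'g set \<Rightarrow> ('g set \<Rightarrow>\<^sub>0 int)"
  where "norm_element G P = (\<Sum>c\<in>lcosets\<^bsub>G\<^esub> P. frag_of c)"

lemma coset_homD:
  assumes "coset_hom G P Q f" "Poly_Mapping.keys z \<subseteq> lcosets\<^bsub>G\<^esub> P"
  shows "Poly_Mapping.keys (f z) \<subseteq> lcosets\<^bsub>G\<^esub> Q"
    and "g \<in> carrier G \<Longrightarrow> f (frag_act G g z) = frag_act G g (f z)"
    and "Poly_Mapping.keys w \<subseteq> lcosets\<^bsub>G\<^esub> P \<Longrightarrow> f (z + w) = f z + f w"
  using assms unfolding coset_hom_def by blast+

lemma coset_hom_diff:
  assumes "coset_hom G P Q f" "Poly_Mapping.keys z \<subseteq> lcosets\<^bsub>G\<^esub> P" "Poly_Mapping.keys w \<subseteq> lcosets\<^bsub>G\<^esub> P"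
  shows "f (z - w) = f z - f w"
proof -
  have "Poly_Mapping.keys (z - w) \<subseteq> lcosets\<^bsub>G\<^esub> P" using assms keys_diff[of z w] by blast
  then have "f (z - w + w) = f (z - w) + f w" by (rule coset_homD(3)[OF assms(1) _ assms(3)])
  then show ?thesis by simp
qed

lemma coset_hom_0: "coset_hom G P Q f \<Longrightarrow> f 0 = 0"
  using coset_hom_diff[of G P Q f 0 0] by simp

context group
begin

lemma lcos_closed: "\<lbrakk>subgroup H G; g \<in> carrier G; c \<in> lcosets H\<rbrakk> \<Longrightarrow> g <# c \<in> lcosets H"
  using subgroup.subset[of H G] by (auto simp: LCOSETS_def lcos_m_assoc)

lemma lcos_of_subgroup: "subgroup H G \<Longrightarrow> H \<in> lcosets H"
  using subgroup.subset[of H G] by (auto simp: LCOSETS_def intro!: bexI[of _ \<one>] lcos_mult_one[symmetric])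

lemma lcosetE:
  assumes "c \<in> lcosets H" obtains g where "g \<in> carrier G" "c = g <# H"
  using assms by (auto simp: LCOSETS_def)

lemma coset_rep_lcoset:
  assumes "subgroup H G" "g \<in> carrier G"
  shows "\<exists>h\<in>H. coset_rep (g <# H) = g \<otimes> h"
proof -
  have "coset_rep (g <# H) \<in> g <# H"
    unfolding coset_rep_def by (rule someI) (rule lcos_self[OF assms(2,1)])
  then show ?thesis by (auto simp: l_coset_def)
qed

lemma coset_rep_rcoset:
  assumes "subgroup H G" "g \<in> carrier G"
  shows "\<exists>h\<in>H. coset_rep (H #> g) = h \<otimes> g"
proof -
  have "coset_rep (H #> g) \<in> H #> g"
    unfolding coset_rep_def by (rule someI) (rule rcos_self[OF assms(2,1)])
  then show ?thesis by (auto simp: r_coset_def)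
qed

lemma coset_rep_closed:
  assumes H: "subgroup H G"
  shows "c \<in> lcosets H \<Longrightarrow> coset_rep c \<in> carrier G" "c \<in> rcosets H \<Longrightarrow> coset_rep c \<in> carrier G"
proof -
  show "coset_rep c \<in> carrier G" if c: "c \<in> lcosets H"
  proof -
    obtain g where g: "g \<in> carrier G" "c = g <# H" using c by (rule lcosetE)
    then show ?thesis using coset_rep_lcoset[OF H g(1)] subgroup.mem_carrier[OF H] by auto
  qed
  show "coset_rep c \<in> carrier G" if c: "c \<in> rcosets H"
  proof -
    obtain g where g: "g \<in> carrier G" "c = H #> g" using c unfolding RCOSETS_def by blast
    then show ?thesis using coset_rep_rcoset[OF H g(1)] subgroup.mem_carrier[OF H] by auto
  qed
qed

lemma keys_frag_act:
  assumes "subgroup H G" "g \<in> carrier G" "Poly_Mapping.keys z \<subseteq> lcosets H"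
  shows "Poly_Mapping.keys (frag_act G g z) \<subseteq> lcosets H"
  unfolding frag_act_def
  by (rule keys_frag_extend_subset[OF assms(3)]) (use assms in \<open>auto simp: keys_frag_of lcos_closed\<close>)

lemma frag_act_cancel:
  assumes "subgroup H G" "g \<in> carrier G" "Poly_Mapping.keys z \<subseteq> lcosets H"
  shows "frag_act G (inv g) (frag_act G g z) = z"
  using assms(3)
proof (induction rule: frag_induction)
  case (one c)
  then obtain a where "a \<in> carrier G" "c = a <# H" by (rule lcosetE)
  then show ?case
    using assms(1,2) subgroup.subset[OF assms(1)]
    by (simp add: frag_act_def lcos_m_assoc m_assoc[symmetric])
qed (simp_all add: frag_act_def frag_extend_diff)

lemma inj_on_lcos_act: "subgroup H G \<Longrightarrow> g \<in> carrier G \<Longrightarrow> inj_on (l_coset G g) (lcosets H)"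
  using frag_act_cancel[of H g "frag_of _"]
  by (intro inj_on_inverseI[of _ "l_coset G (inv g)"]) (simp add: frag_act_def keys_frag_of frag_of_eq)

lemma keys_norm_element: "Poly_Mapping.keys (norm_element G H) \<subseteq> lcosets H"
  unfolding norm_element_def using Poly_Mapping.keys_sum[of frag_of "lcosets H"] by (auto simp: keys_frag_of)

lemma frag_act_norm_element:
  assumes "subgroup H G" "g \<in> carrier G" "finite (lcosets H)"
  shows "frag_act G g (norm_element G H) = norm_element G H"
proof -
  have im: "l_coset G g ` (lcosets H) = lcosets H"
    using inj_on_lcos_act[OF assms(1,2)] lcos_closed[OF assms(1,2)] assms(3)
    by (intro card_subset_eq) (auto simp: card_image)
  have "frag_act G g (norm_element G H) = (\<Sum>c\<in>lcosets H. frag_of (g <# c))"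
    by (simp add: norm_element_def frag_act_def frag_extend_sum[OF assms(3)] comp_def)
  also have "\<dots> = (\<Sum>c\<in>l_coset G g ` (lcosets H). frag_of c)"
    by (subst sum.reindex[OF inj_on_lcos_act[OF assms(1,2)]]) simp
  finally show ?thesis by (simp add: im norm_element_def)
qed

text \<open>Inversion \<open>Hr \<mapsto> r\<^sup>-\<^sup>1H\<close>, written with the representatives that occur in \<^const>\<open>cochain_cor\<close>: it matches
that sum over right cosets with a sum over the left cosets that form a basis of \<open>\<int>[G/H]\<close>.\<close>

lemma rcosets_lcosets_bij:
  assumes H: "subgroup H G"
  shows "bij_betw (\<lambda>c. inv (coset_rep c) <# H) (rcosets H) (lcosets H)"
proof -
  have rep: "coset_rep c \<in> carrier G \<and> c = H #> coset_rep c" if c: "c \<in> rcosets H" for c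
  proof -
    obtain g where g: "g \<in> carrier G" "c = H #> g" using c unfolding RCOSETS_def by blast
    obtain h where h: "h \<in> H" "coset_rep c = h \<otimes> g" using coset_rep_rcoset[OF H g(1)] g(2) by auto
    then have hc: "h \<in> carrier G" using subgroup.mem_carrier[OF H] by blast
    have "h \<otimes> g \<in> H #> g" using h unfolding r_coset_def by blast
    then have "H #> g = H #> (h \<otimes> g)" by (rule repr_independence[OF _ g(1) H])
    then show ?thesis unfolding h(2) using g hc by simp
  qed
  have "inj_on (\<lambda>c. inv (coset_rep c) <# H) (rcosets H)"
  proof (rule inj_onI)
    fix c c' assume c: "c \<in> rcosets H" "c' \<in> rcosets H" and eq: "inv (coset_rep c) <# H = inv (coset_rep c') <# H"
    let ?r = "coset_rep c" and ?r' = "coset_rep c'"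
    have r: "?r \<in> carrier G" "?r' \<in> carrier G" "c = H #> ?r" "c' = H #> ?r'"
      using rep[OF c(1)] rep[OF c(2)] by blast+
    have "inv ?r \<in> inv ?r' <# H" using lcos_self[OF inv_closed[OF r(1)] H] unfolding eq .
    then obtain h where h: "h \<in> H" "inv ?r = inv ?r' \<otimes> h" by (auto simp: l_coset_def)
    have hc: "h \<in> carrier G" using h subgroup.mem_carrier[OF H] by blast
    have "?r = inv (inv ?r' \<otimes> h)" using h(2)[symmetric] r(1) by simp
    also have "\<dots> = inv h \<otimes> ?r'" using r(2) hc by (simp add: inv_mult_group)
    finally have "?r = inv h \<otimes> ?r'" .
    then have "?r \<in> H #> ?r'" using subgroup.m_inv_closed[OF H h(1)] unfolding r_coset_def by blast
    then have "H #> ?r' = H #> ?r" by (rule repr_independence[OF _ r(2) H])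
    then show "c = c'" using r(3,4) by argo
  qed
  moreover have "inv (coset_rep c) <# H \<in> lcosets H" if "c \<in> rcosets H" for c
    using inv_closed[OF conjunct1[OF rep[OF that]]] unfolding LCOSETS_def by blast
  moreover have "c \<in> (\<lambda>c. inv (coset_rep c) <# H) ` (rcosets H)" if c: "c \<in> lcosets H" for c
  proof -
    obtain g where g: "g \<in> carrier G" "c = g <# H" using c by (rule lcosetE)
    obtain h where h: "h \<in> H" "coset_rep (H #> inv g) = h \<otimes> inv g"
      using coset_rep_rcoset[OF H, of "inv g"] g by auto
    have hc: "h \<in> carrier G" using h subgroup.mem_carrier[OF H] by blast
    have "inv (coset_rep (H #> inv g)) = g \<otimes> inv h" using h hc g by (simp add: inv_mult_group)
    moreover have "g \<otimes> inv h \<in> g <# H" using subgroup.m_inv_closed[OF H h(1)] by (auto simp: l_coset_def)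
    ultimately have "c = inv (coset_rep (H #> inv g)) <# H"
      using l_repr_independence[OF _ g(1) H] g(2) by simp
    moreover have "H #> inv g \<in> rcosets H" using g by (auto simp: RCOSETS_def)
    ultimately show ?thesis by blast
  qed
  ultimately show ?thesis by (auto simp: bij_betw_def)
qed

end

section \<open>Transfer along invariant elements of a coset module\<close>

text \<open>For \<open>H\<close>-equivariant \<open>f\<close> this is the value \<open>g f(g\<^sup>-\<^sup>1 x)\<close> at \<open>c = gH\<close>, which is independent of the choice of
\<open>g\<close> in \<open>c\<close> (\<open>twist_coset\<close>). It is the map \<open>\<int>[G/H] \<otimes> \<int>[G\<^sup>k\<^sup>+\<^sup>1] \<rightarrow> A\<close> that corresponds to \<open>f\<close> under the
adjunction between restriction and induction.\<close>

definition twist :: "('g, 'm) monoid_scheme \<Rightarrow> ('g \<Rightarrow>\<^sub>0 int, 'a, 'n) module_scheme \<Rightarrow> ('g list \<Rightarrow> 'a) \<Rightarrow> 'g list \<Rightarrow> 'g set \<Rightarrow> 'a"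
  where "twist G A f xs c = frag_of (coset_rep c) \<odot>\<^bsub>A\<^esub> f (map (\<lambda>x. inv\<^bsub>G\<^esub> (coset_rep c) \<otimes>\<^bsub>G\<^esub> x) xs)"

definition transfer :: "('g, 'm) monoid_scheme \<Rightarrow> ('g \<Rightarrow>\<^sub>0 int, 'a, 'n) module_scheme \<Rightarrow> ('g set \<Rightarrow>\<^sub>0 int) \<Rightarrow> nat \<Rightarrow> ('g list \<Rightarrow> 'a) \<Rightarrow> 'g list \<Rightarrow> 'a"
  where "transfer G A z k f = (\<lambda>xs\<in>lists_of (carrier G) (Suc k). frag_pair A (twist G A f xs) z)"

context group_module
begin

lemma translate_lists_of: "g \<in> carrier G \<Longrightarrow> xs \<in> lists_of (carrier G) n \<Longrightarrow> map (\<lambda>x. g \<otimes> x) xs \<in> lists_of (carrier G) n"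
  by (rule map_lists_of) auto

lemma translate_translate:
  "\<lbrakk>g \<in> carrier G; h \<in> carrier G; xs \<in> lists_of (carrier G) n\<rbrakk> \<Longrightarrow>
    map (\<lambda>x. g \<otimes> x) (map (\<lambda>x. h \<otimes> x) xs) = map (\<lambda>x. (g \<otimes> h) \<otimes> x) xs"
  by (auto simp: lists_of_def G.m_assoc subset_iff)

lemma translate_one: "xs \<in> lists_of (carrier G) n \<Longrightarrow> map (\<lambda>x. \<one> \<otimes> x) xs = xs"
  by (auto simp: lists_of_def subset_iff intro!: map_idI)

text \<open>Two choices of \<open>g\<close> differ by some \<open>h \<in> H\<close> on the right, and \<open>g h f(h\<^sup>-\<^sup>1 g\<^sup>-\<^sup>1 x) = g f(g\<^sup>-\<^sup>1 x)\<close> by equivariance.\<close>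

lemma twist_coset:
  assumes H: "subgroup H G" and f: "f \<in> carrier (EC H (carrier G) k)" and g: "g \<in> carrier G"
    and xs: "xs \<in> lists_of (carrier G) (Suc k)"
  shows "twist G A f xs (g <# H) = frag_of g \<odot>\<^bsub>A\<^esub> f (map (\<lambda>x. inv g \<otimes> x) xs)"
proof -
  obtain h where h: "h \<in> H" "coset_rep (g <# H) = g \<otimes> h"
    using G.coset_rep_lcoset[OF H g] by blast
  have hc: "h \<in> carrier G" using h subgroup.mem_carrier[OF H] by blast
  let ?ys = "map (\<lambda>x. inv g \<otimes> x) xs"
  note ys = translate_lists_of[OF G.inv_closed[OF g] xs]
  have "map (\<lambda>x. inv (g \<otimes> h) \<otimes> x) xs = map (\<lambda>x. inv h \<otimes> x) ?ys"
    by (subst translate_translate[OF _ _ xs]) (use g hc in \<open>auto simp: G.inv_mult_group\<close>)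
  then have "f (map (\<lambda>x. inv (g \<otimes> h) \<otimes> x) xs) = frag_of (inv h) \<odot>\<^bsub>A\<^esub> f ?ys"
    using EC_eq[OF f subgroup.m_inv_closed[OF H h(1)] ys] by (simp only:)
  then have "twist G A f xs (g <# H) = frag_of (g \<otimes> h) \<odot>\<^bsub>A\<^esub> (frag_of (inv h) \<odot>\<^bsub>A\<^esub> f ?ys)"
    by (simp add: twist_def h(2))
  also have "\<dots> = frag_of (g \<otimes> h \<otimes> inv h) \<odot>\<^bsub>A\<^esub> f ?ys"
    using act_mult[of "g \<otimes> h" "inv h"] g hc EC_closed[OF f ys] by simp
  finally show ?thesis using g hc by (simp add: G.m_assoc)
qed

lemma twist_closed:
  assumes H: "subgroup H G" and f: "f \<in> carrier (EC H (carrier G) k)" and xs: "xs \<in> lists_of (carrier G) (Suc k)"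
  shows "twist G A f xs \<in> lcosets H \<rightarrow> carrier A"
proof
  fix c assume "c \<in> lcosets H"
  then obtain g where g: "g \<in> carrier G" "c = g <# H" by (rule G.lcosetE)
  show "twist G A f xs c \<in> carrier A"
    unfolding g(2) twist_coset[OF H f g(1) xs]
    using translate_lists_of[OF G.inv_closed[OF g(1)] xs] EC_closed[OF f] act_closed g(1) by blast
qed

lemma twist_act:
  assumes H: "subgroup H G" and f: "f \<in> carrier (EC H (carrier G) k)" and xs: "xs \<in> lists_of (carrier G) (Suc k)"
    and g: "g \<in> carrier G" and c: "c \<in> lcosets H"
  shows "twist G A f (map (\<lambda>x. g \<otimes> x) xs) (g <# c) = frag_of g \<odot>\<^bsub>A\<^esub> twist G A f xs c"
proof -
  obtain a where a: "a \<in> carrier G" "c = a <# H" using c by (rule G.lcosetE)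
  have "g <# c = (g \<otimes> a) <# H" using a g subgroup.subset[OF H] by (simp add: G.lcos_m_assoc)
  moreover have "map (\<lambda>x. inv (g \<otimes> a) \<otimes> x) (map (\<lambda>x. g \<otimes> x) xs) = map (\<lambda>x. inv a \<otimes> x) xs"
    by (subst translate_translate[OF _ _ xs]) (use a g in \<open>auto simp: G.inv_mult_group G.m_assoc\<close>)
  moreover have "twist G A f (map (\<lambda>x. g \<otimes> x) xs) ((g \<otimes> a) <# H) =
      frag_of (g \<otimes> a) \<odot>\<^bsub>A\<^esub> f (map (\<lambda>x. inv (g \<otimes> a) \<otimes> x) (map (\<lambda>x. g \<otimes> x) xs))"
    by (rule twist_coset[OF H f _ translate_lists_of[OF g xs]]) (use a g in simp)
  ultimately show ?thesis
    using a g act_mult EC_closed[OF f translate_lists_of[OF G.inv_closed[OF a(1)] xs]]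
    by (simp only: twist_coset[OF H f a(1) xs])
qed

text \<open>This is the \<open>G\<close>-equivariance of the adjoint of \<open>f\<close>. For \<open>g\<close> that fixes \<open>z\<close> it says that the transfer of
\<open>f\<close> along \<open>z\<close> commutes with \<open>g\<close>.\<close>

lemma frag_pair_twist_act:
  assumes H: "subgroup H G" and f: "f \<in> carrier (EC H (carrier G) k)" and xs: "xs \<in> lists_of (carrier G) (Suc k)"
    and g: "g \<in> carrier G" and z: "Poly_Mapping.keys z \<subseteq> lcosets H"
  shows "frag_pair A (twist G A f (map (\<lambda>x. g \<otimes> x) xs)) (frag_act G g z) = frag_of g \<odot>\<^bsub>A\<^esub> frag_pair A (twist G A f xs) z"
proof -
  note t = twist_closed[OF H f translate_lists_of[OF g xs]] and t' = twist_closed[OF H f xs]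
  have "frag_pair A (twist G A f (map (\<lambda>x. g \<otimes> x) xs)) (frag_act G g z) =
      frag_pair A (\<lambda>c. twist G A f (map (\<lambda>x. g \<otimes> x) xs) (g <# c)) z"
    unfolding frag_act_def
    by (rule frag_pair_map[OF z]) (use t G.lcos_closed[OF H g] in blast)
  also have "\<dots> = frag_pair A (\<lambda>c. frag_of g \<odot>\<^bsub>A\<^esub> twist G A f xs c) z"
    by (rule A.frag_pair_cong) (use z twist_act[OF H f xs g] t' act_closed[OF g] in blast)+
  also have "\<dots> = frag_of g \<odot>\<^bsub>A\<^esub> frag_pair A (twist G A f xs) z"
    by (rule act_frag_pair[symmetric]) (use g z t' in auto)
  finally show ?thesis .
qed

lemma transfer_apply:
  "xs \<in> lists_of (carrier G) (Suc k) \<Longrightarrow> transfer G A z k f xs = frag_pair A (twist G A f xs) z"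
  by (simp add: transfer_def)

lemma stable_carrier: "H \<subseteq> carrier G \<Longrightarrow> stable_under G H (carrier G)"
  by (auto simp: stable_under_def)

lemma twist_list_diff:
  assumes H: "subgroup H G" and f: "f \<in> carrier (EC H (carrier G) k)"
    and xs: "xs \<in> lists_of (carrier G) (Suc (Suc k))" and c: "c \<in> lcosets H"
  shows "twist G A (list_diff A (carrier G) k f) xs c = frag_pair A (\<lambda>ys. twist G A f ys c) (bd xs)"
proof -
  obtain g where g: "g \<in> carrier G" "c = g <# H" using c by (rule G.lcosetE)
  let ?t = "map (\<lambda>x. inv g \<otimes> x)"
  note k = keys_bd[OF xs] and gi = G.inv_closed[OF g(1)]
  note cl = EC_closed[OF f translate_lists_of[OF gi]]
  have df: "list_diff A (carrier G) k f \<in> carrier (EC H (carrier G) (Suc k))"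
    by (rule list_diff_closed[OF stable_carrier[OF subgroup.subset[OF H]] f])
  have "twist G A (list_diff A (carrier G) k f) xs c = frag_of g \<odot>\<^bsub>A\<^esub> frag_pair A f (bd (?t xs))"
    unfolding g(2) twist_coset[OF H df g(1) xs] list_diff_apply[OF translate_lists_of[OF gi xs]] ..
  also have "frag_pair A f (bd (?t xs)) = frag_pair A (\<lambda>ys. f (?t ys)) (bd xs)"
    unfolding bd_map by (rule frag_pair_map[OF k]) (rule cl)
  also have "frag_of g \<odot>\<^bsub>A\<^esub> \<dots> = frag_pair A (\<lambda>ys. frag_of g \<odot>\<^bsub>A\<^esub> f (?t ys)) (bd xs)"
    by (rule act_frag_pair[OF g(1)]) (use k cl in blast)
  also have "\<dots> = frag_pair A (\<lambda>ys. twist G A f ys c) (bd xs)"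
    by (rule A.frag_pair_cong) (use k twist_coset[OF H f g(1)] g(2) twist_closed[OF H f] c in auto)
  finally show ?thesis .
qed

text \<open>Equivariance under \<open>K\<close> comes from \<open>frag_pair_twist_act\<close>, as \<open>K\<close> fixes \<open>z\<close>; the differential commutes with
the sum over cosets because it does so at each coset (\<open>twist_list_diff\<close>).\<close>

lemma cochain_map_transfer:
  assumes H: "subgroup H G" and K: "K \<subseteq> carrier G" and z: "Poly_Mapping.keys z \<subseteq> lcosets H"
    and inv: "\<And>g. g \<in> K \<Longrightarrow> frag_act G g z = z"
  shows "cochain_map (EC H (carrier G)) (list_diff A (carrier G)) (EC K (carrier G)) (list_diff A (carrier G))
    (transfer G A z)"
  unfolding cochain_map_def
proof (intro allI conjI ballI)
  fix k
  have tc: "frag_pair A (twist G A f xs) z \<in> carrier A"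
    if "f \<in> carrier (EC H (carrier G) k)" "xs \<in> lists_of (carrier G) (Suc k)" for f xs k
    using twist_closed[OF H that] z by (intro A.frag_pair_closed) blast
  show "transfer G A z k \<in> hom (EC H (carrier G) k) (EC K (carrier G) k)"
  proof (rule homI)
    fix f assume f: "f \<in> carrier (EC H (carrier G) k)"
    show "transfer G A z k f \<in> carrier (EC K (carrier G) k)"
      unfolding transfer_def
    proof (rule ECI)
      fix g xs assume "g \<in> K" "xs \<in> lists_of (carrier G) (Suc k)"
      then show "frag_pair A (twist G A f (map (\<lambda>x. g \<otimes> x) xs)) z = frag_of g \<odot>\<^bsub>A\<^esub> frag_pair A (twist G A f xs) z"
        using frag_pair_twist_act[OF H f _ _ z, of xs g] inv[of g] K by auto
    qed (use tc f stable_carrier K in auto)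
    fix f' assume f': "f' \<in> carrier (EC H (carrier G) k)"
    show "transfer G A z k (f \<otimes>\<^bsub>EC H (carrier G) k\<^esub> f') = transfer G A z k f \<otimes>\<^bsub>EC K (carrier G) k\<^esub> transfer G A z k f'"
      unfolding transfer_def[of G A z k "f \<otimes>\<^bsub>EC H (carrier G) k\<^esub> f'"] EC_simps(2)[of K]
    proof (rule restrict_ext)
      fix xs assume xs: "xs \<in> lists_of (carrier G) (Suc k)"
      note t = twist_closed[OF H f xs] twist_closed[OF H f' xs]
      have "twist G A (f \<otimes>\<^bsub>EC H (carrier G) k\<^esub> f') xs c = twist G A f xs c \<oplus>\<^bsub>A\<^esub> twist G A f' xs c" if "c \<in> lcosets H" for c
      proof -
        have "coset_rep c \<in> carrier G"
          by (rule G.coset_rep_closed(1)[OF H that])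
        then show ?thesis
          using translate_lists_of[OF G.inv_closed xs] EC_closed[OF f] EC_closed[OF f']
          by (simp add: twist_def EC_simps(2) act_add)
      qed
      then have "frag_pair A (twist G A (f \<otimes>\<^bsub>EC H (carrier G) k\<^esub> f') xs) z =
          frag_pair A (\<lambda>c. twist G A f xs c \<oplus>\<^bsub>A\<^esub> twist G A f' xs c) z"
        using z t by (intro A.frag_pair_cong) blast+
      also have "\<dots> = frag_pair A (twist G A f xs) z \<oplus>\<^bsub>A\<^esub> frag_pair A (twist G A f' xs) z"
        using z t by (intro A.frag_pair_add_fun) blast+
      finally show "frag_pair A (twist G A (f \<otimes>\<^bsub>EC H (carrier G) k\<^esub> f') xs) z =
          transfer G A z k f xs \<oplus>\<^bsub>A\<^esub> transfer G A z k f' xs"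
        by (simp add: transfer_apply[OF xs])
    qed
  qed
  fix f assume f: "f \<in> carrier (EC H (carrier G) k)"
  show "list_diff A (carrier G) k (transfer G A z k f) = transfer G A z (Suc k) (list_diff A (carrier G) k f)"
    unfolding list_diff_def[of A "carrier G" k "transfer G A z k f"] transfer_def[of G A z "Suc k"]
  proof (rule restrict_ext)
    fix xs assume xs: "xs \<in> lists_of (carrier G) (Suc (Suc k))"
    note k = keys_bd[OF xs]
    have "frag_pair A (transfer G A z k f) (bd xs) = frag_pair A (\<lambda>ys. frag_pair A (twist G A f ys) z) (bd xs)"
      using k tc[OF f] transfer_apply by (intro A.frag_pair_cong) blast+
    also have "\<dots> = frag_pair A (\<lambda>c. frag_pair A (\<lambda>ys. twist G A f ys c) (bd xs)) z"
      using k z twist_closed[OF H f] by (intro A.frag_pair_swap) blast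
    also have "\<dots> = frag_pair A (twist G A (list_diff A (carrier G) k f) xs) z"
      using z k twist_list_diff[OF H f xs] twist_closed[OF H list_diff_closed[OF stable_carrier[OF subgroup.subset[OF H]] f] xs]
      by (intro A.frag_pair_cong) (auto simp: subset_iff)
    finally show "frag_pair A (transfer G A z k f) (bd xs) = frag_pair A (twist G A (list_diff A (carrier G) k f) xs) z" .
  qed
qed

text \<open>Both sides are additive in \<open>z\<close>, so it is enough to compare them at a single coset \<open>gK\<close>. There the left
side is \<open>g\<close> applied to the transfer of \<open>f\<close> along \<open>e(K)\<close> at \<open>g\<^sup>-\<^sup>1 x\<close>, which is the transfer along
\<open>g e(K) = e(gK)\<close> at \<open>x\<close>.\<close>

lemma transfer_transfer:
  assumes H: "subgroup H G" and K: "subgroup K G" and e: "coset_hom G K H e"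
    and inv: "\<And>g. g \<in> K \<Longrightarrow> frag_act G g (e (frag_of K)) = e (frag_of K)"
    and f: "f \<in> carrier (EC H (carrier G) k)" and z: "Poly_Mapping.keys z \<subseteq> lcosets K"
  shows "transfer G A z k (transfer G A (e (frag_of K)) k f) = transfer G A (e z) k f"
  unfolding transfer_def[of G A z] transfer_def[of G A "e z"]
proof (rule restrict_ext)
  fix xs assume xs: "xs \<in> lists_of (carrier G) (Suc k)"
  let ?t = "e (frag_of K)" let ?f = "transfer G A ?t k f"
  have Kk: "Poly_Mapping.keys (frag_of K) \<subseteq> lcosets K" using G.lcos_of_subgroup[OF K] by (simp add: keys_frag_of)
  note t = coset_homD(1)[OF e Kk]
  have f': "?f \<in> carrier (EC K (carrier G) k)"
    using cochain_map_transfer[OF H subgroup.subset[OF K] t inv] f by (auto simp: cochain_map_def hom_def)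
  note tc = twist_closed[OF H f xs] and tc' = twist_closed[OF K f' xs]
  show "frag_pair A (twist G A ?f xs) z = frag_pair A (twist G A f xs) (e z)"
    using z
  proof (induction rule: frag_induction_support)
    case zero
    show ?case by (simp add: coset_hom_0[OF e])
  next
    case (one c)
    then obtain g where g: "g \<in> carrier G" "c = g <# K" by (rule G.lcosetE)
    let ?ys = "map (\<lambda>x. inv g \<otimes> x) xs"
    note ys = translate_lists_of[OF G.inv_closed[OF g(1)] xs]
    have xs': "map (\<lambda>x. g \<otimes> x) ?ys = xs"
      by (subst translate_translate[OF _ _ xs]) (use g in \<open>auto simp: translate_one[OF xs]\<close>)
    have "frag_pair A (twist G A ?f xs) (frag_of c) = twist G A ?f xs c"
      using one tc' by (intro A.frag_pair_of) blast
    also have "\<dots> = frag_of g \<odot>\<^bsub>A\<^esub> frag_pair A (twist G A f ?ys) ?t"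
      unfolding g(2) twist_coset[OF K f' g(1) xs] transfer_apply[OF ys] ..
    also have "\<dots> = frag_pair A (twist G A f xs) (frag_act G g ?t)"
      using frag_pair_twist_act[OF H f ys g(1) t] xs' by simp
    also have "frag_act G g ?t = e (frag_of c)"
      using coset_homD(2)[OF e Kk g(1)] g(2) by (simp add: frag_act_def)
    finally show ?case .
  next
    case (diff a b)
    show ?case
      unfolding coset_hom_diff[OF e diff(1,2)]
        A.frag_pair_diff[OF diff(1,2) tc'] A.frag_pair_diff[OF coset_homD(1)[OF e diff(1)] coset_homD(1)[OF e diff(2)] tc]
        diff(3,4) ..
  qed
qed

lemma transfer_base:
  assumes H: "subgroup H G" and f: "f \<in> carrier (EC H (carrier G) k)"
  shows "transfer G A (frag_of H) k f = f"
proof -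
  have "transfer G A (frag_of H) k f xs = f xs" for xs
  proof (cases "xs \<in> lists_of (carrier G) (Suc k)")
    case True
    have "\<one> <# H = H" using subgroup.subset[OF H] by (rule G.lcos_mult_one)
    then have "twist G A f xs H = f xs"
      using twist_coset[OF H f G.one_closed True] EC_closed[OF f True] by (simp add: translate_one[OF True] act_one del: G.l_one)
    then show ?thesis using True EC_closed[OF f True] by (simp add: transfer_apply)
  next
    case False
    then show ?thesis using f by (auto simp: transfer_def EC_simps PiE_iff extensional_def)
  qed
  then show ?thesis ..
qed

text \<open>A fully equivariant cochain has the same value \<open>g f(g\<^sup>-\<^sup>1 x) = f(x)\<close> at every coset, so the transfer
multiplies it by the augmentation of \<open>z\<close>.\<close>

lemma transfer_invariant:
  assumes H: "subgroup H G" and f: "f \<in> carrier (EC (carrier G) (carrier G) k)"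
    and z: "Poly_Mapping.keys z \<subseteq> lcosets H" "augment z = frag_of ()"
  shows "transfer G A z k f = f"
proof -
  have fH: "f \<in> carrier (EC H (carrier G) k)"
    using f subgroup.subset[OF H] by (auto simp: EC_simps)
  have "transfer G A z k f xs = f xs" for xs
  proof (cases "xs \<in> lists_of (carrier G) (Suc k)")
    case True
    note c = EC_closed[OF f True]
    have "twist G A f xs c = f xs" if cH: "c \<in> lcosets H" for c
    proof -
      obtain g where g: "g \<in> carrier G" "c = g <# H" using cH by (rule G.lcosetE)
      show ?thesis
        unfolding g(2) twist_coset[OF H fH g(1) True] EC_eq[OF f G.inv_closed[OF g(1)] True]
        using act_mult[of g "inv g" "f xs"] g c by (simp add: act_one)
    qed
    then have "transfer G A z k f xs = frag_pair A (\<lambda>c. f xs) z"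
      unfolding transfer_apply[OF True] using z c by (intro A.frag_pair_cong) auto
    also have "\<dots> = frag_pair A (\<lambda>u::unit. f xs) (augment z)"
      unfolding augment_def using frag_pair_map[OF z(1), of "\<lambda>u. f xs" "\<lambda>c. ()"] c by simp
    finally show ?thesis using c z by simp
  next
    case False
    then show ?thesis using f by (auto simp: transfer_def EC_simps PiE_iff extensional_def)
  qed
  then show ?thesis ..
qed

text \<open>The map called \<open>p\<close> in \<^const>\<open>cochain_cor\<close>. It is \<open>H\<close>-equivariant with values in \<open>H\<close>, but not the identity
on \<open>H\<close> in general, as the representative of the coset \<open>H\<close> is an arbitrary element of \<open>H\<close>.\<close>

definition to_subgroup :: "'g set \<Rightarrow> 'g \<Rightarrow> 'g"
  where "to_subgroup H x = x \<otimes> inv (coset_rep (H #> x))"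

lemma to_subgroup:
  assumes H: "subgroup H G"
  shows "to_subgroup H \<in> carrier G \<rightarrow> H"
    and "\<lbrakk>h \<in> H; x \<in> carrier G\<rbrakk> \<Longrightarrow> to_subgroup H (h \<otimes> x) = h \<otimes> to_subgroup H x"
proof -
  have *: "\<exists>h\<in>H. coset_rep (H #> x) = h \<otimes> x" if "x \<in> carrier G" for x
    by (rule G.coset_rep_rcoset[OF H that])
  show "to_subgroup H \<in> carrier G \<rightarrow> H"
  proof
    fix x assume x: "x \<in> carrier G"
    obtain h where h: "h \<in> H" "coset_rep (H #> x) = h \<otimes> x" using *[OF x] by blast
    then have "to_subgroup H x = inv h"
      using x subgroup.mem_carrier[OF H h(1)]
      by (simp add: to_subgroup_def G.inv_mult_group G.m_assoc[symmetric])
    then show "to_subgroup H x \<in> H" using subgroup.m_inv_closed[OF H h(1)] by simp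
  qed
  assume h: "h \<in> H" and x: "x \<in> carrier G"
  have hc: "h \<in> carrier G" by (rule subgroup.mem_carrier[OF H h])
  have "h \<otimes> x \<in> H #> x" using h by (auto simp: r_coset_def)
  then have "H #> (h \<otimes> x) = H #> x" using G.repr_independence[OF _ x H] by simp
  moreover obtain h' where "h' \<in> H" "coset_rep (H #> x) = h' \<otimes> x" using *[OF x] by blast
  ultimately show "to_subgroup H (h \<otimes> x) = h \<otimes> to_subgroup H x"
    using hc x subgroup.mem_carrier[OF H] by (simp add: to_subgroup_def G.m_assoc)
qed

text \<open>The summand of co-restriction at the right coset with representative \<open>r\<close> is the value of the twisted
cochain at the left coset \<open>r\<^sup>-\<^sup>1H\<close>, so the sum is the evaluation at the norm element.\<close>

lemma cochain_cor_eq: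
  assumes H: "subgroup H G" and fin: "finite (rcosets H)" and f: "f \<in> carrier (EC H H k)"
  shows "cochain_cor G H A k f = transfer G A (norm_element G H) k (pullback (carrier G) (to_subgroup H) k f)"
  unfolding cochain_cor_def Let_def transfer_def tuples_eq
proof (rule restrict_ext)
  fix xs assume xs: "xs \<in> lists_of (carrier G) (Suc k)"
  let ?\<phi> = "pullback (carrier G) (to_subgroup H) k f"
  let ?b = "\<lambda>c. inv (coset_rep c) <# H"
  note bij = G.rcosets_lcosets_bij[OF H]
  have stable: "stable_under G H H" using H by (auto simp: stable_under_def subgroup_def)
  have \<phi>: "?\<phi> \<in> carrier (EC H (carrier G) k)"
    using cochain_map_pullback[OF stable stable_carrier[OF subgroup.subset[OF H]] to_subgroup[OF H]] f
    by (auto simp: cochain_map_def hom_def)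
  note t = twist_closed[OF H \<phi> xs]
  have finl: "finite (lcosets H)" using bij fin bij_betw_finite by blast
  have rep: "coset_rep c \<in> carrier G" if "c \<in> rcosets H" for c
    by (rule G.coset_rep_closed(2)[OF H that])
  have "frag_pair A (twist G A ?\<phi> xs) (norm_element G H) = finsum A (\<lambda>c. frag_pair A (twist G A ?\<phi> xs) (frag_of c)) (lcosets H)"
    unfolding norm_element_def by (rule A.frag_pair_sum[OF finl _ t]) (simp add: keys_frag_of)
  also have "\<dots> = finsum A (twist G A ?\<phi> xs) (lcosets H)"
    by (rule A.finsum_cong') (use funcset_mem[OF t] in auto)
  also have "\<dots> = finsum A (twist G A ?\<phi> xs) (?b ` (rcosets H))"
    using bij by (simp add: bij_betw_def)
  also have "\<dots> = finsum A (\<lambda>c. twist G A ?\<phi> xs (?b c)) (rcosets H)"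
    by (rule A.add.finprod_reindex) (use bij t in \<open>auto simp: bij_betw_def\<close>)
  also have "\<dots> = finsum A (\<lambda>c. frag_of (inv (coset_rep c)) \<odot>\<^bsub>A\<^esub>
      f (map (\<lambda>x. (coset_rep c \<otimes> x) \<otimes> inv (coset_rep (H #> (coset_rep c \<otimes> x)))) xs)) (rcosets H)"
  proof (rule A.finsum_cong'[OF refl])
    have eq: "twist G A ?\<phi> xs (?b c) = frag_of (inv (coset_rep c)) \<odot>\<^bsub>A\<^esub>
      f (map (\<lambda>x. (coset_rep c \<otimes> x) \<otimes> inv (coset_rep (H #> (coset_rep c \<otimes> x)))) xs)"
      if c: "c \<in> rcosets H" for c
    proof -
      note r = rep[OF c]
      have "?\<phi> (map (\<lambda>x. coset_rep c \<otimes> x) xs) =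
          f (map (\<lambda>x. (coset_rep c \<otimes> x) \<otimes> inv (coset_rep (H #> (coset_rep c \<otimes> x)))) xs)"
        using translate_lists_of[OF r xs] by (simp add: pullback_def to_subgroup_def[abs_def] comp_def)
      then show ?thesis
        using twist_coset[OF H \<phi> G.inv_closed[OF r] xs] r by simp
    qed
    show "twist G A ?\<phi> xs (?b c) = frag_of (inv (coset_rep c)) \<odot>\<^bsub>A\<^esub>
      f (map (\<lambda>x. (coset_rep c \<otimes> x) \<otimes> inv (coset_rep (H #> (coset_rep c \<otimes> x)))) xs)"
      if "c \<in> rcosets H" for c by (rule eq[OF that])
    show "(\<lambda>c. frag_of (inv (coset_rep c)) \<odot>\<^bsub>A\<^esub>
      f (map (\<lambda>x. (coset_rep c \<otimes> x) \<otimes> inv (coset_rep (H #> (coset_rep c \<otimes> x)))) xs))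
        \<in> rcosets H \<rightarrow> carrier A"
      using funcset_mem[OF t bij_betw_apply[OF bij]] eq by (intro funcsetI) simp
  qed
  finally show "finsum A (\<lambda>c. frag_of (inv (coset_rep c)) \<odot>\<^bsub>A\<^esub>
      f (map (\<lambda>x. (coset_rep c \<otimes> x) \<otimes> inv (coset_rep (H #> (coset_rep c \<otimes> x)))) xs)) (rcosets H) =
      frag_pair A (twist G A ?\<phi> xs) (norm_element G H)" by simp
qed

end

section \<open>Integrally equivalent subgroups\<close>

definition coset_iso :: "('g, 'm) monoid_scheme \<Rightarrow> 'g set \<Rightarrow> 'g set \<Rightarrow>
    (('g set \<Rightarrow>\<^sub>0 int) \<Rightarrow> ('g set \<Rightarrow>\<^sub>0 int)) \<Rightarrow> (('g set \<Rightarrow>\<^sub>0 int) \<Rightarrow> ('g set \<Rightarrow>\<^sub>0 int)) \<Rightarrow> bool"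
  where "coset_iso G P Q f f' \<longleftrightarrow> coset_hom G P Q f \<and> coset_hom G Q P f' \<and>
    (\<forall>z. Poly_Mapping.keys z \<subseteq> lcosets\<^bsub>G\<^esub> P \<longrightarrow> f' (f z) = z) \<and>
    (\<forall>z. Poly_Mapping.keys z \<subseteq> lcosets\<^bsub>G\<^esub> Q \<longrightarrow> f (f' z) = z)"

lemma coset_iso_sym: "coset_iso G P Q f f' \<Longrightarrow> coset_iso G Q P f' f"
  by (auto simp: coset_iso_def)

text \<open>A linear map is a total function on formal combinations of sets, and only its values on combinations
of cosets represent the module map; being an inverse is a condition on these values.\<close>

lemma coset_hom_inverse:
  assumes G: "group G" "subgroup P G" "subgroup Q G" and f: "coset_hom G P Q f"
    and inv: "\<And>z. Poly_Mapping.keys z \<subseteq> lcosets\<^bsub>G\<^esub> P \<Longrightarrow> f' (f z) = z"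
      "\<And>z. Poly_Mapping.keys z \<subseteq> lcosets\<^bsub>G\<^esub> Q \<Longrightarrow> Poly_Mapping.keys (f' z) \<subseteq> lcosets\<^bsub>G\<^esub> P \<and> f (f' z) = z"
  shows "coset_hom G Q P f'"
  unfolding coset_hom_def
proof (intro allI impI conjI ballI)
  fix z :: "_ \<Rightarrow>\<^sub>0 int" assume z: "Poly_Mapping.keys z \<subseteq> lcosets\<^bsub>G\<^esub> Q"
  note z' = inv(2)[OF z]
  show "Poly_Mapping.keys (f' z) \<subseteq> lcosets\<^bsub>G\<^esub> P" using z' ..
  show "f' (frag_act G g z) = frag_act G g (f' z)" if g: "g \<in> carrier G" for g
    using coset_homD(2)[OF f conjunct1[OF z'] g] inv(1)[OF group.keys_frag_act[OF G(1,2) g conjunct1[OF z']]] z'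
    by simp
  show "f' (z + w) = f' z + f' w" if w: "Poly_Mapping.keys w \<subseteq> lcosets\<^bsub>G\<^esub> Q" for w :: "_ \<Rightarrow>\<^sub>0 int"
  proof -
    note w' = inv(2)[OF w]
    have "Poly_Mapping.keys (f' z + f' w) \<subseteq> lcosets\<^bsub>G\<^esub> P" using z' w' keys_add[of "f' z" "f' w"] by blast
    then show ?thesis
      using inv(1) coset_homD(3)[OF f conjunct1[OF z'] conjunct1[OF w']] z' w' by metis
  qed
qed

lemma Z_equivalent_coset_iso:
  assumes G: "group G" "subgroup P G" "subgroup Q G" and "Z_equivalent G P Q"
  obtains f f' where "coset_iso G P Q f f'"
proof -
  obtain f where f: "f \<in> left_module_iso (group_ring G) (coset_module G P) (coset_module G Q)"
    using assms(4) by (auto simp: Z_equivalent_def)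
  let ?P = "{z. Poly_Mapping.keys z \<subseteq> lcosets\<^bsub>G\<^esub> P}" and ?Q = "{z. Poly_Mapping.keys z \<subseteq> lcosets\<^bsub>G\<^esub> Q}"
  have bij: "bij_betw f ?P ?Q"
    and add: "\<And>z w. z \<in> ?P \<Longrightarrow> w \<in> ?P \<Longrightarrow> f (z + w) = f z + f w"
    and smult: "\<And>r z. Poly_Mapping.keys r \<subseteq> carrier G \<Longrightarrow> z \<in> ?P \<Longrightarrow>
      f (frag_extend2 (l_coset G) r z) = frag_extend2 (l_coset G) r (f z)"
    using f by (auto simp: left_module_iso_def coset_module_def group_ring_def)
  have act: "frag_extend2 (l_coset G) (frag_of g) z = frag_act G g z" for g z
    by (simp add: frag_extend2_def frag_act_def)
  have hom: "coset_hom G P Q f"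
    using bij_betwE[OF bij] add smult[of "frag_of _"] by (auto simp: coset_hom_def act keys_frag_of)
  let ?f' = "inv_into ?P f"
  have "coset_hom G Q P ?f'"
    by (rule coset_hom_inverse[OF G hom])
      (use bij_betw_inv_into_left[OF bij] bij_betw_inv_into_right[OF bij] bij_betwE[OF bij_betw_inv_into[OF bij]] in auto)
  then have "coset_iso G P Q f ?f'"
    using hom bij_betw_inv_into_left[OF bij] bij_betw_inv_into_right[OF bij] by (simp add: coset_iso_def)
  then show thesis ..
qed

subsection \<open>Pulling back along a surjection\<close>

text \<open>The preimage of \<open>P\<close> contains the kernel of \<open>\<psi>\<close>, so distinct cosets of it have distinct images, and
every coset of \<open>P\<close> is an image because \<open>\<psi>\<close> is surjective.\<close>

lemma lcosets_vimage_bij: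
  assumes "group \<Gamma>" "group G" "\<psi> \<in> epi \<Gamma> G" "subgroup P G" and H: "H = {x \<in> carrier \<Gamma>. \<psi> x \<in> P}"
  shows "subgroup H \<Gamma>" 
    and "g \<in> carrier \<Gamma> \<Longrightarrow> \<psi> ` (g <#\<^bsub>\<Gamma>\<^esub> H) = \<psi> g <#\<^bsub>G\<^esub> P"
    and "bij_betw (image \<psi>) (lcosets\<^bsub>\<Gamma>\<^esub> H) (lcosets\<^bsub>G\<^esub> P)"
proof -
  interpret \<Gamma>: group \<Gamma> by fact
  interpret G: group G by fact
  interpret h: group_hom \<Gamma> G \<psi>
    using assms(3) by unfold_locales (auto simp: epi_def)
  have surj: "\<psi> ` carrier \<Gamma> = carrier G" using assms(3) by (simp add: epi_def)
  show sub: "subgroup H \<Gamma>"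
  proof (rule \<Gamma>.subgroupI)
    show "H \<noteq> {}" using subgroup.one_closed[OF assms(4)] h.hom_one \<Gamma>.one_closed unfolding H by auto
  qed (simp_all add: H subgroup.m_closed[OF assms(4)] subgroup.m_inv_closed[OF assms(4)] Collect_mono subset_iff)
  have im: "\<psi> ` (g <#\<^bsub>\<Gamma>\<^esub> H) = \<psi> g <#\<^bsub>G\<^esub> P" if "g \<in> carrier \<Gamma>" for g
  proof -
    have "P \<subseteq> \<psi> ` carrier \<Gamma>" using surj subgroup.subset[OF assms(4)] by simp
    then have "\<psi> ` H = P" unfolding H by blast
    moreover have "\<psi> (g \<otimes>\<^bsub>\<Gamma>\<^esub> h) = \<psi> g \<otimes>\<^bsub>G\<^esub> \<psi> h" if "h \<in> H" for h
      using that \<open>g \<in> carrier \<Gamma>\<close> by (simp add: H)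
    then have "\<psi> ` (g <#\<^bsub>\<Gamma>\<^esub> H) = \<psi> g <#\<^bsub>G\<^esub> (\<psi> ` H)"
      by (simp add: l_coset_def image_UN)
    ultimately show ?thesis by simp
  qed
  then show "g \<in> carrier \<Gamma> \<Longrightarrow> \<psi> ` (g <#\<^bsub>\<Gamma>\<^esub> H) = \<psi> g <#\<^bsub>G\<^esub> P" .
  show "bij_betw (image \<psi>) (lcosets\<^bsub>\<Gamma>\<^esub> H) (lcosets\<^bsub>G\<^esub> P)"
    unfolding bij_betw_def
  proof
    show "inj_on (image \<psi>) (lcosets\<^bsub>\<Gamma>\<^esub> H)"
    proof (rule inj_onI)
      fix c c' assume "c \<in> lcosets\<^bsub>\<Gamma>\<^esub> H" "c' \<in> lcosets\<^bsub>\<Gamma>\<^esub> H" and eq: "\<psi> ` c = \<psi> ` c'"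
      then obtain a b where a: "a \<in> carrier \<Gamma>" "c = a <#\<^bsub>\<Gamma>\<^esub> H" and b: "b \<in> carrier \<Gamma>" "c' = b <#\<^bsub>\<Gamma>\<^esub> H"
        by (auto simp: LCOSETS_def)
      have "\<psi> a \<in> \<psi> b <#\<^bsub>G\<^esub> P"
        using eq G.lcos_self[OF h.hom_closed[OF a(1)] assms(4)] unfolding a(2) b(2) im[OF a(1)] im[OF b(1)]
        by simp
      then obtain p where p: "p \<in> P" "\<psi> a = \<psi> b \<otimes>\<^bsub>G\<^esub> p" by (auto simp: l_coset_def)
      then have "\<psi> (inv\<^bsub>\<Gamma>\<^esub> b \<otimes>\<^bsub>\<Gamma>\<^esub> a) = p"
        using a b subgroup.mem_carrier[OF assms(4)] by (simp add: G.m_assoc[symmetric])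
      then have "inv\<^bsub>\<Gamma>\<^esub> b \<otimes>\<^bsub>\<Gamma>\<^esub> a \<in> H" using p a b by (simp add: H)
      moreover have "a = b \<otimes>\<^bsub>\<Gamma>\<^esub> (inv\<^bsub>\<Gamma>\<^esub> b \<otimes>\<^bsub>\<Gamma>\<^esub> a)" using a b by (simp add: \<Gamma>.m_assoc[symmetric])
      ultimately have "a \<in> b <#\<^bsub>\<Gamma>\<^esub> H" unfolding l_coset_def by blast
      then show "c = c'" using \<Gamma>.l_repr_independence[OF _ b(1) sub] a b by simp
    qed
    have "lcosets\<^bsub>G\<^esub> P = (\<lambda>g. g <#\<^bsub>G\<^esub> P) ` \<psi> ` carrier \<Gamma>"
      unfolding surj by (auto simp: LCOSETS_def)
    also have "\<dots> = image \<psi> ` (lcosets\<^bsub>\<Gamma>\<^esub> H)"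
      using im unfolding LCOSETS_def by (auto simp: image_UN)
    finally show "image \<psi> ` (lcosets\<^bsub>\<Gamma>\<^esub> H) = lcosets\<^bsub>G\<^esub> P" ..
  qed
qed

text \<open>The bijection of cosets extends to an isomorphism \<open>\<int>[\<Gamma>/H] \<cong> \<int>[G/P]\<close> that is equivariant along \<open>\<psi>\<close>, and
conjugating with it turns an isomorphism over \<open>\<int>[G]\<close> into one over \<open>\<int>[\<Gamma>]\<close>. The rest of the
argument takes place in \<open>\<Gamma>\<close>.\<close>

lemma coset_iso_vimage:
  assumes \<Gamma>: "group \<Gamma>" and G: "group G" and \<psi>: "\<psi> \<in> epi \<Gamma> G" and P: "subgroup P G" and Q: "subgroup Q G"
    and H: "H = {x \<in> carrier \<Gamma>. \<psi> x \<in> P}" and K: "K = {x \<in> carrier \<Gamma>. \<psi> x \<in> Q}"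
    and iso: "coset_iso G P Q f f'"
  shows "\<exists>e e'. coset_iso \<Gamma> H K e e'"
proof -
  define push where "push = frag_extend (\<lambda>c. frag_of (\<psi> ` c))"
  define pull where "pull L = frag_extend (\<lambda>c. frag_of (inv_into (lcosets\<^bsub>\<Gamma>\<^esub> L) (image \<psi>) c))" for L
  note bij = lcosets_vimage_bij(3)[OF \<Gamma> G \<psi>]
  have sub: "subgroup {x \<in> carrier \<Gamma>. \<psi> x \<in> R} \<Gamma>" if "subgroup R G" for R
    using lcosets_vimage_bij(1)[OF \<Gamma> G \<psi> that refl] .
  have \<psi>c: "\<psi> g \<in> carrier G" if "g \<in> carrier \<Gamma>" for g
    using \<psi> that by (auto simp: epi_def hom_def)
  have keys_push: "Poly_Mapping.keys (push z) \<subseteq> lcosets\<^bsub>G\<^esub> R"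
    if "subgroup R G" "L = {x \<in> carrier \<Gamma>. \<psi> x \<in> R}" "Poly_Mapping.keys z \<subseteq> lcosets\<^bsub>\<Gamma>\<^esub> L" for R L z
    unfolding push_def
    by (rule keys_frag_extend_subset[OF that(3)]) (use bij_betwE[OF bij[OF that(1,2)]] in \<open>auto simp: keys_frag_of\<close>)
  have keys_pull: "Poly_Mapping.keys (pull L z) \<subseteq> lcosets\<^bsub>\<Gamma>\<^esub> L"
    if "subgroup R G" "L = {x \<in> carrier \<Gamma>. \<psi> x \<in> R}" "Poly_Mapping.keys z \<subseteq> lcosets\<^bsub>G\<^esub> R" for R L z
    unfolding pull_def
    by (rule keys_frag_extend_subset[OF that(3)])
      (use bij_betwE[OF bij_betw_inv_into[OF bij[OF that(1,2)]]] in \<open>auto simp: keys_frag_of\<close>)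
  have pull_push: "pull L (push z) = z"
    if R: "subgroup R G" "L = {x \<in> carrier \<Gamma>. \<psi> x \<in> R}" and "Poly_Mapping.keys z \<subseteq> lcosets\<^bsub>\<Gamma>\<^esub> L" for R L z
    using that(3) unfolding pull_def push_def
    by (induction rule: frag_induction) (use bij_betw_inv_into_left[OF bij[OF R]] in \<open>simp_all add: frag_extend_diff\<close>)
  have push_pull: "push (pull L z) = z"
    if R: "subgroup R G" "L = {x \<in> carrier \<Gamma>. \<psi> x \<in> R}" and "Poly_Mapping.keys z \<subseteq> lcosets\<^bsub>G\<^esub> R" for R L z
    using that(3) unfolding pull_def push_def
    by (induction rule: frag_induction) (use bij_betw_inv_into_right[OF bij[OF R]] in \<open>simp_all add: frag_extend_diff\<close>)
  have push_act: "push (frag_act \<Gamma> g z) = frag_act G (\<psi> g) (push z)"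
    if R: "subgroup R G" "L = {x \<in> carrier \<Gamma>. \<psi> x \<in> R}" and g: "g \<in> carrier \<Gamma>" and z: "Poly_Mapping.keys z \<subseteq> lcosets\<^bsub>\<Gamma>\<^esub> L" for R L g z
    using z
  proof (induction rule: frag_induction)
    case (one c)
    then obtain a where a: "a \<in> carrier \<Gamma>" "c = a <#\<^bsub>\<Gamma>\<^esub> L" by (auto simp: LCOSETS_def)
    have "g <#\<^bsub>\<Gamma>\<^esub> c = (g \<otimes>\<^bsub>\<Gamma>\<^esub> a) <#\<^bsub>\<Gamma>\<^esub> L"
      using a g group.lcos_m_assoc[OF \<Gamma>, of L g a] by (auto simp: R)
    moreover have "\<psi> g <#\<^bsub>G\<^esub> (\<psi> a <#\<^bsub>G\<^esub> R) = \<psi> (g \<otimes>\<^bsub>\<Gamma>\<^esub> a) <#\<^bsub>G\<^esub> R"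
      using group.lcos_m_assoc[OF G subgroup.subset[OF R(1)] \<psi>c[OF g] \<psi>c[OF a(1)]] \<psi> a g
      by (auto simp: epi_def hom_def)
    moreover have "g \<otimes>\<^bsub>\<Gamma>\<^esub> a \<in> carrier \<Gamma>" using a g monoid.m_closed[OF group.is_monoid[OF \<Gamma>]] by simp
    ultimately show ?case
      using lcosets_vimage_bij(2)[OF \<Gamma> G \<psi> R] a by (simp add: push_def frag_act_def)
  qed (simp_all add: push_def frag_act_def frag_extend_diff)
  have pull_act: "pull L (frag_act G (\<psi> g) z) = frag_act \<Gamma> g (pull L z)"
    if R: "subgroup R G" "L = {x \<in> carrier \<Gamma>. \<psi> x \<in> R}" and g: "g \<in> carrier \<Gamma>" and z: "Poly_Mapping.keys z \<subseteq> lcosets\<^bsub>G\<^esub> R" for R L g z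
    using push_act[OF R g keys_pull[OF R z]] push_pull[OF R z]
      pull_push[OF R group.keys_frag_act[OF \<Gamma> sub[OF R(1), folded R(2)] g keys_pull[OF R z]]]
    by simp
  have conj: "coset_hom \<Gamma> L M (\<lambda>z. pull M (e (push z)))"
    if R: "subgroup R G" "L = {x \<in> carrier \<Gamma>. \<psi> x \<in> R}" and S: "subgroup S G" "M = {x \<in> carrier \<Gamma>. \<psi> x \<in> S}"
      and e: "coset_hom G R S e" for R L S M e
    unfolding coset_hom_def
  proof (intro allI impI conjI ballI)
    fix z :: "_ \<Rightarrow>\<^sub>0 int" assume z: "Poly_Mapping.keys z \<subseteq> lcosets\<^bsub>\<Gamma>\<^esub> L"
    note pz = keys_push[OF R z] and ez = coset_homD[OF e keys_push[OF R z]]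
    show "Poly_Mapping.keys (pull M (e (push z))) \<subseteq> lcosets\<^bsub>\<Gamma>\<^esub> M" by (rule keys_pull[OF S ez(1)])
    show "pull M (e (push (frag_act \<Gamma> g z))) = frag_act \<Gamma> g (pull M (e (push z)))" if g: "g \<in> carrier \<Gamma>" for g
      by (simp add: push_act[OF R g z] ez(2)[OF \<psi>c[OF g]] pull_act[OF S g ez(1)])
    show "pull M (e (push (z + w))) = pull M (e (push z)) + pull M (e (push w))"
      if w: "Poly_Mapping.keys w \<subseteq> lcosets\<^bsub>\<Gamma>\<^esub> L" for w :: "_ \<Rightarrow>\<^sub>0 int"
      using ez(3)[OF keys_push[OF R w]] by (simp add: push_def pull_def frag_extend_add)
  qed
  have f: "coset_hom G P Q f" "coset_hom G Q P f'" using iso by (simp_all add: coset_iso_def)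
  have "coset_iso \<Gamma> H K (\<lambda>z. pull K (f (push z))) (\<lambda>z. pull H (f' (push z)))"
    unfolding coset_iso_def
    using conj[OF P H Q K f(1)] conj[OF Q K P H f(2)] iso
    by (simp add: coset_iso_def push_pull[OF P H] push_pull[OF Q K] pull_push[OF P H] pull_push[OF Q K]
        keys_push[OF P H] keys_push[OF Q K] coset_homD(1)[OF f(1)] coset_homD(1)[OF f(2)])
  then show ?thesis by blast
qed

subsection \<open>Normalising the isomorphism\<close>

lemma augment_simps [simp]:
  "augment 0 = 0" "augment (frag_of c) = frag_of ()" "augment (z + w) = augment z + augment w"
  "augment (z - w) = augment z - augment w" "augment (frag_cmul n z) = frag_cmul n (augment z)"
  by (simp_all add: augment_def frag_extend_add frag_extend_diff frag_extend_cmul)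

lemma augment_frag_act [simp]: "augment (frag_act G g z) = augment z"
  using subset_UNIV[of "Poly_Mapping.keys z"]
  by (induction z rule: frag_induction) (simp_all add: frag_act_def frag_extend_diff)

lemma frag_cmul_diff: "frag_cmul n (z - w) = frag_cmul n z - frag_cmul n w"
  by (rule poly_mapping_eqI) (simp add: lookup_minus right_diff_distrib)

lemma unit_frag: "z = frag_cmul (Poly_Mapping.lookup z ()) (frag_of ())"
  by (rule poly_mapping_eqI) simp

lemma unit_frag_eq: "frag_cmul m (frag_of ()) = frag_cmul n (frag_of ()) \<longleftrightarrow> m = n"
  by (metis lookup_frag_cmul lookup_frag_of mult.right_neutral)

text \<open>The augmentation of \<open>f(gH) = g f(H)\<close> is that of \<open>f(H)\<close>, for every \<open>g\<close>: the composite of \<open>f\<close> with the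
augmentation is a constant times the augmentation.\<close>

lemma (in group) augment_coset_hom:
  assumes H: "subgroup H G" and f: "coset_hom G H K f" and z: "Poly_Mapping.keys z \<subseteq> lcosets H"
  shows "augment (f z) = frag_cmul (Poly_Mapping.lookup (augment (f (frag_of H))) ()) (augment z)"
  using z
proof (induction rule: frag_induction_support)
  case (one c)
  then obtain g where g: "g \<in> carrier G" "c = g <# H" by (rule lcosetE)
  have "Poly_Mapping.keys (frag_of H) \<subseteq> lcosets H" using lcos_of_subgroup[OF H] by (simp add: keys_frag_of)
  note act = coset_homD(2)[OF f this g(1)]
  have "frag_act G g (frag_of H) = frag_of c" by (simp add: g(2) frag_act_def)
  then have "augment (f (frag_of c)) = augment (f (frag_of H))"
    using act augment_frag_act[of G g "f (frag_of H)"] by simp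
  also have "\<dots> = frag_cmul (Poly_Mapping.lookup (augment (f (frag_of H))) ()) (frag_of ())"
    by (rule unit_frag)
  finally show ?case by simp
qed (simp_all add: coset_hom_0[OF f] coset_hom_diff[OF f] frag_cmul_diff)

text \<open>The constants by which \<open>f\<close> and \<open>f'\<close> multiply the augmentation have product \<open>1\<close>, so both are \<open>1\<close> or both
are \<open>-1\<close>; in the second case \<open>f\<close> and \<open>f'\<close> are replaced by their negatives.\<close>

lemma coset_iso_normalized:
  assumes G: "group G" and H: "subgroup H G" and K: "subgroup K G" and iso: "coset_iso G H K f f'"
  obtains e e' where "coset_iso G H K e e'"
    "\<And>z. Poly_Mapping.keys z \<subseteq> lcosets\<^bsub>G\<^esub> H \<Longrightarrow> augment (e z) = augment z"
    "\<And>z. Poly_Mapping.keys z \<subseteq> lcosets\<^bsub>G\<^esub> K \<Longrightarrow> augment (e' z) = augment z"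
proof -
  have f: "coset_hom G H K f" "coset_hom G K H f'" using iso by (simp_all add: coset_iso_def)
  define n m where "n = Poly_Mapping.lookup (augment (f (frag_of H))) ()"
    and "m = Poly_Mapping.lookup (augment (f' (frag_of K))) ()"
  note an = group.augment_coset_hom[OF G H f(1), folded n_def]
  note am = group.augment_coset_hom[OF G K f(2), folded m_def]
  have Hk: "Poly_Mapping.keys (frag_of H) \<subseteq> lcosets\<^bsub>G\<^esub> H"
    using group.lcos_of_subgroup[OF G H] by (simp add: keys_frag_of)
  have "frag_of () = augment (f' (f (frag_of H)))" using iso Hk by (simp add: coset_iso_def)
  also have "\<dots> = frag_cmul (m * n) (frag_of ())"
    using am[OF coset_homD(1)[OF f(1) Hk]] an[OF Hk] by simp
  finally have "frag_cmul (m * n) (frag_of ()) = frag_cmul 1 (frag_of ())" by simp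
  then have "m * n = 1" by (simp only: unit_frag_eq)
  then consider "m = 1" "n = 1" | "m = -1" "n = -1" using zmult_eq_1_iff by blast
  then show thesis
  proof cases
    case 1
    then show thesis using that[OF iso] an am by simp
  next
    case 2
    have neg: "coset_hom G P Q (\<lambda>z. - e z)" if "coset_hom G P Q e" for P Q and e :: "('a set \<Rightarrow>\<^sub>0 int) \<Rightarrow> ('a set \<Rightarrow>\<^sub>0 int)"
      using that by (auto simp: coset_hom_def frag_act_def frag_extend_minus)
    have neg': "e (- z) = - e z" if "coset_hom G P Q e" "Poly_Mapping.keys z \<subseteq> lcosets\<^bsub>G\<^esub> P" 
      for P Q z and e :: "('a set \<Rightarrow>\<^sub>0 int) \<Rightarrow> ('a set \<Rightarrow>\<^sub>0 int)"
      using coset_hom_diff[OF that(1), of 0 z] coset_hom_0[OF that(1)] that(2) by simp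
    have "coset_iso G H K (\<lambda>z. - f z) (\<lambda>z. - f' z)"
      using iso neg[OF f(1)] neg[OF f(2)]
      by (auto simp: coset_iso_def neg'[OF f(1)] neg'[OF f(2)] coset_homD(1)[OF f(1)] coset_homD(1)[OF f(2)])
    moreover have "augment (- z) = - augment z" for z :: "'a set \<Rightarrow>\<^sub>0 int"
      using augment_simps(5)[of "-1" z] by simp
    ultimately show thesis using that an am 2 by simp
  qed
qed

text \<open>\<open>G\<close> permutes the cosets transitively, so all coefficients of an invariant element agree.\<close>

lemma (in group) invariant_frag:
  assumes K: "subgroup K G" and fin: "finite (lcosets K)" and w: "Poly_Mapping.keys w \<subseteq> lcosets K"
    and inv: "\<And>g. g \<in> carrier G \<Longrightarrow> frag_act G g w = w"
  shows "w = frag_cmul (Poly_Mapping.lookup w K) (norm_element G K)"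
proof (rule poly_mapping_eqI)
  fix c
  have N: "Poly_Mapping.lookup (norm_element G K) c = (if c \<in> lcosets K then 1 else 0)"
    using fin by (simp add: norm_element_def lookup_sum)
  show "Poly_Mapping.lookup w c = Poly_Mapping.lookup (frag_cmul (Poly_Mapping.lookup w K) (norm_element G K)) c"
  proof (cases "c \<in> lcosets K")
    case True
    then obtain g where g: "g \<in> carrier G" "c = g <# K" by (rule lcosetE)
    have "Poly_Mapping.lookup (frag_act G g w) (g <# K) = Poly_Mapping.lookup w K"
      using w
    proof (induction rule: frag_induction)
      case (one a)
      then show ?case
        using inj_onD[OF inj_on_lcos_act[OF K g(1)] _ one lcos_of_subgroup[OF K]] by (auto simp: frag_act_def)
    qed (simp_all add: frag_act_def frag_extend_diff lookup_minus)
    then show ?thesis using inv[OF g(1)] g(2) N True by simp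
  next
    case False
    then have "c \<notin> Poly_Mapping.keys w" using w by blast
    then show ?thesis using N False by (simp add: in_keys_iff)
  qed
qed

text \<open>The norm elements span the invariants, so \<open>e(N\<^sub>H) = m N\<^sub>K\<close> and \<open>e'(N\<^sub>K) = m' N\<^sub>H\<close>. Taking augmentations gives
\<open>|G/H| = m |G/K|\<close> and \<open>|G/K| = m' |G/H|\<close>, hence \<open>m m' = 1\<close> and \<open>m > 0\<close>.\<close>

lemma coset_iso_norm_element:
  fixes G (structure)
  assumes G: "group G" and H: "subgroup H G" and K: "subgroup K G" and iso: "coset_iso G H K e e'"
    and aug: "\<And>z. Poly_Mapping.keys z \<subseteq> lcosets\<^bsub>G\<^esub> H \<Longrightarrow> augment (e z) = augment z"
      "\<And>z. Poly_Mapping.keys z \<subseteq> lcosets\<^bsub>G\<^esub> K \<Longrightarrow> augment (e' z) = augment z"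
    and fin: "finite (lcosets\<^bsub>G\<^esub> H)" "finite (lcosets\<^bsub>G\<^esub> K)"
  shows "e (norm_element G H) = norm_element G K"
proof -
  interpret group G by fact
  have e: "coset_hom G H K e" "coset_hom G K H e'" using iso by (simp_all add: coset_iso_def)
  have scalar: "\<exists>m. f (norm_element G P) = frag_cmul m (norm_element G Q)"
    if f: "coset_hom G P Q f" and "subgroup P G" "subgroup Q G" "finite (lcosets P)" "finite (lcosets Q)" for f P Q
  proof -
    have "frag_act G g (f (norm_element G P)) = f (norm_element G P)" if "g \<in> carrier G" for g
      using coset_homD(2)[OF f keys_norm_element that] frag_act_norm_element[OF \<open>subgroup P G\<close> that \<open>finite (lcosets P)\<close>]
      by simp
    then show ?thesis
      using invariant_frag[OF \<open>subgroup Q G\<close> \<open>finite (lcosets Q)\<close> coset_homD(1)[OF f keys_norm_element]] by blast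
  qed
  have augN: "augment (norm_element G P) = frag_cmul (int (card (lcosets P))) (frag_of ())" if "finite (lcosets P)" for P
    using that by (simp add: norm_element_def augment_def frag_extend_sum comp_def frag_cmul_sum poly_mapping_eq_iff fun_eq_iff lookup_sum)
  obtain m m' where m: "e (norm_element G H) = frag_cmul m (norm_element G K)"
    and m': "e' (norm_element G K) = frag_cmul m' (norm_element G H)"
    using scalar[OF e(1) H K fin] scalar[OF e(2) K H fin(2,1)] by blast
  have "int (card (lcosets H)) = m * int (card (lcosets K))"
    using aug(1)[OF keys_norm_element] m by (simp add: augN fin unit_frag_eq)
  moreover have "int (card (lcosets K)) = m' * int (card (lcosets H))"
    using aug(2)[OF keys_norm_element] m' by (simp add: augN fin unit_frag_eq)
  moreover have "card (lcosets H) > 0" "card (lcosets K) > 0"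
    using fin lcos_of_subgroup[OF H] lcos_of_subgroup[OF K] by (auto simp: card_gt_0_iff)
  ultimately have eq: "int (card (lcosets H)) = m * (m' * int (card (lcosets H)))"
    and pos: "0 < m * int (card (lcosets K))" and cpos: "card (lcosets H) > 0" "card (lcosets K) > 0"
    by (metis, metis of_nat_0_less_iff, blast+)
  from eq cpos have "m * m' = 1" by simp
  moreover from pos cpos(2) have "m > 0" by (metis of_nat_0_less_iff zero_less_mult_pos2)
  ultimately have "m = 1" using zmult_eq_1_iff[of m m'] by auto
  then show ?thesis using m by simp
qed

section \<open>The comparison isomorphism\<close>

lemma tuples_restrict_eq: "restrict f (tuples (G\<lparr>carrier := H\<rparr>) k) = pullback H (\<lambda>x. x) k f"
  by (auto simp: tuples_eq pullback_def intro: restrict_ext)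

context group_module
begin

text \<open>Writing \<open>H\<^sup>k(H, A)\<close> as the cohomology of \<open>C(H, H)\<close>. The two differentials are given by different formulas,
which agree on cochains with values in the carrier of \<open>A\<close>.\<close>

lemma cohomology_EC:
  "cohomology (G\<lparr>carrier := H\<rparr>) A k = cocycles (EC H H) (list_diff A H) k Mod cobounds (EC H H) (list_diff A H) k"
  "coboundaries (G\<lparr>carrier := H\<rparr>) A k = cobounds (EC H H) (list_diff A H) k"
  "cocycle_group (G\<lparr>carrier := H\<rparr>) A k = cocycles (EC H H) (list_diff A H) k"
proof -
  have d: "cochain_diff (G\<lparr>carrier := H\<rparr>) A j f = list_diff A H j f" if "f \<in> carrier (EC H H j)" for j f
    using cochain_diff_eq[of f "G\<lparr>carrier := H\<rparr>" j] EC_closed[OF that] by simp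
  show b: "coboundaries (G\<lparr>carrier := H\<rparr>) A k = cobounds (EC H H) (list_diff A H) k"
    unfolding coboundaries_def cobounds_def cochain_group_eq(1) by (auto simp: d split: nat.split)
  show z: "cocycle_group (G\<lparr>carrier := H\<rparr>) A k = cocycles (EC H H) (list_diff A H) k"
    unfolding cocycle_group_def cocycles_def cochain_group_eq(1)
    by (rule arg_cong[where f = "\<lambda>c. EC H H k\<lparr>carrier := c\<rparr>"]) (auto simp: kernel_def d)
  show "cohomology (G\<lparr>carrier := H\<rparr>) A k = cocycles (EC H H) (list_diff A H) k Mod cobounds (EC H H) (list_diff A H) k"
    unfolding cohomology_def z b ..
qed

lemma induced_map_EC: "induced_map (G\<lparr>carrier := H\<rparr>) A k = class_map (EC H H) (list_diff A H) k"
  by (simp add: fun_eq_iff induced_map_def class_map_def coclass_def cohomology_EC)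

lemma stable_subgroup: "subgroup H G \<Longrightarrow> stable_under G H H" "subgroup H G \<Longrightarrow> stable_under G H (carrier G)"
  by (auto simp: stable_under_def subgroup_def)

lemma subgroup_carrier: "subgroup (carrier G) G"
  by (rule G.subgroup_self)

text \<open>The composite \<open>C(H, H) \<rightarrow> C(H, G) \<rightarrow> C(K, G) \<rightarrow> C(K, K)\<close>, where the outer maps induce isomorphisms on
cohomology and the middle one is the transfer along a \<open>K\<close>-invariant element of \<open>\<int>[G/H]\<close>.\<close>

definition comparison :: "'g set \<Rightarrow> 'g set \<Rightarrow> ('g set \<Rightarrow>\<^sub>0 int) \<Rightarrow> nat \<Rightarrow> ('g list \<Rightarrow> 'a) \<Rightarrow> ('g list \<Rightarrow> 'a)"
  where "comparison H K z k f =
    pullback K (\<lambda>x. x) k (transfer G A z k (pullback (carrier G) (to_subgroup H) k f))"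

lemma cochain_map_extend:
  assumes "subgroup H G"
  shows "cochain_map (EC H H) (list_diff A H) (EC H (carrier G)) (list_diff A (carrier G)) (pullback (carrier G) (to_subgroup H))"
  using cochain_map_pullback[OF stable_subgroup[OF assms] to_subgroup[OF assms]] .

lemma cochain_map_restrict:
  assumes "subgroup H G"
  shows "cochain_map (EC H (carrier G)) (list_diff A (carrier G)) (EC H H) (list_diff A H) (pullback H (\<lambda>x. x))"
  using stable_subgroup[OF assms] subgroup.subset[OF assms]
  by (intro cochain_map_pullback) auto

lemma cochain_map_comparison:
  assumes "subgroup H G" "subgroup K G" "Poly_Mapping.keys z \<subseteq> lcosets H" "\<And>g. g \<in> K \<Longrightarrow> frag_act G g z = z"
  shows "cochain_map (EC H H) (list_diff A H) (EC K K) (list_diff A K) (comparison H K z)"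
  unfolding comparison_def[abs_def]
  by (intro cochain_map_comp[OF cochain_map_comp[OF cochain_map_extend[OF assms(1)]
          cochain_map_transfer[OF assms(1) subgroup.subset[OF assms(2)] assms(3,4)]] cochain_map_restrict[OF assms(2)]])

lemma pullback_pullback:
  assumes "u \<in> V \<rightarrow> U"
  shows "pullback V u k (pullback U v k f) = pullback V (\<lambda>x. v (u x)) k f"
  unfolding pullback_def by (rule restrict_ext) (use map_lists_of[OF _ assms] in \<open>simp add: comp_def\<close>)

lemma pullback_id: "f \<in> carrier (EC H U k) \<Longrightarrow> pullback U (\<lambda>x. x) k f = f"
  by (auto simp: EC_simps pullback_def PiE_iff extensional_def)

text \<open>The composite pulls back along the \<open>H\<close>-map \<open>G \<rightarrow> H \<subseteq> G\<close>, which induces the same map as the identity.\<close>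

lemma coclass_extend_restrict:
  assumes H: "subgroup H G" and f: "f \<in> carrier (cocycles (EC H (carrier G)) (list_diff A (carrier G)) k)"
  shows "coclass (EC H (carrier G)) (list_diff A (carrier G)) k
      (pullback (carrier G) (to_subgroup H) k (pullback H (\<lambda>x. x) k f)) =
    coclass (EC H (carrier G)) (list_diff A (carrier G)) k f"
proof -
  note r = to_subgroup[OF H] and st = stable_subgroup(2)[OF H]
  have r': "to_subgroup H \<in> carrier G \<rightarrow> carrier G" using r(1) subgroup.subset[OF H] by blast
  show ?thesis
    using coclass_pullback_eq[OF st st _ r' _ r(2) f, of "\<lambda>x. x"]
      pullback_id[of f H "carrier G" k] f
    by (simp add: pullback_pullback[OF r(1)])
qed

text \<open>The composite pulls back along the \<open>H\<close>-map \<open>H \<subseteq> G \<rightarrow> H\<close>, which induces the same map as the identity.\<close>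

lemma coclass_restrict_extend:
  assumes H: "subgroup H G" and f: "f \<in> carrier (cocycles (EC H H) (list_diff A H) k)"
  shows "coclass (EC H H) (list_diff A H) k
      (pullback H (\<lambda>x. x) k (pullback (carrier G) (to_subgroup H) k f)) =
    coclass (EC H H) (list_diff A H) k f"
proof -
  note r = to_subgroup[OF H] and st = stable_subgroup(1)[OF H] and sub = subgroup.subset[OF H]
  have r': "to_subgroup H \<in> H \<rightarrow> H" using r(1) sub by blast
  have i: "(\<lambda>x. x) \<in> H \<rightarrow> carrier G" using sub by blast
  show ?thesis
    using coclass_pullback_eq[OF st st _ r' _ r(2) f, of "\<lambda>x. x"]
      pullback_id[of f H H k] f sub
    by (simp add: pullback_pullback[OF i] subset_iff)
qed

text \<open>Restricting to \<open>K\<close> and extending back does not change the class, so when a comparison map is followed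
by another one, or by co-restriction, the steps between the two transfers cancel on cohomology.\<close>

lemma comparison_extend:
  assumes H: "subgroup H G" and K: "subgroup K G"
    and z: "Poly_Mapping.keys z \<subseteq> lcosets H" "\<And>g. g \<in> K \<Longrightarrow> frag_act G g z = z"
    and f: "f \<in> carrier (cocycles (EC H H) (list_diff A H) k)"
  shows "transfer G A z k (pullback (carrier G) (to_subgroup H) k f) \<in>
      carrier (cocycles (EC K (carrier G)) (list_diff A (carrier G)) k)" 
    and "coclass (EC K (carrier G)) (list_diff A (carrier G)) k
      (pullback (carrier G) (to_subgroup K) k (comparison H K z k f)) =
    coclass (EC K (carrier G)) (list_diff A (carrier G)) k
      (transfer G A z k (pullback (carrier G) (to_subgroup H) k f))"
proof -
  note cH = cochain_complex_EC[OF stable_subgroup(1)[OF H]] cochain_complex_EC[OF stable_subgroup(2)[OF H]]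
  note cK = cochain_complex_EC[OF stable_subgroup(2)[OF K]]
  show *: "transfer G A z k (pullback (carrier G) (to_subgroup H) k f) \<in>
      carrier (cocycles (EC K (carrier G)) (list_diff A (carrier G)) k)"
    by (rule cochain_map_cocycle[OF cH(2) cK cochain_map_transfer[OF H subgroup.subset[OF K] z]
          cochain_map_cocycle[OF cH cochain_map_extend[OF H] f]])
  show "coclass (EC K (carrier G)) (list_diff A (carrier G)) k
      (pullback (carrier G) (to_subgroup K) k (comparison H K z k f)) =
    coclass (EC K (carrier G)) (list_diff A (carrier G)) k
      (transfer G A z k (pullback (carrier G) (to_subgroup H) k f))"
    unfolding comparison_def by (rule coclass_extend_restrict[OF K *])
qed

text \<open>The coset \<open>K\<close> is fixed by \<open>K\<close>, hence so is its image; such elements are the ones to transfer along.\<close>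

lemma image_of_trivial_coset:
  assumes H: "subgroup H G" and K: "subgroup K G" and e: "coset_hom G K H e"
  shows "Poly_Mapping.keys (e (frag_of K)) \<subseteq> lcosets H"
    and "g \<in> K \<Longrightarrow> frag_act G g (e (frag_of K)) = e (frag_of K)"
proof -
  have k: "Poly_Mapping.keys (frag_of K) \<subseteq> lcosets K"
    using G.lcos_of_subgroup[OF K] by (simp add: keys_frag_of)
  then show "Poly_Mapping.keys (e (frag_of K)) \<subseteq> lcosets H" by (rule coset_homD(1)[OF e])
  show "frag_act G g (e (frag_of K)) = e (frag_of K)" if g: "g \<in> K"
  proof -
    have "g <# K = K"
      using G.lcos_mult_one[OF subgroup.subset[OF K]] G.l_repr_independence[of g \<one> K] g K
      by (simp add: subgroup.mem_carrier)
    then have "frag_act G g (frag_of K) = frag_of K" by (simp add: frag_act_def)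
    then show ?thesis using coset_homD(2)[OF e k subgroup.mem_carrier[OF K g]] by simp
  qed
qed

text \<open>After the cancellation of \<open>comparison_extend\<close>, the two transfers compose to the transfer along
\<open>e'(e(H)) = H\<close>, which is the identity.\<close>

lemma comparison_comparison:
  assumes H: "subgroup H G" and K: "subgroup K G" and iso: "coset_iso G H K e e'"
    and f: "f \<in> carrier (cocycles (EC H H) (list_diff A H) k)"
  shows "coclass (EC H H) (list_diff A H) k
      (comparison K H (e (frag_of H)) k (comparison H K (e' (frag_of K)) k f)) =
    coclass (EC H H) (list_diff A H) k f"
proof -
  have e: "coset_hom G H K e" "coset_hom G K H e'" using iso by (simp_all add: coset_iso_def)
  let ?t = "e' (frag_of K)" and ?s = "e (frag_of H)"
  let ?x = "pullback (carrier G) (to_subgroup H) k f"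
  note t = image_of_trivial_coset[OF H K e(2)] and s = image_of_trivial_coset[OF K H e(1)]
  note cHH = cochain_complex_EC[OF stable_subgroup(1)[OF H]] and cH = cochain_complex_EC[OF stable_subgroup(2)[OF H]]
    and cKK = cochain_complex_EC[OF stable_subgroup(1)[OF K]] and cK = cochain_complex_EC[OF stable_subgroup(2)[OF K]]
  have f': "comparison H K ?t k f \<in> carrier (cocycles (EC K K) (list_diff A K) k)"
    by (rule cochain_map_cocycle[OF cHH cKK cochain_map_comparison[OF H K t] f])
  have x: "?x \<in> carrier (cocycles (EC H (carrier G)) (list_diff A (carrier G)) k)"
    by (rule cochain_map_cocycle[OF cHH cH cochain_map_extend[OF H] f])
  have "coclass (EC H (carrier G)) (list_diff A (carrier G)) k
      (transfer G A ?s k (pullback (carrier G) (to_subgroup K) k (comparison H K ?t k f))) =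
    coclass (EC H (carrier G)) (list_diff A (carrier G)) k (transfer G A ?s k (transfer G A ?t k ?x))"
    by (rule cochain_map_coclass_cong[OF cK cH cochain_map_transfer[OF K subgroup.subset[OF H] s]
          comparison_extend(1)[OF H K t f] cochain_map_cocycle[OF cKK cK cochain_map_extend[OF K] f']
          comparison_extend(2)[OF H K t f]])
  also have "transfer G A ?s k (transfer G A ?t k ?x) = ?x"
    using transfer_transfer[OF H K e(2) t(2) _ s(1)] transfer_base[OF H] x iso G.lcos_of_subgroup[OF H]
    by (simp add: coset_iso_def keys_frag_of)
  finally have eq: "coclass (EC H (carrier G)) (list_diff A (carrier G)) k
      (transfer G A ?s k (pullback (carrier G) (to_subgroup K) k (comparison H K ?t k f))) =
    coclass (EC H (carrier G)) (list_diff A (carrier G)) k ?x" .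
  have "coclass (EC H H) (list_diff A H) k (comparison K H ?s k (comparison H K ?t k f)) =
    coclass (EC H H) (list_diff A H) k (pullback H (\<lambda>x. x) k ?x)"
    unfolding comparison_def[of K H]
    by (rule cochain_map_coclass_cong[OF cH cHH cochain_map_restrict[OF H] x comparison_extend(1)[OF K H s f'] eq])
  then show ?thesis using coclass_restrict_extend[OF H f] by simp
qed

text \<open>A cocycle of \<open>G\<close> restricted to \<open>H\<close> and extended back is cohomologous to itself in \<open>C(H, G)\<close>, and the
transfer along an element of augmentation \<open>1\<close> fixes it.\<close>

lemma comparison_restrict:
  assumes H: "subgroup H G" and K: "subgroup K G"
    and z: "Poly_Mapping.keys z \<subseteq> lcosets H" "\<And>g. g \<in> K \<Longrightarrow> frag_act G g z = z" "augment z = frag_of ()"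
    and f: "f \<in> carrier (cocycles (EC (carrier G) (carrier G)) (list_diff A (carrier G)) k)"
  shows "coclass (EC K K) (list_diff A K) k (comparison H K z k (pullback H (\<lambda>x. x) k f)) =
    coclass (EC K K) (list_diff A K) k (pullback K (\<lambda>x. x) k f)"
proof -
  note cHH = cochain_complex_EC[OF stable_subgroup(1)[OF H]] and cH = cochain_complex_EC[OF stable_subgroup(2)[OF H]]
    and cKK = cochain_complex_EC[OF stable_subgroup(1)[OF K]] and cK = cochain_complex_EC[OF stable_subgroup(2)[OF K]]
  have f': "f \<in> carrier (cocycles (EC H (carrier G)) (list_diff A (carrier G)) k)"
    using cochain_map_cocycle[OF cochain_complex_EC[OF stable_subgroup(2)[OF subgroup_carrier]] cH
        cochain_map_subgroup[OF subgroup.subset[OF H]] f] .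
  note tm = cochain_map_comp[OF cochain_map_transfer[OF H subgroup.subset[OF K] z(1,2)] cochain_map_restrict[OF K]]
  have r: "pullback H (\<lambda>x. x) k f \<in> carrier (cocycles (EC H H) (list_diff A H) k)"
    by (rule cochain_map_cocycle[OF cH cHH cochain_map_restrict[OF H] f'])
  have "coclass (EC K K) (list_diff A K) k (comparison H K z k (pullback H (\<lambda>x. x) k f)) =
    coclass (EC K K) (list_diff A K) k (pullback K (\<lambda>x. x) k (transfer G A z k f))"
    unfolding comparison_def
    by (rule cochain_map_coclass_cong[OF cH cKK tm f' cochain_map_cocycle[OF cHH cH cochain_map_extend[OF H] r]
          coclass_extend_restrict[OF H f']])
  also have "transfer G A z k f = f"
    using f by (intro transfer_invariant[OF H _ z(1,3)]) simp
  finally show ?thesis .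
qed

lemma cochain_map_cor:
  assumes H: "subgroup H G" and fin: "finite (rcosets H)"
  shows "cochain_map (EC H H) (list_diff A H) (EC (carrier G) (carrier G)) (list_diff A (carrier G)) (cochain_cor G H A)"
proof -
  have finl: "finite (lcosets H)" using G.rcosets_lcosets_bij[OF H] fin bij_betw_finite by blast
  have "cochain_map (EC H H) (list_diff A H) (EC (carrier G) (carrier G)) (list_diff A (carrier G))
    (\<lambda>k f. transfer G A (norm_element G H) k (pullback (carrier G) (to_subgroup H) k f))"
    by (rule cochain_map_comp[OF cochain_map_extend[OF H] cochain_map_transfer[OF H subset_refl G.keys_norm_element]])
      (rule G.frag_act_norm_element[OF H _ finl])
  then show ?thesis
    using comm_groupE(1)[OF comm_group_EC[OF stable_subgroup(1)[OF H]]]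
      list_diff_closed[OF stable_subgroup(1)[OF H]]
    unfolding cochain_map_def hom_def Pi_iff by (simp add: cochain_cor_eq[OF H fin])
qed

text \<open>Co-restriction from \<open>K\<close> is the transfer along \<open>N\<^sub>K\<close>. Preceded by the transfer along \<open>e'(K)\<close> it becomes
the transfer along \<open>e'(N\<^sub>K) = N\<^sub>H\<close>, that is, co-restriction from \<open>H\<close>.\<close>

lemma comparison_cor:
  assumes H: "subgroup H G" and K: "subgroup K G" and iso: "coset_iso G H K e e'"
    and norm: "e' (norm_element G K) = norm_element G H"
    and fin: "finite (rcosets H)" "finite (rcosets K)"
    and f: "f \<in> carrier (cocycles (EC H H) (list_diff A H) k)"
  shows "coclass (EC (carrier G) (carrier G)) (list_diff A (carrier G)) k
      (cochain_cor G K A k (comparison H K (e' (frag_of K)) k f)) =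
    coclass (EC (carrier G) (carrier G)) (list_diff A (carrier G)) k (cochain_cor G H A k f)"
proof -
  have e: "coset_hom G K H e'" using iso by (simp_all add: coset_iso_def)
  let ?t = "e' (frag_of K)"
  let ?x = "pullback (carrier G) (to_subgroup H) k f"
  note t = image_of_trivial_coset[OF H K e]
  have finl: "finite (lcosets K)" using G.rcosets_lcosets_bij[OF K] fin(2) bij_betw_finite by blast
  note cHH = cochain_complex_EC[OF stable_subgroup(1)[OF H]] and cH = cochain_complex_EC[OF stable_subgroup(2)[OF H]]
    and cKK = cochain_complex_EC[OF stable_subgroup(1)[OF K]] and cK = cochain_complex_EC[OF stable_subgroup(2)[OF K]]
    and cG = cochain_complex_EC[OF stable_subgroup(2)[OF subgroup_carrier]]
  have f': "comparison H K ?t k f \<in> carrier (cocycles (EC K K) (list_diff A K) k)"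
    by (rule cochain_map_cocycle[OF cHH cKK cochain_map_comparison[OF H K t] f])
  have x: "?x \<in> carrier (cocycles (EC H (carrier G)) (list_diff A (carrier G)) k)"
    by (rule cochain_map_cocycle[OF cHH cH cochain_map_extend[OF H] f])
  have "coclass (EC (carrier G) (carrier G)) (list_diff A (carrier G)) k
      (transfer G A (norm_element G K) k (pullback (carrier G) (to_subgroup K) k (comparison H K ?t k f))) =
    coclass (EC (carrier G) (carrier G)) (list_diff A (carrier G)) k
      (transfer G A (norm_element G K) k (transfer G A ?t k ?x))"
    by (rule cochain_map_coclass_cong[OF cK cG cochain_map_transfer[OF K subset_refl G.keys_norm_element G.frag_act_norm_element[OF K _ finl]]
          comparison_extend(1)[OF H K t f] cochain_map_cocycle[OF cKK cK cochain_map_extend[OF K] f']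
          comparison_extend(2)[OF H K t f]])
  also have "transfer G A (norm_element G K) k (transfer G A ?t k ?x) = transfer G A (norm_element G H) k ?x"
    using transfer_transfer[OF H K e t(2) _ G.keys_norm_element] x norm by simp
  finally show ?thesis
    using cochain_cor_eq[OF K fin(2)] cochain_cor_eq[OF H fin(1)] f f' by simp
qed

text \<open>The comparison map is the transfer along \<open>e'(K)\<close>, which corresponds to the module map \<open>e'\<close> from
\<open>\<int>[G/K]\<close> to \<open>\<int>[G/H]\<close>: cohomology is contravariant in the module, so a map from \<open>H\<^sup>k(H, A)\<close> to \<open>H\<^sup>k(K, A)\<close>
needs the inverse of \<open>e\<close>.\<close>

lemma coset_iso_cohomology:
  assumes H: "subgroup H G" and K: "subgroup K G" and iso: "coset_iso G H K e e'"
    and aug: "\<And>z. Poly_Mapping.keys z \<subseteq> lcosets H \<Longrightarrow> augment (e z) = augment z"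
      "\<And>z. Poly_Mapping.keys z \<subseteq> lcosets K \<Longrightarrow> augment (e' z) = augment z"
  shows "\<exists>\<Psi> \<in> iso (cohomology (G\<lparr>carrier := H\<rparr>) A k) (cohomology (G\<lparr>carrier := K\<rparr>) A k).
           compatible G H K A k \<Psi>"
proof
  have e: "coset_hom G H K e" "coset_hom G K H e'" using iso by (simp_all add: coset_iso_def)
  let ?t = "e' (frag_of K)" and ?s = "e (frag_of H)"
  let ?\<theta> = "comparison H K ?t"
  let ?\<Psi> = "class_map (EC K K) (list_diff A K) k (?\<theta> k)"
  note t = image_of_trivial_coset[OF H K e(2)] and s = image_of_trivial_coset[OF K H e(1)]
  note cHH = cochain_complex_EC[OF stable_subgroup(1)[OF H]] and cH = cochain_complex_EC[OF stable_subgroup(2)[OF H]]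
    and cKK = cochain_complex_EC[OF stable_subgroup(1)[OF K]] and cK = cochain_complex_EC[OF stable_subgroup(2)[OF K]]
    and cG = cochain_complex_EC[OF stable_subgroup(2)[OF subgroup_carrier]]
  have m: "cochain_map (EC H H) (list_diff A H) (EC K K) (list_diff A K) ?\<theta>"
    by (rule cochain_map_comparison[OF H K t])
  have m': "cochain_map (EC K K) (list_diff A K) (EC H H) (list_diff A H) (comparison K H ?s)"
    by (rule cochain_map_comparison[OF K H s])
  show iso': "?\<Psi> \<in> iso (cohomology (G\<lparr>carrier := H\<rparr>) A k) (cohomology (G\<lparr>carrier := K\<rparr>) A k)"
    unfolding cohomology_EC
    by (rule class_map_iso[OF cHH cKK m m'])
      (fact comparison_comparison[OF H K iso] comparison_comparison[OF K H coset_iso_sym[OF iso]])+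
  have augt: "augment ?t = frag_of ()"
    using aug(2)[of "frag_of K"] G.lcos_of_subgroup[OF K] by (simp add: keys_frag_of)
  have res: "?\<Psi> (cohomology_res G H A k C) = cohomology_res G K A k C" if C: "C \<in> carrier (cohomology G A k)" for C
  proof -
    obtain f where f: "f \<in> carrier (cocycles (EC (carrier G) (carrier G)) (list_diff A (carrier G)) k)"
      and C: "C = coclass (EC (carrier G) (carrier G)) (list_diff A (carrier G)) k f"
      using C cohomology_EC(1)[of "carrier G" k] cochain_complex.carrier_cohomology[OF cG, of k]
      by (auto simp del: cocycles_simps)
    have rm: "cochain_map (EC (carrier G) (carrier G)) (list_diff A (carrier G)) (EC L L) (list_diff A L) (pullback L (\<lambda>x. x))"
      if "subgroup L G" for L
      using cochain_map_comp[OF cochain_map_subgroup[OF subgroup.subset[OF that]] cochain_map_restrict[OF that]] by simp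
    have r: "cohomology_res G L A k C = coclass (EC L L) (list_diff A L) k (pullback L (\<lambda>x. x) k f)" if L: "subgroup L G" for L
      unfolding cohomology_res_def induced_map_EC tuples_restrict_eq C
      by (rule class_map_coclass[OF cG cochain_complex_EC[OF stable_subgroup(1)[OF L]] rm[OF L] f])
    show ?thesis
      unfolding r[OF H] r[OF K] class_map_coclass[OF cHH cKK m cochain_map_cocycle[OF cG cHH rm[OF H] f]]
      by (rule comparison_restrict[OF H K t augt f])
  qed
  have cor: "cohomology_cor G K A k (?\<Psi> D) = cohomology_cor G H A k D"
    if D: "D \<in> carrier (cohomology (G\<lparr>carrier := H\<rparr>) A k)" and fin: "finite (rcosets H)" "finite (rcosets K)" for D
  proof -
    obtain f where f: "f \<in> carrier (cocycles (EC H H) (list_diff A H) k)"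
      and D: "D = coclass (EC H H) (list_diff A H) k f"
      using D cochain_complex.carrier_cohomology[OF cHH, of k] by (auto simp: cohomology_EC simp del: cocycles_simps)
    note f' = cochain_map_cocycle[OF cHH cKK m f]
    have finl: "finite (lcosets H)" "finite (lcosets K)"
      using G.rcosets_lcosets_bij[OF H] G.rcosets_lcosets_bij[OF K] fin bij_betw_finite by blast+
    have norm: "e' (norm_element G K) = norm_element G H"
      by (rule coset_iso_norm_element[OF G.is_group K H coset_iso_sym[OF iso] aug(2,1) finl(2,1)])
    have c: "cohomology_cor G L A k (coclass (EC L L) (list_diff A L) k x) =
        coclass (EC (carrier G) (carrier G)) (list_diff A (carrier G)) k (cochain_cor G L A k x)"
      if L: "subgroup L G" "finite (rcosets L)" and x: "x \<in> carrier (cocycles (EC L L) (list_diff A L) k)" for L x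
      unfolding cohomology_cor_def induced_map_EC[of "carrier G" k, simplified]
      by (rule class_map_coclass[OF cochain_complex_EC[OF stable_subgroup(1)[OF L(1)]] cG cochain_map_cor[OF L] x])
    show ?thesis
      unfolding D class_map_coclass[OF cHH cKK m f] c[OF K fin(2) f'] c[OF H fin(1) f]
      by (rule comparison_cor[OF H K iso norm fin f])
  qed
  show "compatible G H K A k ?\<Psi>"
    unfolding compatible_def using iso' res cor by (auto simp: iso_def)
qed

end

theorem lemma3p4:
  fixes \<Gamma> :: "('g, 'm) monoid_scheme"
    and G :: "('h, 'n) monoid_scheme"
    and A :: "('g \<Rightarrow>\<^sub>0 int, 'a, 'p) module_scheme"
    and k :: nat
  assumes "group \<Gamma>" and "group G"
    and "\<psi> \<in> epi \<Gamma> G"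
    and "subgroup P\<^sub>1 G" and "subgroup P\<^sub>2 G"
    and "Z_equivalent G P\<^sub>1 P\<^sub>2"
    and "\<Gamma>\<^sub>1 = {x \<in> carrier \<Gamma>. \<psi> x \<in> P\<^sub>1}"
    and "\<Gamma>\<^sub>2 = {x \<in> carrier \<Gamma>. \<psi> x \<in> P\<^sub>2}"
    and "left_module (group_ring \<Gamma>) A"
  shows "\<exists>\<Psi> \<in> iso (cohomology (\<Gamma>\<lparr>carrier := \<Gamma>\<^sub>1\<rparr>) A k) (cohomology (\<Gamma>\<lparr>carrier := \<Gamma>\<^sub>2\<rparr>) A k).
           compatible \<Gamma> \<Gamma>\<^sub>1 \<Gamma>\<^sub>2 A k \<Psi>"
proof -
  interpret group_module \<Gamma> A by (rule group_module_left_module) fact+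
  have H: "subgroup \<Gamma>\<^sub>1 \<Gamma>" and K: "subgroup \<Gamma>\<^sub>2 \<Gamma>"
    using lcosets_vimage_bij(1)[OF assms(1-4,7)] lcosets_vimage_bij(1)[OF assms(1-3,5,8)] .
  obtain f f' where "coset_iso G P\<^sub>1 P\<^sub>2 f f'"
    using Z_equivalent_coset_iso[OF assms(2,4-6)] .
  then obtain f f' where iso: "coset_iso \<Gamma> \<Gamma>\<^sub>1 \<Gamma>\<^sub>2 f f'"
    using coset_iso_vimage[OF assms(1-5,7,8)] by blast
  obtain e e' where "coset_iso \<Gamma> \<Gamma>\<^sub>1 \<Gamma>\<^sub>2 e e'"
    "\<And>z. Poly_Mapping.keys z \<subseteq> lcosets\<^bsub>\<Gamma>\<^esub> \<Gamma>\<^sub>1 \<Longrightarrow> augment (e z) = augment z"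
    "\<And>z. Poly_Mapping.keys z \<subseteq> lcosets\<^bsub>\<Gamma>\<^esub> \<Gamma>\<^sub>2 \<Longrightarrow> augment (e' z) = augment z"
    using coset_iso_normalized[OF assms(1) H K iso] by blast
  then show ?thesis by (rule coset_iso_cohomology[OF H K])
qed

end
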